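(* There exist absolute constants $0<c_1\le c_2$ (independent of $n$, $A$, $f$, $q$, $\varepsilon$, $\delta$) such that the following holds. Let $f:[0,\infty)\to[0,\infty)$ be operator monotone with $f(0)=0$, let $A\in\mathbb{R}^{n\times n}$ be symmetric positive semi-definite, let $\varepsilon>0$ and $\delta\in(0,1/2]$. Then one can choose an integer $r=\ell$ with $$c_1\big(\sqrt{\log(\delta^{-1})}\,\varepsilon^{-1}+\log(\delta^{-1})\big)\le r=\ell\le c_2\big(\sqrt{\log(\delta^{-1})}\,\varepsilon^{-1}+\log(\delta^{-1})\big)$$ such that, for any integer $q\ge 2$, the output $\mathrm{tr}^{\mathsf{fn++}}_{r,\ell}(f(A))$ of the funNyström++ algorithm satisfies $$\big|\mathrm{tr}^{\mathsf{fn++}}_{r,\ell}(f(A))-\mathrm{tr}(f(A))\big|\le\varepsilon\,\mathrm{tr}(f(A))$$ with probability at least $1-\delta$.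
   Context: For a symmetric matrix $B=V\,\mathrm{diag}(\mu_1,\dots,\mu_n)V^T$ with $V$ orthogonal, $f(B)=V\,\mathrm{diag}(f(\mu_1),\dots,f(\mu_n))V^T$. A function $f:[0,\infty)\to[0,\infty)$ is operator monotone if for every size and all symmetric positive semi-definite $B,C$ with $B\succeq C$ (i.e. $B-C$ positive semi-definite) one has $f(B)\succeq f(C)$. A Gaussian random matrix has i.i.d. standard normal entries. funNyström++ (in exact arithmetic) with parameters $r$ (rank), $\ell$ (number of samples), $q$ (number of subspace iterations): draw an $n\times r$ Gaussian random matrix $\Omega$ and form the Nyström approximation $$\widehat{A}_{q,r}=A^q\Omega\,(\Omega^TA^{2q-1}\Omega)^{\dagger}\,(A^q\Omega)^T$$ ($\dagger$ the Moore–Penrose pseudoinverse); draw an $n\times\ell$ Gaussian random matrix $\Phi$ independent of $\Omega$, and for a symmetric matrix $B$ set $\mathrm{tr}_\ell(B)=\frac1\ell\,\mathrm{tr}(\Phi^TB\Phi)$. The output is $$\mathrm{tr}^{\mathsf{fn++}}_{r,\ell}(f(A))=\mathrm{tr}\big(f(\widehat{A}_{q,r})\big)+\mathrm{tr}_\ell\big(f(A)-f(\widehat{A}_{q,r})\big).$$ *)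

theory Defs
  imports "HOL-Probability.Probability" "Jordan_Normal_Form.Matrix"
begin

definition mat_trace :: "'a::comm_monoid_add mat \<Rightarrow> 'a" where
  "mat_trace B = (\<Sum>i<dim_row B. B $$ (i, i))"

definition symmetric_mat :: "nat \<Rightarrow> real mat \<Rightarrow> bool" where
  "symmetric_mat n B \<longleftrightarrow> B \<in> carrier_mat n n \<and> transpose_mat B = B"

definition psd_mat :: "nat \<Rightarrow> real mat \<Rightarrow> bool" where
  "psd_mat n B \<longleftrightarrow> symmetric_mat n B \<and> (\<forall>x\<in>carrier_vec n. 0 \<le> Matrix.scalar_prod x (B *\<^sub>v x))"

(* Orthonormal columns; the library's orthogonal_mat only requires pairwise orthogonal columns. *)
definition orthonormal_mat :: "nat \<Rightarrow> real mat \<Rightarrow> bool" where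
  "orthonormal_mat n V \<longleftrightarrow>
     V \<in> carrier_mat n n \<and> transpose_mat V * V = 1\<^sub>m n \<and> V * transpose_mat V = 1\<^sub>m n"

(* f(B) for symmetric B. The result does not depend on the chosen spectral decomposition
   (see mat_fun_eqI), so THE picks a genuine matrix whenever B is symmetric. *)
definition mat_fun :: "(real \<Rightarrow> real) \<Rightarrow> real mat \<Rightarrow> real mat" where
  "mat_fun f B = (THE F. \<exists>V \<mu>. orthonormal_mat (dim_row B) V \<and>
      B = V * mat_diag (dim_row B) \<mu> * transpose_mat V \<and>
      F = V * mat_diag (dim_row B) (\<lambda>i. f (\<mu> i)) * transpose_mat V)"

lemma spectral_unique:
  assumes V: "orthonormal_mat n V" and W: "orthonormal_mat n W"
    and eq: "V * mat_diag n \<mu> * transpose_mat V = W * mat_diag n \<nu> * transpose_mat W"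
  shows "V * mat_diag n (\<lambda>i. f (\<mu> i)) * transpose_mat V =
         W * mat_diag n (\<lambda>i. f (\<nu> i)) * transpose_mat W"
proof -
  define U where "U = transpose_mat W * V"
  have cV: "V \<in> carrier_mat n n" "transpose_mat V \<in> carrier_mat n n"
    and cW: "W \<in> carrier_mat n n" "transpose_mat W \<in> carrier_mat n n"
    and V1: "transpose_mat V * V = 1\<^sub>m n" "V * transpose_mat V = 1\<^sub>m n"
    and W1: "transpose_mat W * W = 1\<^sub>m n" "W * transpose_mat W = 1\<^sub>m n"
    using V W by (auto simp: orthonormal_mat_def)
  have cU: "U \<in> carrier_mat n n" using cV cW by (simp add: U_def)
  have cD: "mat_diag n g \<in> carrier_mat n n" for g :: "nat \<Rightarrow> real" by simp
  note [simp] = cV cW cU cD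
  have conj: "transpose_mat W * (V * mat_diag n g * transpose_mat V) * V = U * mat_diag n g" for g
  proof -
    have "transpose_mat W * (V * mat_diag n g * transpose_mat V) * V
        = transpose_mat W * V * mat_diag n g * (transpose_mat V * V)"
      by (simp add: assoc_mult_mat[of _ n n _ n _ n] mult_carrier_mat[of _ n n _ n])
    then show ?thesis by (simp add: V1 U_def right_mult_one_mat[of _ n n] mult_carrier_mat[of _ n n _ n])
  qed
  have conj': "transpose_mat W * (W * mat_diag n g * transpose_mat W) * V = mat_diag n g * U" for g
  proof -
    have "transpose_mat W * (W * mat_diag n g * transpose_mat W) * V
        = (transpose_mat W * W) * mat_diag n g * (transpose_mat W * V)"
      by (simp add: assoc_mult_mat[of _ n n _ n _ n] mult_carrier_mat[of _ n n _ n])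
    then show ?thesis by (simp add: W1 U_def left_mult_one_mat[of _ n n] mult_carrier_mat[of _ n n _ n])
  qed
  have unconj: "X = W * (transpose_mat W * X * V) * transpose_mat V" if [simp]: "X \<in> carrier_mat n n" for X
  proof -
    have "W * (transpose_mat W * X * V) * transpose_mat V
        = (W * transpose_mat W) * X * (V * transpose_mat V)"
      by (simp add: assoc_mult_mat[of _ n n _ n _ n] mult_carrier_mat[of _ n n _ n])
    then show ?thesis by (simp add: W1 V1 left_mult_one_mat[of _ n n] right_mult_one_mat[of _ n n])
  qed
  have UD: "U * mat_diag n \<mu> = mat_diag n \<nu> * U"
    using conj[of \<mu>] conj'[of \<nu>] by (simp add: eq)
  have "U * mat_diag n (\<lambda>i. f (\<mu> i)) = mat_diag n (\<lambda>i. f (\<nu> i)) * U"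
  proof (rule eq_matI)
    fix i j assume "i < dim_row (mat_diag n (\<lambda>i. f (\<nu> i)) * U)" "j < dim_col (mat_diag n (\<lambda>i. f (\<nu> i)) * U)"
    then have ij: "i < n" "j < n" using cU by (auto simp: mat_diag_def)
    have "(U * mat_diag n \<mu>) $$ (i,j) = (mat_diag n \<nu> * U) $$ (i,j)" by (simp only: UD)
    then have "U $$ (i,j) * \<mu> j = \<nu> i * U $$ (i,j)"
      using ij by (simp add: mat_diag_mult_left[of _ n n] mat_diag_mult_right[of _ n n])
    then have "U $$ (i,j) * f (\<mu> j) = f (\<nu> i) * U $$ (i,j)" by (cases "U $$ (i,j) = 0") auto
    then show "(U * mat_diag n (\<lambda>i. f (\<mu> i))) $$ (i,j) = (mat_diag n (\<lambda>i. f (\<nu> i)) * U) $$ (i,j)"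
      using ij by (simp add: mat_diag_mult_left[of _ n n] mat_diag_mult_right[of _ n n])
  qed (use carrier_matD[OF cU] in \<open>simp_all add: mat_diag_def\<close>)
  then have "transpose_mat W * (V * mat_diag n (\<lambda>i. f (\<mu> i)) * transpose_mat V) * V
    = transpose_mat W * (W * mat_diag n (\<lambda>i. f (\<nu> i)) * transpose_mat W) * V"
    by (simp only: conj conj')
  then show ?thesis
    using unconj[of "V * mat_diag n (\<lambda>i. f (\<mu> i)) * transpose_mat V"]
      unconj[of "W * mat_diag n (\<lambda>i. f (\<nu> i)) * transpose_mat W"]
    by (simp add: mult_carrier_mat[of _ n n _ n])
qed

lemma mat_fun_eqI:
  assumes V: "orthonormal_mat n V" and B: "B = V * mat_diag n \<mu> * transpose_mat V"
  shows "mat_fun f B = V * mat_diag n (\<lambda>i. f (\<mu> i)) * transpose_mat V"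
proof -
  have "dim_row B = n" using V by (auto simp: B orthonormal_mat_def)
  moreover have "F = V * mat_diag n (\<lambda>i. f (\<mu> i)) * transpose_mat V"
    if "orthonormal_mat n W" "B = W * mat_diag n \<nu> * transpose_mat W"
      "F = W * mat_diag n (\<lambda>i. f (\<nu> i)) * transpose_mat W" for F W \<nu>
    using spectral_unique[OF that(1) V, of \<nu> \<mu> f] that(2,3) B by simp
  ultimately show ?thesis
    unfolding mat_fun_def using V B by (intro the_equality) blast+
qed

definition loewner_le :: "nat \<Rightarrow> real mat \<Rightarrow> real mat \<Rightarrow> bool" where
  "loewner_le n C B \<longleftrightarrow> C \<in> carrier_mat n n \<and> B \<in> carrier_mat n n \<and> psd_mat n (B - C)"

definition operator_monotone :: "(real \<Rightarrow> real) \<Rightarrow> bool" where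
  "operator_monotone f \<longleftrightarrow> (\<forall>m B C. psd_mat m B \<longrightarrow> psd_mat m C \<longrightarrow>
     loewner_le m C B \<longrightarrow> loewner_le m (mat_fun f C) (mat_fun f B))"

definition is_moore_penrose :: "real mat \<Rightarrow> real mat \<Rightarrow> bool" where
  "is_moore_penrose M X \<longleftrightarrow> X \<in> carrier_mat (dim_col M) (dim_row M) \<and>
     M * X * M = M \<and> X * M * X = X \<and>
     transpose_mat (M * X) = M * X \<and> transpose_mat (X * M) = X * M"

definition moore_penrose :: "real mat \<Rightarrow> real mat" where
  "moore_penrose M = (THE X. is_moore_penrose M X)"

lemma moore_penrose_eqI:
  assumes X: "is_moore_penrose M X"
  shows "moore_penrose M = X"
  unfolding moore_penrose_def
proof (rule the_equality)
  show "is_moore_penrose M X" by (fact X)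
next
  fix Y assume Y: "is_moore_penrose M Y"
  define a b where "a = dim_row M" and "b = dim_col M"
  have M: "M \<in> carrier_mat a b" by (simp add: a_def b_def)
  have cX: "X \<in> carrier_mat b a" and cY: "Y \<in> carrier_mat b a"
    using X Y by (auto simp: is_moore_penrose_def a_def b_def)
  have x: "M * X * M = M" "X * M * X = X" "transpose_mat (M * X) = M * X" "transpose_mat (X * M) = X * M"
    using X by (auto simp: is_moore_penrose_def)
  have y: "M * Y * M = M" "Y * M * Y = Y" "transpose_mat (M * Y) = M * Y" "transpose_mat (Y * M) = Y * M"
    using Y by (auto simp: is_moore_penrose_def)
  note c [simp] = mult_carrier_mat[OF M cX] mult_carrier_mat[OF cX M] mult_carrier_mat[OF M cY] mult_carrier_mat[OF cY M]
  have "X * M = X * (M * Y * M)" by (simp only: y)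
  also have "\<dots> = X * M * (Y * M)"
    by (simp only: assoc_mult_mat[OF M cY M] assoc_mult_mat[OF cX M c(4)])
  also have "\<dots> = transpose_mat (X * M) * transpose_mat (Y * M)" by (simp only: x y)
  also have "\<dots> = transpose_mat (Y * M * (X * M))"
    by (rule transpose_mult[symmetric]) (rule c)+
  also have "Y * M * (X * M) = Y * (M * X * M)"
    by (simp only: assoc_mult_mat[OF cY M c(2)] assoc_mult_mat[OF M cX M])
  finally have 1: "X * M = Y * M" by (simp only: x y)
  have "M * X = M * Y * M * X" by (simp only: y)
  also have "\<dots> = M * Y * (M * X)"
    by (simp only: assoc_mult_mat[OF c(3) M cX])
  also have "\<dots> = transpose_mat (M * Y) * transpose_mat (M * X)" by (simp only: x y)
  also have "\<dots> = transpose_mat (M * X * (M * Y))"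
    by (rule transpose_mult[symmetric]) (rule c)+
  also have "M * X * (M * Y) = M * X * M * Y"
    by (simp only: assoc_mult_mat[OF c(1) M cY])
  finally have 2: "M * X = M * Y" by (simp only: x y)
  have "Y = X * M * Y" by (simp only: 1 y)
  also have "\<dots> = X * (M * X)"
    by (simp only: 2 assoc_mult_mat[OF cX M cY])
  also have "\<dots> = X * M * X" by (simp only: assoc_mult_mat[OF cX M cX])
  finally show "Y = X" by (simp only: x)
qed

definition nystrom :: "nat \<Rightarrow> real mat \<Rightarrow> real mat \<Rightarrow> real mat" where
  "nystrom q A \<Omega> = (A ^\<^sub>m q * \<Omega>) * moore_penrose (transpose_mat \<Omega> * A ^\<^sub>m (2 * q - 1) * \<Omega>)
     * transpose_mat (A ^\<^sub>m q * \<Omega>)"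

(* The number of samples is the number of columns of \<Phi>. *)
definition trace_estimate :: "real mat \<Rightarrow> real mat \<Rightarrow> real" where
  "trace_estimate \<Phi> B = mat_trace (transpose_mat \<Phi> * B * \<Phi>) / real (dim_col \<Phi>)"

definition fun_nystrom_pp :: "(real \<Rightarrow> real) \<Rightarrow> nat \<Rightarrow> real mat \<Rightarrow> real mat \<Rightarrow> real mat \<Rightarrow> real" where
  "fun_nystrom_pp f q A \<Omega> \<Phi> = mat_trace (mat_fun f (nystrom q A \<Omega>))
     + trace_estimate \<Phi> (mat_fun f A - mat_fun f (nystrom q A \<Omega>))"

(* Joint law of the entries (i, j), i < n, j < k, of an n x k Gaussian random matrix;
   an outcome g is turned into a matrix by Matrix.mat n k g. *)
definition gaussian_entries :: "nat \<Rightarrow> nat \<Rightarrow> (nat \<times> nat \<Rightarrow> real) measure" where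
  "gaussian_entries n k = PiM ({..<n} \<times> {..<k}) (\<lambda>_. density lborel (\<lambda>x. ennreal (std_normal_density x)))"

end

theory Submission
  imports Defs "Jordan_Normal_Form.Spectral_Radius"
begin

text \<open>
  Write \<open>B = A^(q - 1/2)\<close>, \<open>p = 2 q - 1\<close> and \<open>T = tr (f A)\<close>. The Nystrom approximation is \<open>H = A^(1/2) P A^(1/2)\<close>
  with \<open>P\<close> the orthogonal projector onto the range of \<open>B \<Omega>\<close>, so \<open>0 \<preceq> H \<preceq> A\<close>, and \<open>A - H \<preceq> \<tau> I\<close> as soon as
  \<open>e\<^sup>T A e \<le> \<tau> |e|\<^sup>2\<close> whenever \<open>\<Omega>\<^sup>T B e = 0\<close>. In eigencoordinates this kernel condition bounds the coordinates of
  \<open>B e\<close> in the leading eigenspace by those outside of it: with probability \<open>1 - exp (- c r)\<close> the \<open>r\<close> Gaussian columns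
  are well conditioned on a leading eigenspace of dimension at most \<open>c r\<close>, and form, weighted by \<open>B\<close>, a matrix of norm at most
  \<open>C (r max \<mu>\<^sup>p + \<Sum> \<mu>\<^sup>p)^(1/2)\<close> on the rest.

  Operator monotonicity gives that \<open>f x / x\<close> decreases, hence \<open>f\<close> is subadditive and
  \<open>0 \<preceq> f A - f H \<preceq> f \<tau> I\<close>; the choice of \<open>\<tau>\<close> makes \<open>f \<tau> \<le> C T / r\<close>. The eigenvalues \<open>d\<close> of
  \<open>f A - f H\<close> therefore satisfy \<open>\<Sum> d \<le> T\<close> and \<open>\<Sum> d\<^sup>2 \<le> C T\<^sup>2 / r\<close>, so by a Chernoff bound the stochastic trace
  estimate from \<open>r\<close> samples errs by more than \<open>\<epsilon> T\<close> with probability at most \<open>2 exp (- c r\<^sup>2 \<epsilon>\<^sup>2)\<close> for \<open>\<epsilon> \<le> 1\<close>.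
\<close>

subsection \<open>The spectral theorem for real symmetric matrices\<close>

text \<open>Accuracy \<open>\<epsilon>\<close> from about \<open>1 / \<epsilon>\<close> samples asks
  for a sampling error of order \<open>T / r\<close> instead of \<open>T / sqrt r\<close>; the
  missing factor has to come from the norm bound on \<open>f A - f H\<close>. The sketch sees
  \<open>A\<close> only through the power \<open>p\<close>, yet the constants must not depend on
  \<open>q\<close>. So the kernel estimate is proved for the form of \<open>A^p\<close>, and
  Jensen's inequality for \<open>x^p\<close> brings it back to \<open>A\<close>: a constant
  \<open>C \<ge> 1\<close> in front of a \<open>p\<close>-th power costs at most the factor
  \<open>C\<close> once the root is taken. No gap between eigenvalues is available, so the leading
  eigenspace is cut out by the size of \<open>f (\<mu> a)\<close>, and its dimension is bounded by
  counting against \<open>T\<close>. Two obstacles are of a different kind. A set outside the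
  sigma-algebra has measure \<open>0\<close> by convention, so a lower bound on the probability
  requires a measurable estimator, although the pseudoinverse is discontinuous; a Borel functional
  calculus supplies this. And the eigenbasis of \<open>f A - f H\<close> depends on
  \<open>\<Omega>\<close>, so \<open>\<Omega>\<close> is frozen before the samples are
  treated.\<close>

lemma mat_mult_index:
  assumes "A \<in> carrier_mat n k" "B \<in> carrier_mat k m" "i < n" "j < m"
  shows "(A * B) $$ (i, j) = (\<Sum>l<k. A $$ (i, l) * B $$ (l, j))"
  using assms by (simp add: Matrix.scalar_prod_def atLeast0LessThan)

lemma mat_vec_index:
  assumes "A \<in> carrier_mat n k" "x \<in> carrier_vec k" "i < n"
  shows "(A *\<^sub>v x) $ i = (\<Sum>l<k. A $$ (i, l) * x $ l)"
  using assms by (simp add: Matrix.scalar_prod_def atLeast0LessThan)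

lemma symmetric_mat_index:
  assumes "symmetric_mat n A" "i < n" "j < n"
  shows "A $$ (i, j) = A $$ (j, i)"
proof -
  have A: "A \<in> carrier_mat n n" "transpose_mat A = A" using assms(1) by (auto simp: symmetric_mat_def)
  have "transpose_mat A $$ (i, j) = A $$ (j, i)" using A(1) assms(2,3) by simp
  then show ?thesis by (simp only: A(2))
qed

text \<open>Over the complex numbers an eigenvector \<open>z\<close> exists. Symmetry makes the
  Hermitian form of \<open>A\<close> at \<open>z\<close> equal to its own conjugate, so the
  eigenvalue is real, and the real or the imaginary part of \<open>z\<close> is a nonzero real
  eigenvector.\<close>

lemma real_eigenvector_exists:
  assumes A: "symmetric_mat n A" and n: "0 < n"
  obtains v \<kappa> where "v \<in> carrier_vec n" "v \<noteq> 0\<^sub>v n" "A *\<^sub>v v = \<kappa> \<cdot>\<^sub>v v"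
proof -
  have cA: "A \<in> carrier_mat n n" using A by (simp add: symmetric_mat_def)
  define B where "B = map_mat complex_of_real A"
  have cB: "B \<in> carrier_mat n n" using cA by (simp add: B_def)
  obtain k where "eigenvalue B k"
    using spectrum_non_empty[OF cB n] unfolding spectrum_def by blast
  then obtain z where z: "z \<in> carrier_vec n" "z \<noteq> 0\<^sub>v n" "B *\<^sub>v z = k \<cdot>\<^sub>v z"
    unfolding eigenvalue_def eigenvector_def carrier_matD(1)[OF cB] by blast
  have eq: "(\<Sum>j<n. complex_of_real (A $$ (i, j)) * z $ j) = k * z $ i" if "i < n" for i
  proof -
    have "(B *\<^sub>v z) $ i = (\<Sum>j<n. B $$ (i, j) * z $ j)" by (rule mat_vec_index[OF cB z(1) that])
    also have "\<dots> = (\<Sum>j<n. complex_of_real (A $$ (i, j)) * z $ j)"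
      using that cA by (intro sum.cong) (auto simp: B_def)
    finally show ?thesis using z that by simp
  qed
  define S where "S = (\<Sum>i<n. \<Sum>j<n. cnj (z $ i) * (complex_of_real (A $$ (i, j)) * z $ j))"
  define N where "N = (\<Sum>i<n. (cmod (z $ i))\<^sup>2)"
  have "S = (\<Sum>i<n. cnj (z $ i) * (k * z $ i))"
    unfolding S_def sum_distrib_left[symmetric] using eq by simp
  also have "\<dots> = (\<Sum>i<n. k * complex_of_real ((cmod (z $ i))\<^sup>2))"
    by (simp only: complex_norm_square mult_ac)
  finally have S: "S = k * complex_of_real N" by (simp only: N_def of_real_sum sum_distrib_left)
  have "cnj S = (\<Sum>i<n. \<Sum>j<n. z $ i * (complex_of_real (A $$ (i, j)) * cnj (z $ j)))"
    by (simp add: S_def)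
  also have "\<dots> = S" unfolding S_def
    by (subst sum.swap) (intro sum.cong refl, use symmetric_mat_index[OF A] in \<open>simp add: mult_ac\<close>)
  finally have "cnj k * complex_of_real N = k * complex_of_real N" using S by simp
  moreover have "N \<noteq> 0"
  proof
    assume "N = 0"
    then have "\<forall>i<n. z $ i = 0" unfolding N_def by (subst (asm) sum_nonneg_eq_0_iff) auto
    then have "z = 0\<^sub>v n" using z(1) by (intro eq_vecI) auto
    with z(2) show False by simp
  qed
  ultimately have "cnj k = k" by simp
  then have k: "k = complex_of_real (Re k)" by (simp add: complex_eq_iff)
  \<comment> \<open>\<open>g\<close> stands for \<open>Re\<close> and for \<open>Im\<close>; both
    are real-linear and hence commute with the real matrix and the real eigenvalue.\<close>
  have part: "A *\<^sub>v Matrix.vec n (\<lambda>i. g (z $ i)) = Re k \<cdot>\<^sub>v Matrix.vec n (\<lambda>i. g (z $ i))"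
    if g: "bounded_linear g" "\<And>a x. g (complex_of_real a * x) = a * g x" for g :: "complex \<Rightarrow> real"
  proof (rule eq_vecI)
    fix i assume "i < dim_vec (Re k \<cdot>\<^sub>v Matrix.vec n (\<lambda>i. g (z $ i)))"
    then have i: "i < n" by simp
    interpret g: bounded_linear g by (rule g)
    have "(A *\<^sub>v Matrix.vec n (\<lambda>i. g (z $ i))) $ i = (\<Sum>j<n. A $$ (i, j) * g (z $ j))"
      by (subst mat_vec_index[OF cA _ i]) auto
    also have "\<dots> = g (\<Sum>j<n. complex_of_real (A $$ (i, j)) * z $ j)" by (simp add: g.sum g(2))
    also have "\<dots> = Re k * g (z $ i)" using eq[OF i] k g(2) by metis
    finally show "(A *\<^sub>v Matrix.vec n (\<lambda>i. g (z $ i))) $ i = (Re k \<cdot>\<^sub>v Matrix.vec n (\<lambda>i. g (z $ i))) $ i"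
      using i by simp
  qed (use cA in auto)
  show ?thesis
  proof (cases "Matrix.vec n (\<lambda>i. Re (z $ i)) = 0\<^sub>v n")
    case False
    show ?thesis by (rule that[OF _ False part]) (auto simp: bounded_linear_Re)
  next
    case True
    have "Matrix.vec n (\<lambda>i. Im (z $ i)) \<noteq> 0\<^sub>v n"
    proof
      assume "Matrix.vec n (\<lambda>i. Im (z $ i)) = 0\<^sub>v n"
      then have "z $ i = 0" if "i < n" for i
        using True that by (auto simp: vec_eq_iff complex_eq_iff)
      then have "z = 0\<^sub>v n" using z(1) by (intro eq_vecI) auto
      with z(2) show False by simp
    qed
    then show ?thesis by (rule that[OF _ _ part, rotated]) (auto simp: bounded_linear_Im)
  qed
qed

text \<open>The reflection \<open>1 - c w w\<^sup>T\<close> along \<open>w = v - e\<^sub>0\<close>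
  exchanges the unit vectors \<open>e\<^sub>0\<close> and \<open>v\<close>. It degenerates for
  \<open>v = e\<^sub>0\<close>, that is for \<open>v $ 0 = 1\<close>, where the identity serves
  instead.\<close>

lemma householder_exists:
  fixes v :: "real vec"
  assumes v: "v \<in> carrier_vec n" "(\<Sum>i<n. (v $ i)\<^sup>2) = 1" and n: "0 < n"
  obtains H where "orthonormal_mat n H" "transpose_mat H = H" "col H 0 = v"
proof (cases "v $ 0 = 1")
  case True
  have "(\<Sum>i<n. (v $ i)\<^sup>2) = (v $ 0)\<^sup>2 + (\<Sum>i\<in>{..<n} - {0}. (v $ i)\<^sup>2)"
    using n by (subst sum.remove[of _ 0]) auto
  then have "(\<Sum>i\<in>{..<n} - {0}. (v $ i)\<^sup>2) = 0" using v True by simp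
  then have "\<forall>i\<in>{..<n} - {0}. v $ i = 0" by (subst (asm) sum_nonneg_eq_0_iff) auto
  then have "col (1\<^sub>m n) 0 = v" using v n True by (intro eq_vecI) (auto simp: unit_vec_def)
  then show ?thesis by (intro that[of "1\<^sub>m n"]) (auto simp: orthonormal_mat_def)
next
  case False
  define w where "w i = v $ i - (if i = 0 then 1 else 0)" for i
  define c where "c = 1 / (1 - v $ 0)"
  have "(\<Sum>i<n. (w i)\<^sup>2) = (\<Sum>i<n. (v $ i)\<^sup>2 + (if i = 0 then 1 - 2 * v $ 0 else 0))"
    by (intro sum.cong) (auto simp: w_def power2_diff)
  then have w2: "(\<Sum>i<n. (w i)\<^sup>2) = 2 - 2 * v $ 0"
    using v n by (simp add: sum.distrib)
  \<comment> \<open>This normalisation turns \<open>1 - c w w\<^sup>T\<close> into an involution: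
    the terms in \<open>w w\<^sup>T\<close> of its square cancel when
    \<open>c |w|\<^sup>2 = 2\<close>.\<close>
  have cw: "c * (\<Sum>i<n. (w i)\<^sup>2) = 2" using False by (simp add: w2 c_def field_simps)
  define H where "H = Matrix.mat n n (\<lambda>(i, j). (if i = j then 1 else 0) - c * w i * w j)"
  have cH: "H \<in> carrier_mat n n" by (simp add: H_def)
  have T: "transpose_mat H = H" by (rule eq_matI) (auto simp: H_def)
  have "H * H = 1\<^sub>m n"
  proof (rule eq_matI)
    fix i j assume "i < dim_row (1\<^sub>m n :: real mat)" "j < dim_col (1\<^sub>m n :: real mat)"
    then have ij: "i < n" "j < n" by auto
    have "(H * H) $$ (i, j) = (\<Sum>l<n. H $$ (i, l) * H $$ (l, j))"
      by (rule mat_mult_index[OF cH cH ij])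
    also have "\<dots> = (\<Sum>l<n. (if i = l then (if i = j then 1 else 0) - c * w i * w j else 0)
        - (if l = j then c * w i * w j else 0) + c * w i * w j * (c * (w l)\<^sup>2))"
      using ij by (intro sum.cong refl) (auto simp: H_def algebra_simps power2_eq_square)
    also have "\<dots> = (if i = j then 1 else 0) - 2 * (c * w i * w j) + c * w i * w j * (c * (\<Sum>l<n. (w l)\<^sup>2))"
      using ij by (simp add: sum.distrib sum_subtractf sum_distrib_left[symmetric])
    finally show "(H * H) $$ (i, j) = (1\<^sub>m n) $$ (i, j)" using ij by (simp add: cw)
  qed (use cH in auto)
  moreover have "col H 0 = v"
  proof (rule eq_vecI)
    fix i assume "i < dim_vec v"
    then have i: "i < n" using v by simp
    have "c * w 0 = - 1" using False by (simp add: c_def w_def field_simps)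
    moreover have "c * w i * w 0 = w i * (c * w 0)" by (simp only: mult_ac)
    ultimately have "c * w i * w 0 = - w i" by simp
    then show "col H 0 $ i = v $ i" using i n by (auto simp: H_def w_def)
  qed (use v cH in auto)
  ultimately show ?thesis using cH T by (intro that[of H]) (auto simp: orthonormal_mat_def)
qed

lemma orthonormal_mat_mult:
  assumes "orthonormal_mat n V" "orthonormal_mat n W"
  shows "orthonormal_mat n (V * W)"
proof -
  have [simp]: "V \<in> carrier_mat n n" "W \<in> carrier_mat n n"
    "transpose_mat V \<in> carrier_mat n n" "transpose_mat W \<in> carrier_mat n n"
    and e: "transpose_mat V * V = 1\<^sub>m n" "V * transpose_mat V = 1\<^sub>m n"
    "transpose_mat W * W = 1\<^sub>m n" "W * transpose_mat W = 1\<^sub>m n"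
    using assms by (auto simp: orthonormal_mat_def)
  have "transpose_mat W * transpose_mat V * (V * W) = transpose_mat W * ((transpose_mat V * V) * W)"
    by (simp add: assoc_mult_mat[of _ n n _ n _ n] mult_carrier_mat[of _ n n _ n])
  moreover have "V * W * (transpose_mat W * transpose_mat V) = V * ((W * transpose_mat W) * transpose_mat V)"
    by (simp add: assoc_mult_mat[of _ n n _ n _ n] mult_carrier_mat[of _ n n _ n])
  ultimately show ?thesis unfolding orthonormal_mat_def
    by (simp add: transpose_mult[of _ n n _ n] e left_mult_one_mat[of _ n n] mult_carrier_mat[of _ n n _ n])
qed

text \<open>Deflation: a reflection moves an eigenvector to the first coordinate axis, and symmetry
  clears the first row along with the first column, so the induction hypothesis applies to the
  remaining block.\<close>

theorem spectral_theorem: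
  assumes "symmetric_mat n A"
  shows "\<exists>V \<mu>. orthonormal_mat n V \<and> A = V * mat_diag n \<mu> * transpose_mat V"
  using assms
proof (induction n arbitrary: A)
  case 0
  then have "A = 1\<^sub>m 0" by (intro eq_matI) (auto simp: symmetric_mat_def)
  then show ?case by (intro exI[of _ "1\<^sub>m 0"] exI[of _ "\<lambda>_. 0"]) (auto simp: orthonormal_mat_def intro!: eq_matI)
next
  case (Suc n)
  have cA: "A \<in> carrier_mat (Suc n) (Suc n)" and TA: "transpose_mat A = A"
    using Suc.prems by (auto simp: symmetric_mat_def)
  obtain u \<kappa> where u: "u \<in> carrier_vec (Suc n)" "u \<noteq> 0\<^sub>v (Suc n)" "A *\<^sub>v u = \<kappa> \<cdot>\<^sub>v u"
    using real_eigenvector_exists[OF Suc.prems] by blast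
  define N where "N = (\<Sum>i<Suc n. (u $ i)\<^sup>2)"
  have "N \<noteq> 0"
  proof
    assume "N = 0"
    then have "\<forall>i\<in>{..<Suc n}. u $ i = 0" unfolding N_def by (subst (asm) sum_nonneg_eq_0_iff) auto
    then have "u = 0\<^sub>v (Suc n)" using u(1) by (intro eq_vecI) auto
    with u(2) show False by simp
  qed
  then have N: "0 < N" by (simp add: N_def less_le sum_nonneg)
  define v where "v = (1 / sqrt N) \<cdot>\<^sub>v u"
  have v: "v \<in> carrier_vec (Suc n)" using u by (simp add: v_def)
  have "(\<Sum>i<Suc n. (v $ i)\<^sup>2) = (\<Sum>i<Suc n. (u $ i)\<^sup>2 / N)"
    using u N by (intro sum.cong) (auto simp: v_def power_mult_distrib power_divide)
  then have v1: "(\<Sum>i<Suc n. (v $ i)\<^sup>2) = 1"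
    using N by (simp only: sum_divide_distrib[symmetric] N_def[symmetric]) simp
  have Av: "A *\<^sub>v v = \<kappa> \<cdot>\<^sub>v v"
    using u cA by (simp add: v_def mult_mat_vec[of _ "Suc n" "Suc n"] smult_smult_assoc mult.commute)
  obtain H where H: "orthonormal_mat (Suc n) H" "transpose_mat H = H" "col H 0 = v"
    using householder_exists[OF v v1] by blast
  have cH: "H \<in> carrier_mat (Suc n) (Suc n)" and HH: "H * H = 1\<^sub>m (Suc n)"
    using H by (auto simp: orthonormal_mat_def)
  note [simp] = cA cH
  define B where "B = H * A * H"
  have cB [simp]: "B \<in> carrier_mat (Suc n) (Suc n)" by (simp add: B_def mult_carrier_mat[of _ "Suc n" "Suc n" _ "Suc n"])
  have TB: "transpose_mat B = B"
    unfolding B_def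
    by (simp add: transpose_mult[of _ "Suc n" "Suc n" _ "Suc n"] H TA assoc_mult_mat[of _ "Suc n" "Suc n" _ "Suc n" _ "Suc n"]
        mult_carrier_mat[of _ "Suc n" "Suc n" _ "Suc n"])
  have HB: "H * B * H = A"
  proof -
    have "H * B * H = (H * H) * A * (H * H)" unfolding B_def
      by (simp add: assoc_mult_mat[of _ "Suc n" "Suc n" _ "Suc n" _ "Suc n"] mult_carrier_mat[of _ "Suc n" "Suc n" _ "Suc n"])
    then show ?thesis by (simp add: HH left_mult_one_mat[of _ "Suc n" "Suc n"] right_mult_one_mat[of _ "Suc n" "Suc n"])
  qed
  have colB: "col B 0 = \<kappa> \<cdot>\<^sub>v unit_vec (Suc n) 0"
  proof -
    have "col B 0 = H * A *\<^sub>v col H 0"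
      unfolding B_def by (rule col_mult2[of _ "Suc n" "Suc n" _ "Suc n"]) (auto simp: mult_carrier_mat[of _ "Suc n" "Suc n" _ "Suc n"])
    also have "\<dots> = H *\<^sub>v (A *\<^sub>v v)" using v by (simp add: H(3) assoc_mult_mat_vec[of _ "Suc n" "Suc n" _ "Suc n"])
    also have "\<dots> = \<kappa> \<cdot>\<^sub>v (H *\<^sub>v col H 0)"
      using v by (simp add: Av H(3) mult_mat_vec[of _ "Suc n" "Suc n"])
    also have "H *\<^sub>v col H 0 = col (H * H) 0"
      by (rule col_mult2[symmetric, of _ "Suc n" "Suc n" _ "Suc n"]) auto
    finally show ?thesis by (simp add: HH)
  qed
  define C where "C = Matrix.mat n n (\<lambda>(i, j). B $$ (Suc i, Suc j))"
  have cC: "C \<in> carrier_mat n n" by (simp add: C_def)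
  have Bsym: "B $$ (i, j) = B $$ (j, i)" if "i < Suc n" "j < Suc n" for i j
    using that TB cB by (intro symmetric_mat_index[of "Suc n"]) (auto simp: symmetric_mat_def)
  have B0: "B $$ (i, 0) = (if i = 0 then \<kappa> else 0)" if "i < Suc n" for i
  proof -
    have "B $$ (i, 0) = col B 0 $ i" using that by (simp add: carrier_matD[OF cB])
    also have "\<dots> = (\<kappa> \<cdot>\<^sub>v unit_vec (Suc n) 0) $ i" by (simp only: colB)
    finally show ?thesis using that by simp
  qed
  have BC: "B = four_block_mat (mat_diag 1 (\<lambda>_. \<kappa>)) (0\<^sub>m 1 n) (0\<^sub>m n 1) C"
  proof (rule eq_matI)
    fix i j assume "i < dim_row (four_block_mat (mat_diag 1 (\<lambda>_. \<kappa>)) (0\<^sub>m 1 n) (0\<^sub>m n 1) C)"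
      "j < dim_col (four_block_mat (mat_diag 1 (\<lambda>_. \<kappa>)) (0\<^sub>m 1 n) (0\<^sub>m n 1) C)"
    then have ij: "i < Suc n" "j < Suc n" by (auto simp: C_def mat_diag_def)
    then show "B $$ (i, j) = four_block_mat (mat_diag 1 (\<lambda>_. \<kappa>)) (0\<^sub>m 1 n) (0\<^sub>m n 1) C $$ (i, j)"
      using B0[of i] B0[of j] Bsym[of i j]
      by (cases i; cases j) (auto simp: C_def mat_diag_def)
  qed (simp_all add: carrier_matD[OF cB] C_def mat_diag_def)
  have "symmetric_mat n C" unfolding symmetric_mat_def
    using cC Bsym by (auto simp: C_def intro!: eq_matI)
  then obtain W \<mu> where W: "orthonormal_mat n W" "C = W * mat_diag n \<mu> * transpose_mat W"
    using Suc.IH by blast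
  have cW: "W \<in> carrier_mat n n" and W1: "transpose_mat W * W = 1\<^sub>m n" "W * transpose_mat W = 1\<^sub>m n"
    using W(1) by (auto simp: orthonormal_mat_def)
  define U where "U = four_block_mat (1\<^sub>m 1) (0\<^sub>m 1 n) (0\<^sub>m n 1) W"
  define \<nu> where "\<nu> i = (case i of 0 \<Rightarrow> \<kappa> | Suc k \<Rightarrow> \<mu> k)" for i
  have cU: "U \<in> carrier_mat (Suc n) (Suc n)"
    using four_block_carrier_mat[of "1\<^sub>m 1" 1 1 W n n] cW by (simp add: U_def)
  have TU: "transpose_mat U = four_block_mat (1\<^sub>m 1) (0\<^sub>m 1 n) (0\<^sub>m n 1) (transpose_mat W)"
    unfolding U_def by (subst transpose_four_block_mat[of _ 1 1 _ n _ n]) (use cW in auto)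
  have Dn: "mat_diag (Suc n) \<nu> = four_block_mat (mat_diag 1 (\<lambda>_. \<kappa>)) (0\<^sub>m 1 n) (0\<^sub>m n 1) (mat_diag n \<mu>)"
  proof (rule eq_matI)
    fix i j assume "i < dim_row (four_block_mat (mat_diag 1 (\<lambda>_. \<kappa>)) (0\<^sub>m 1 n) (0\<^sub>m n 1) (mat_diag n \<mu>))"
      "j < dim_col (four_block_mat (mat_diag 1 (\<lambda>_. \<kappa>)) (0\<^sub>m 1 n) (0\<^sub>m n 1) (mat_diag n \<mu>))"
    then have "i < Suc n" "j < Suc n" by (auto simp: mat_diag_def)
    then show "mat_diag (Suc n) \<nu> $$ (i, j) = four_block_mat (mat_diag 1 (\<lambda>_. \<kappa>)) (0\<^sub>m 1 n) (0\<^sub>m n 1) (mat_diag n \<mu>) $$ (i, j)"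
      by (cases i; cases j) (auto simp: mat_diag_def \<nu>_def)
  qed (auto simp: mat_diag_def)
  have block: "four_block_mat a (0\<^sub>m 1 n) (0\<^sub>m n 1) b * four_block_mat a' (0\<^sub>m 1 n) (0\<^sub>m n 1) b'
      = four_block_mat (a * a') (0\<^sub>m 1 n) (0\<^sub>m n 1) (b * b')"
    if "a \<in> carrier_mat 1 1" "a' \<in> carrier_mat 1 1" "b \<in> carrier_mat n n" "b' \<in> carrier_mat n n"
    for a a' b b' :: "real mat"
    using that by (subst mult_four_block_mat[of _ 1 1 _ n _ n _ _ 1 _ n]) auto
  have one: "four_block_mat (1\<^sub>m 1) (0\<^sub>m 1 n) (0\<^sub>m n 1) (1\<^sub>m n) = (1\<^sub>m (Suc n) :: real mat)"
    using four_block_one_mat[of 1 n] by simp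
  have "transpose_mat U * U = 1\<^sub>m (Suc n)" "U * transpose_mat U = 1\<^sub>m (Suc n)"
    unfolding TU unfolding U_def using cW
    by (simp_all add: block W1 one del: One_nat_def four_block_one_mat)
  then have U1: "orthonormal_mat (Suc n) U" using cU by (simp add: orthonormal_mat_def)
  have UB: "U * mat_diag (Suc n) \<nu> * transpose_mat U = B"
    unfolding TU Dn BC W(2) unfolding U_def using cW
    by (simp add: block mult_carrier_mat[of _ n n _ n] left_mult_one_mat[of _ 1 1] right_mult_one_mat[of _ 1 1]
        del: One_nat_def)
  have "A = (H * U) * mat_diag (Suc n) \<nu> * transpose_mat (H * U)"
  proof -
    have "(H * U) * D * (T * H) = H * (U * D * T) * H"
      if "D \<in> carrier_mat (Suc n) (Suc n)" "T \<in> carrier_mat (Suc n) (Suc n)" for D T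
      using that cU by (simp add: assoc_mult_mat[of _ "Suc n" "Suc n" _ "Suc n" _ "Suc n"]
          mult_carrier_mat[of _ "Suc n" "Suc n" _ "Suc n"])
    from this[of "mat_diag (Suc n) \<nu>" "transpose_mat U"]
    have "H * U * mat_diag (Suc n) \<nu> * (transpose_mat U * H) = H * B * H"
      using cU by (simp only: UB mat_diag_dim transpose_carrier_mat)
    then show ?thesis by (simp only: transpose_mult[OF cH cU] H(2) HB)
  qed
  then show ?case using orthonormal_mat_mult[OF H(1) U1] by blast
qed

subsection \<open>Functional calculus\<close>

text \<open>With \<open>V\<close> fixed and \<open>h\<close> varying, sums, products, powers and
  functions of matrices with a common eigenbasis become pointwise operations on
  \<open>h\<close>.\<close>

definition spec :: "nat \<Rightarrow> real mat \<Rightarrow> (nat \<Rightarrow> real) \<Rightarrow> real mat" where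
  "spec n V h = V * mat_diag n h * transpose_mat V"

lemma symmetric_mat_spec:
  assumes "symmetric_mat n A"
  obtains V \<mu> where "orthonormal_mat n V" "A = spec n V \<mu>"
  using spectral_theorem[OF assms] by (auto simp: spec_def)

context
  fixes n :: nat and V :: "real mat"
  assumes V: "orthonormal_mat n V"
begin

lemma orthonormal_carrier: "V \<in> carrier_mat n n"
  using V by (simp add: orthonormal_mat_def)

lemma orthonormal_cols:
  assumes "a < n" "b < n"
  shows "(\<Sum>i<n. V $$ (i, a) * V $$ (i, b)) = (if a = b then 1 else 0)"
proof -
  have "(\<Sum>i<n. V $$ (i, a) * V $$ (i, b)) = (\<Sum>i<n. transpose_mat V $$ (a, i) * V $$ (i, b))"
    using orthonormal_carrier assms by (intro sum.cong) auto
  also have "\<dots> = (transpose_mat V * V) $$ (a, b)"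
    using orthonormal_carrier by (intro mat_mult_index[symmetric, of _ n n _ n] assms) auto
  also have "transpose_mat V * V = 1\<^sub>m n" using V by (simp add: orthonormal_mat_def)
  finally show ?thesis using assms by simp
qed

lemma spec_carrier [simp]: "spec n V h \<in> carrier_mat n n"
  using orthonormal_carrier by (simp add: spec_def mult_carrier_mat[of _ n n _ n])

lemma spec_index:
  assumes "i < n" "j < n"
  shows "spec n V h $$ (i, j) = (\<Sum>a<n. h a * V $$ (i, a) * V $$ (j, a))"
proof -
  have VD: "V * mat_diag n h \<in> carrier_mat n n"
    by (rule mult_carrier_mat[OF orthonormal_carrier mat_diag_dim])
  have "spec n V h $$ (i, j) = (\<Sum>a<n. (V * mat_diag n h) $$ (i, a) * transpose_mat V $$ (a, j))"
    unfolding spec_def using orthonormal_carrier by (intro mat_mult_index[OF VD _ assms]) simp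
  also have "\<dots> = (\<Sum>a<n. h a * V $$ (i, a) * V $$ (j, a))"
    unfolding mat_diag_mult_right[OF orthonormal_carrier]
    using orthonormal_carrier assms by (intro sum.cong refl) simp
  finally show ?thesis .
qed

lemma spec_cong: "(\<And>a. a < n \<Longrightarrow> g a = h a) \<Longrightarrow> spec n V g = spec n V h"
  by (rule eq_matI) (auto simp: carrier_matD[OF spec_carrier] spec_index)

lemma spec_symmetric: "symmetric_mat n (spec n V h)"
  unfolding symmetric_mat_def
  by (auto intro!: eq_matI simp: carrier_matD[OF spec_carrier] spec_index mult_ac)

lemma spec_mult: "spec n V g * spec n V h = spec n V (\<lambda>a. g a * h a)"
proof -
  have "V * D * T * (V * E * T) = V * (D * (T * V) * E) * T"
    if "D \<in> carrier_mat n n" "E \<in> carrier_mat n n" "T \<in> carrier_mat n n" for D E T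
    using that orthonormal_carrier
    by (simp add: assoc_mult_mat[of _ n n _ n _ n] mult_carrier_mat[of _ n n _ n])
  from this[of "mat_diag n g" "mat_diag n h" "transpose_mat V"]
  have "spec n V g * spec n V h = V * (mat_diag n g * (transpose_mat V * V) * mat_diag n h) * transpose_mat V"
    using orthonormal_carrier by (simp only: spec_def mat_diag_dim transpose_carrier_mat)
  also have "transpose_mat V * V = 1\<^sub>m n" using V by (simp add: orthonormal_mat_def)
  also have "mat_diag n g * 1\<^sub>m n = mat_diag n g" by (rule right_mult_one_mat[OF mat_diag_dim])
  finally show ?thesis by (simp only: spec_def mat_diag_diag)
qed

lemma spec_one: "spec n V (\<lambda>_. 1) = 1\<^sub>m n"
  using V by (simp add: spec_def orthonormal_mat_def right_mult_one_mat[of _ n n])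

lemma spec_power: "spec n V h ^\<^sub>m k = spec n V (\<lambda>a. h a ^ k)"
  by (induction k) (simp_all add: spec_one spec_mult mult.commute carrier_matD[OF spec_carrier])

lemma spec_add: "spec n V g + spec n V h = spec n V (\<lambda>a. g a + h a)"
  by (rule eq_matI) (auto simp: carrier_matD[OF spec_carrier] spec_index sum.distrib distrib_right)

lemma spec_minus: "spec n V g - spec n V h = spec n V (\<lambda>a. g a - h a)"
  by (rule eq_matI) (auto simp: carrier_matD[OF spec_carrier] spec_index sum_subtractf left_diff_distrib)

lemma spec_smult: "c \<cdot>\<^sub>m spec n V h = spec n V (\<lambda>a. c * h a)"
  by (rule eq_matI) (auto simp: carrier_matD[OF spec_carrier] spec_index sum_distrib_left mult_ac)

lemma mat_fun_spec: "mat_fun f (spec n V \<mu>) = spec n V (\<lambda>a. f (\<mu> a))"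
  unfolding spec_def by (rule mat_fun_eqI[OF V refl])

lemma trace_spec: "mat_trace (spec n V h) = (\<Sum>a<n. h a)"
proof -
  have "mat_trace (spec n V h) = (\<Sum>i<n. \<Sum>a<n. h a * (V $$ (i, a) * V $$ (i, a)))"
    by (simp add: mat_trace_def carrier_matD[OF spec_carrier] spec_index mult.assoc)
  also have "\<dots> = (\<Sum>a<n. h a * (\<Sum>i<n. V $$ (i, a) * V $$ (i, a)))"
    by (subst sum.swap) (simp add: sum_distrib_left)
  finally show ?thesis by (simp add: orthonormal_cols)
qed

lemma spec_quadratic_form:
  assumes "x \<in> carrier_vec n"
  shows "Matrix.scalar_prod x (spec n V h *\<^sub>v x) = (\<Sum>a<n. h a * (\<Sum>i<n. V $$ (i, a) * x $ i)\<^sup>2)"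
proof -
  have "Matrix.scalar_prod x (spec n V h *\<^sub>v x) = (\<Sum>i<n. x $ i * (spec n V h *\<^sub>v x) $ i)"
    by (simp add: Matrix.scalar_prod_def[of x] atLeast0LessThan carrier_matD[OF spec_carrier]
        del: index_mult_mat_vec)
  also have "\<dots> = (\<Sum>i<n. x $ i * (\<Sum>j<n. spec n V h $$ (i, j) * x $ j))"
    by (intro sum.cong refl) (simp only: mat_vec_index[OF spec_carrier assms] lessThan_iff)
  also have "\<dots> = (\<Sum>i<n. \<Sum>j<n. \<Sum>a<n. h a * (V $$ (i, a) * x $ i) * (V $$ (j, a) * x $ j))"
    by (simp add: spec_index sum_distrib_left sum_distrib_right mult_ac)
  also have "\<dots> = (\<Sum>i<n. \<Sum>a<n. \<Sum>j<n. h a * (V $$ (i, a) * x $ i) * (V $$ (j, a) * x $ j))"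
    by (intro sum.cong refl sum.swap)
  also have "\<dots> = (\<Sum>a<n. \<Sum>i<n. \<Sum>j<n. h a * (V $$ (i, a) * x $ i) * (V $$ (j, a) * x $ j))"
    by (rule sum.swap)
  also have "\<dots> = (\<Sum>a<n. h a * (\<Sum>i<n. V $$ (i, a) * x $ i)\<^sup>2)"
    by (simp add: power2_eq_square sum_product sum_distrib_left mult_ac)
  finally show ?thesis .
qed

lemma norm_coords:
  assumes "x \<in> carrier_vec n"
  shows "(\<Sum>a<n. (\<Sum>i<n. V $$ (i, a) * x $ i)\<^sup>2) = Matrix.scalar_prod x x"
  using spec_quadratic_form[OF assms, of "\<lambda>_. 1"] assms by (simp add: spec_one)

lemma psd_spec_iff: "psd_mat n (spec n V h) \<longleftrightarrow> (\<forall>a<n. 0 \<le> h a)"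
proof
  assume psd: "psd_mat n (spec n V h)"
  show "\<forall>a<n. 0 \<le> h a"
  proof (intro allI impI)
    fix a assume a: "a < n"
    have c: "col V a \<in> carrier_vec n" using orthonormal_carrier a by auto
    have "(\<Sum>i<n. V $$ (i, b) * col V a $ i) = (if b = a then 1 else 0)" if "b < n" for b
      using orthonormal_cols[OF that a] orthonormal_carrier a by simp
    then have "Matrix.scalar_prod (col V a) (spec n V h *\<^sub>v col V a) = (\<Sum>b<n. if b = a then h a else 0)"
      unfolding spec_quadratic_form[OF c] by (intro sum.cong) auto
    then have "Matrix.scalar_prod (col V a) (spec n V h *\<^sub>v col V a) = h a" using a by simp
    moreover have "0 \<le> Matrix.scalar_prod (col V a) (spec n V h *\<^sub>v col V a)"
      using psd c by (simp add: psd_mat_def)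
    ultimately show "0 \<le> h a" by simp
  qed
next
  assume "\<forall>a<n. 0 \<le> h a"
  then show "psd_mat n (spec n V h)"
    unfolding psd_mat_def using spec_symmetric by (auto simp: spec_quadratic_form intro!: sum_nonneg)
qed

end

subsection \<open>The Loewner order and operator monotone functions\<close>

lemma quadratic_form_minus:
  fixes B C :: "real mat"
  assumes "B \<in> carrier_mat n n" "C \<in> carrier_mat n n" "x \<in> carrier_vec n"
  shows "Matrix.scalar_prod x ((B - C) *\<^sub>v x)
    = Matrix.scalar_prod x (B *\<^sub>v x) - Matrix.scalar_prod x (C *\<^sub>v x)"
  using assms
  by (simp add: minus_mult_distrib_mat_vec[of _ n n] scalar_prod_minus_distrib[of _ n])

lemma loewner_leI:
  assumes "symmetric_mat n B" "symmetric_mat n C"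
    and "\<And>x. x \<in> carrier_vec n \<Longrightarrow> Matrix.scalar_prod x (C *\<^sub>v x) \<le> Matrix.scalar_prod x (B *\<^sub>v x)"
  shows "loewner_le n C B"
proof -
  have c: "B \<in> carrier_mat n n" "C \<in> carrier_mat n n"
    using assms by (auto simp: symmetric_mat_def)
  have "transpose_mat (B - C) = B - C"
    using assms(1,2) c by (simp add: symmetric_mat_def transpose_minus[of _ n n])
  then have "symmetric_mat n (B - C)"
    using minus_carrier_mat[OF c(2)] by (simp add: symmetric_mat_def)
  then show ?thesis
    using assms(3) c by (auto simp: loewner_le_def psd_mat_def quadratic_form_minus[of _ n])
qed

lemma loewner_leD:
  assumes "loewner_le n C B" "x \<in> carrier_vec n"
  shows "Matrix.scalar_prod x (C *\<^sub>v x) \<le> Matrix.scalar_prod x (B *\<^sub>v x)"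
  using assms by (auto simp: loewner_le_def psd_mat_def quadratic_form_minus[of _ n])

lemma psd_diag_nonneg:
  assumes "psd_mat n B" "i < n"
  shows "0 \<le> B $$ (i, i)"
proof -
  have B: "B \<in> carrier_mat n n" using assms by (simp add: psd_mat_def symmetric_mat_def)
  have "0 \<le> Matrix.scalar_prod (unit_vec n i) (B *\<^sub>v unit_vec n i)"
    using assms by (simp add: psd_mat_def)
  also have "\<dots> = B $$ (i, i)"
    using B assms(2) by (simp add: scalar_prod_left_unit[of _ n])
  finally show ?thesis .
qed

lemma psd_symmetric: "psd_mat n B \<Longrightarrow> symmetric_mat n B"
  by (simp add: psd_mat_def)

context
  fixes f :: "real \<Rightarrow> real"
  assumes om: "operator_monotone f"
begin

lemma operator_monotone_mono:
  assumes "0 \<le> x" "x \<le> y"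
  shows "f x \<le> f y"
proof -
  have V: "orthonormal_mat 1 (1\<^sub>m 1)" by (simp add: orthonormal_mat_def)
  let ?s = "\<lambda>z. spec 1 (1\<^sub>m 1) (\<lambda>_. z)"
  have "loewner_le 1 (?s x) (?s y)"
    unfolding loewner_le_def spec_minus[OF V] psd_spec_iff[OF V] using assms spec_carrier[OF V] by auto
  then have "loewner_le 1 (mat_fun f (?s x)) (mat_fun f (?s y))"
    using om assms unfolding operator_monotone_def by (meson V psd_spec_iff order.trans)
  then show ?thesis
    unfolding loewner_le_def mat_fun_spec[OF V] spec_minus[OF V] psd_spec_iff[OF V] by simp
qed

text \<open>Operator monotonicity is applied to \<open>b v v\<^sup>T \<preceq> diag (a, M)\<close> with a unit vector \<open>v\<close>, where \<open>v\<^sub>0\<^sup>2\<close>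
  can be chosen arbitrarily close to \<open>a / b\<close> provided that \<open>M\<close> is large; the entries at \<open>(0, 0)\<close> are compared.\<close>

lemma operator_monotone_weighted:
  assumes f0: "f 0 = 0" and ab: "0 < a" "a < b" and t: "0 < t" "t < a / b"
  shows "t * f b \<le> f a"
proof -
  have "a / b < 1" using ab by simp
  then have t1: "t < 1" using t by linarith
  define c where "c = sqrt t"
  define s where "s = sqrt (1 - t)"
  have c2: "c * c = t" and s2: "s * s = 1 - t" using t t1 by (simp_all add: c_def s_def)
  define R where "R = Matrix.mat 2 2 (\<lambda>(i, j). if i = j then c else if i = 0 then - s else s)"
  define p where "p = a - b * t"
  have p: "0 < p" using t ab by (simp add: p_def field_simps)
  \<comment> \<open>The value at which the determinant of \<open>diag (a, M) - b v v\<^sup>T\<close>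
    vanishes, so that the difference of the two quadratic forms is a perfect square divided by
    \<open>p\<close>.\<close>
  define M where "M = b * s\<^sup>2 + b\<^sup>2 * c\<^sup>2 * s\<^sup>2 / p"
  have M: "0 \<le> M" using ab p by (simp add: M_def)
  have R: "orthonormal_mat 2 R" unfolding orthonormal_mat_def
    by (auto simp: R_def c2 s2 Matrix.scalar_prod_def numeral_2_eq_2 less_Suc_eq intro!: eq_matI)
  have E: "orthonormal_mat 2 (1\<^sub>m 2)" by (simp add: orthonormal_mat_def)
  define B where "B = spec 2 (1\<^sub>m 2) (\<lambda>i. if i = 0 then a else M)"
  define C where "C = spec 2 R (\<lambda>i. if i = 0 then b else 0)"
  have "psd_mat 2 B" "psd_mat 2 C"
    unfolding B_def C_def psd_spec_iff[OF E] psd_spec_iff[OF R] using ab M by auto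
  moreover have "loewner_le 2 C B"
  proof (rule loewner_leI)
    fix x :: "real vec" assume x: "x \<in> carrier_vec 2"
    have "Matrix.scalar_prod x (B *\<^sub>v x) = a * (x $ 0)\<^sup>2 + M * (x $ 1)\<^sup>2"
      unfolding B_def spec_quadratic_form[OF E x] by (simp add: numeral_2_eq_2)
    moreover have "Matrix.scalar_prod x (C *\<^sub>v x) = b * (c * x $ 0 + s * x $ 1)\<^sup>2"
      unfolding C_def spec_quadratic_form[OF R x] by (simp add: R_def numeral_2_eq_2)
    moreover have "a * (x $ 0)\<^sup>2 + M * (x $ 1)\<^sup>2 - b * (c * x $ 0 + s * x $ 1)\<^sup>2
        = (p * x $ 0 - b * c * s * x $ 1)\<^sup>2 / p"
    proof -
      have "p * M = p * (b * s\<^sup>2) + b\<^sup>2 * c\<^sup>2 * s\<^sup>2" using p by (simp add: M_def field_simps)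
      then have "p * (a * (x $ 0)\<^sup>2 + M * (x $ 1)\<^sup>2 - b * (c * x $ 0 + s * x $ 1)\<^sup>2)
          = p * (a * (x $ 0)\<^sup>2) + (p * (b * s\<^sup>2) + b\<^sup>2 * c\<^sup>2 * s\<^sup>2) * (x $ 1)\<^sup>2 - p * b * (c * x $ 0 + s * x $ 1)\<^sup>2"
        by (simp only: right_diff_distrib distrib_left mult.assoc[symmetric])
      also have "\<dots> = (p * x $ 0 - b * c * s * x $ 1)\<^sup>2 + p * (x $ 0)\<^sup>2 * (a - b * (c * c) - p)"
        by (simp add: power2_eq_square algebra_simps)
      also have "\<dots> = (p * x $ 0 - b * c * s * x $ 1)\<^sup>2" by (simp add: c2 p_def)
      finally show ?thesis using p by (simp add: field_simps)
    qed
    moreover have "0 \<le> (p * x $ 0 - b * c * s * x $ 1)\<^sup>2 / p" using p by simp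
    ultimately show "Matrix.scalar_prod x (C *\<^sub>v x) \<le> Matrix.scalar_prod x (B *\<^sub>v x)" by linarith
  qed (auto simp: B_def C_def spec_symmetric[OF E] spec_symmetric[OF R])
  ultimately have "loewner_le 2 (mat_fun f C) (mat_fun f B)"
    using om by (auto simp: operator_monotone_def)
  then have "0 \<le> (mat_fun f B - mat_fun f C) $$ (0, 0)"
    by (intro psd_diag_nonneg[of 2]) (auto simp: loewner_le_def)
  \<comment> \<open>Since \<open>f 0 = 0\<close>, the matrix \<open>f C\<close> is
    \<open>f b v v\<^sup>T\<close>, whose corner entry is
    \<open>f b c\<^sup>2 = t f b\<close>.\<close>
  also have "\<dots> = f a - t * f b"
    unfolding B_def C_def mat_fun_spec[OF E] mat_fun_spec[OF R]
    by (simp add: spec_index[OF E] spec_index[OF R] carrier_matD[OF spec_carrier[OF E]]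
        carrier_matD[OF spec_carrier[OF R]] numeral_2_eq_2[symmetric] f0)
      (simp add: R_def numeral_2_eq_2 f0 c2[symmetric] mult_ac)
  finally show ?thesis by simp
qed

text \<open>The value \<open>t = a / b\<close> in \<open>operator_monotone_weighted\<close> is
  reached as a limit, because there \<open>t\<close> has to stay strictly below it. Multiplying out
  the quotients \<open>f x / x\<close> admits \<open>a = 0\<close>.\<close>

lemma operator_monotone_ratio:
  assumes f0: "f 0 = 0" and ab: "0 \<le> a" "a \<le> b"
  shows "a * f b \<le> b * f a"
proof (cases "a = 0 \<or> a = b")
  case True
  then show ?thesis using f0 ab by auto
next
  case False
  then have ab': "0 < a" "a < b" using ab by auto
  have fb: "0 \<le> f b" using operator_monotone_mono[of 0 b] f0 ab by simp
  have "a / b * f b \<le> f a"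
  proof (rule field_le_epsilon)
    fix e :: real assume e: "0 < e"
    \<comment> \<open>At most \<open>e / (f b + 1)\<close> below \<open>a / b\<close>. The maximum
      keeps \<open>t\<close> positive, and the \<open>+ 1\<close> keeps the denominator positive
      when \<open>f b = 0\<close>.\<close>
    define t where "t = max (a / (2 * b)) (a / b - e / (f b + 1))"
    have pos: "0 < f b + 1" using fb by simp
    have "0 < a / (2 * b)" "a / (2 * b) < a / b" using ab' by (auto simp: field_simps)
    moreover have "a / b - e / (f b + 1) < a / b" using e pos by simp
    ultimately have "0 < t" "t < a / b" unfolding t_def by linarith+
    then have "t * f b \<le> f a" by (intro operator_monotone_weighted f0 ab') auto
    moreover have "(a / b - e / (f b + 1)) * f b \<le> t * f b"
      using fb by (intro mult_right_mono) (auto simp: t_def)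
    moreover have "e / (f b + 1) * f b \<le> e"
      using e fb pos by (simp add: field_simps)
    ultimately show "a / b * f b \<le> f a + e" by (simp add: left_diff_distrib)
  qed
  then show ?thesis using ab' by (simp add: field_simps)
qed

text \<open>Both \<open>x\<close> and \<open>t\<close> lie below \<open>x + t\<close>, so the
  decreasing ratio makes \<open>f x\<close> and \<open>f t\<close> at least their proportional
  shares of \<open>f (x + t)\<close>.\<close>

lemma operator_monotone_subadditive:
  assumes f0: "f 0 = 0" and "0 \<le> x" "0 \<le> t"
  shows "f (x + t) \<le> f x + f t"
proof (cases "x + t = 0")
  case True
  then show ?thesis using assms by (simp add: add_nonneg_eq_0_iff)
next
  case False
  then have pos: "0 < x + t" using assms by simp
  have "x * f (x + t) \<le> (x + t) * f x" "t * f (x + t) \<le> (x + t) * f t"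
    using assms by (auto intro!: operator_monotone_ratio)
  then have "(x + t) * f (x + t) \<le> (x + t) * (f x + f t)" by (simp add: algebra_simps)
  then show ?thesis using pos by simp
qed

lemma operator_monotone_scale:
  assumes f0: "f 0 = 0" and "0 \<le> x" "1 \<le> c"
  shows "f (c * x) \<le> c * f x"
proof (cases "x = 0")
  case True
  then show ?thesis using f0 by simp
next
  case False
  have "x * f (c * x) \<le> (c * x) * f x"
    using assms by (intro operator_monotone_ratio) (auto simp: mult_le_cancel_right1)
  then have "x * f (c * x) \<le> x * (c * f x)" by (simp add: mult_ac)
  then show ?thesis using False assms by simp
qed

text \<open>\<open>A\<close> and \<open>H\<close> need not commute, so scalar subadditivity cannot
  be applied to them directly. Instead \<open>A\<close> is compared with
  \<open>H + \<tau> I\<close>, which shares the eigenbasis of \<open>H\<close>; operator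
  monotonicity carries the comparison through \<open>f\<close>, and subadditivity is then applied to
  each eigenvalue of \<open>H\<close>.\<close>

lemma mat_fun_perturbation:
  assumes f0: "f 0 = 0" and A: "psd_mat n A" and H: "psd_mat n H" and HA: "loewner_le n H A"
    and AH: "\<And>x. x \<in> carrier_vec n \<Longrightarrow>
      Matrix.scalar_prod x (A *\<^sub>v x) \<le> Matrix.scalar_prod x (H *\<^sub>v x) + \<tau> * Matrix.scalar_prod x x"
    and \<tau>: "0 \<le> \<tau>"
  obtains W d where "orthonormal_mat n W" "mat_fun f A - mat_fun f H = spec n W d"
    "\<And>a. a < n \<Longrightarrow> 0 \<le> d a" "\<And>a. a < n \<Longrightarrow> d a \<le> f \<tau>"
    "(\<Sum>a<n. d a) = mat_trace (mat_fun f A) - mat_trace (mat_fun f H)"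
    "0 \<le> mat_trace (mat_fun f H)"
proof -
  obtain V \<mu> where V: "orthonormal_mat n V" and A': "A = spec n V \<mu>"
    using symmetric_mat_spec[OF psd_symmetric[OF A]] .
  obtain U \<nu> where U: "orthonormal_mat n U" and H': "H = spec n U \<nu>"
    using symmetric_mat_spec[OF psd_symmetric[OF H]] .
  have \<nu>: "0 \<le> \<nu> a" if "a < n" for a using H that by (simp add: H' psd_spec_iff[OF U])
  have fnn: "0 \<le> f x" if "0 \<le> x" for x using operator_monotone_mono[of 0 x] f0 that by simp
  define D where "D = mat_fun f A - mat_fun f H"
  have cA: "mat_fun f A \<in> carrier_mat n n" unfolding A' mat_fun_spec[OF V] by (rule spec_carrier[OF V])
  have cH: "mat_fun f H \<in> carrier_mat n n" unfolding H' mat_fun_spec[OF U] by (rule spec_carrier[OF U])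
  have "loewner_le n (mat_fun f H) (mat_fun f A)" using om A H HA by (auto simp: operator_monotone_def)
  then have psdD: "psd_mat n D" by (simp add: D_def loewner_le_def)
  obtain W d where W: "orthonormal_mat n W" and D: "D = spec n W d"
    using symmetric_mat_spec[OF psd_symmetric[OF psdD]] .
  have d0: "0 \<le> d a" if "a < n" for a using psdD that by (simp add: D psd_spec_iff[OF W])
  have psdH': "psd_mat n (spec n U (\<lambda>a. \<nu> a + \<tau>))" using \<nu> \<tau> by (simp add: psd_spec_iff[OF U])
  have shift: "Matrix.scalar_prod x (spec n U (\<lambda>a. g a + c) *\<^sub>v x)
      = Matrix.scalar_prod x (spec n U g *\<^sub>v x) + c * Matrix.scalar_prod x x" if "x \<in> carrier_vec n" for x g c
    unfolding spec_quadratic_form[OF U that] norm_coords[OF U that, symmetric]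
    by (simp add: distrib_right sum.distrib sum_distrib_left)
  have "loewner_le n A (spec n U (\<lambda>a. \<nu> a + \<tau>))"
    using AH by (intro loewner_leI spec_symmetric[OF U] psd_symmetric[OF A]) (simp add: shift H')
  then have le: "loewner_le n (mat_fun f A) (spec n U (\<lambda>a. f (\<nu> a + \<tau>)))"
    using om A psdH' unfolding operator_monotone_def by (metis mat_fun_spec[OF U])
  have "psd_mat n (spec n W (\<lambda>a. f \<tau> - d a))"
    unfolding psd_mat_def
  proof (intro conjI ballI spec_symmetric[OF W])
    fix x :: "real vec" assume x: "x \<in> carrier_vec n"
    have "Matrix.scalar_prod x (mat_fun f A *\<^sub>v x) \<le> Matrix.scalar_prod x (spec n U (\<lambda>a. f (\<nu> a + \<tau>)) *\<^sub>v x)"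
      by (rule loewner_leD[OF le x])
    also have "\<dots> \<le> Matrix.scalar_prod x (spec n U (\<lambda>a. f (\<nu> a) + f \<tau>) *\<^sub>v x)"
      unfolding spec_quadratic_form[OF U x]
      by (intro sum_mono mult_right_mono operator_monotone_subadditive f0 \<tau> \<nu>) auto
    also have "\<dots> = Matrix.scalar_prod x (mat_fun f H *\<^sub>v x) + f \<tau> * Matrix.scalar_prod x x"
      by (simp add: shift[OF x] H' mat_fun_spec[OF U])
    finally have "Matrix.scalar_prod x (D *\<^sub>v x) \<le> f \<tau> * Matrix.scalar_prod x x"
      unfolding D_def quadratic_form_minus[OF cA cH x] by linarith
    then show "0 \<le> Matrix.scalar_prod x (spec n W (\<lambda>a. f \<tau> - d a) *\<^sub>v x)"
      unfolding D spec_quadratic_form[OF W x] norm_coords[OF W x, symmetric]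
      by (simp add: left_diff_distrib sum_subtractf sum_distrib_left)
  qed
  then have dle: "d a \<le> f \<tau>" if "a < n" for a using that by (simp add: psd_spec_iff[OF W])
  have "(\<Sum>a<n. d a) = mat_trace D" by (simp add: D trace_spec[OF W])
  also have "\<dots> = mat_trace (mat_fun f A) - mat_trace (mat_fun f H)"
    using cA cH by (simp add: D_def mat_trace_def sum_subtractf)
  finally have tr: "(\<Sum>a<n. d a) = mat_trace (mat_fun f A) - mat_trace (mat_fun f H)" .
  have "0 \<le> mat_trace (mat_fun f H)"
    unfolding H' mat_fun_spec[OF U] trace_spec[OF U] using \<nu> fnn by (intro sum_nonneg) auto
  from that[OF W _ d0 dle tr this] show ?thesis using D by (simp add: D_def)
qed

end

subsection \<open>Measurability of the functional calculus\<close>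

definition measurable_mat :: "'a measure \<Rightarrow> nat \<Rightarrow> nat \<Rightarrow> ('a \<Rightarrow> real mat) \<Rightarrow> bool" where
  "measurable_mat M n m F \<longleftrightarrow> (\<forall>x\<in>space M. F x \<in> carrier_mat n m) \<and>
     (\<forall>i<n. \<forall>j<m. (\<lambda>x. F x $$ (i, j)) \<in> borel_measurable M)"

lemma measurable_matI:
  assumes "\<And>x. x \<in> space M \<Longrightarrow> F x \<in> carrier_mat n m"
    and "\<And>i j. i < n \<Longrightarrow> j < m \<Longrightarrow> (\<lambda>x. F x $$ (i, j)) \<in> borel_measurable M"
  shows "measurable_mat M n m F"
  using assms by (simp add: measurable_mat_def)

lemma measurable_mat_carrier: "measurable_mat M n m F \<Longrightarrow> x \<in> space M \<Longrightarrow> F x \<in> carrier_mat n m"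
  by (simp add: measurable_mat_def)

lemma measurable_mat_index:
  "measurable_mat M n m F \<Longrightarrow> i < n \<Longrightarrow> j < m \<Longrightarrow> (\<lambda>x. F x $$ (i, j)) \<in> borel_measurable M"
  by (simp add: measurable_mat_def)

lemma measurable_mat_cong:
  assumes "measurable_mat M n m F" "\<And>x. x \<in> space M \<Longrightarrow> F x = G x"
  shows "measurable_mat M n m G"
proof (rule measurable_matI)
  show "G x \<in> carrier_mat n m" if "x \<in> space M" for x
    using measurable_mat_carrier[OF assms(1) that] assms(2)[OF that] by simp
  show "(\<lambda>x. G x $$ (i, j)) \<in> borel_measurable M" if "i < n" "j < m" for i j
    using measurable_mat_index[OF assms(1) that] assms(2) by (subst measurable_cong) auto
qed

lemma measurable_mat_const: "A \<in> carrier_mat n m \<Longrightarrow> measurable_mat M n m (\<lambda>_. A)"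
  by (simp add: measurable_mat_def)

lemma measurable_mat_entries:
  assumes "\<And>i j. i < n \<Longrightarrow> j < m \<Longrightarrow> (\<lambda>x. F x i j) \<in> borel_measurable M"
  shows "measurable_mat M n m (\<lambda>x. Matrix.mat n m (\<lambda>(i, j). F x i j))"
  using assms by (intro measurable_matI) simp_all

lemma measurable_mat_mult:
  assumes F: "measurable_mat M n k F" and G: "measurable_mat M k m G"
  shows "measurable_mat M n m (\<lambda>x. F x * G x)"
proof -
  have "measurable_mat M n m (\<lambda>x. Matrix.mat n m (\<lambda>(i, j). \<Sum>l<k. F x $$ (i, l) * G x $$ (l, j)))"
    by (intro measurable_mat_entries borel_measurable_sum borel_measurable_times
        measurable_mat_index[OF F] measurable_mat_index[OF G]) auto
  then show ?thesis
  proof (rule measurable_mat_cong)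
    fix x assume x: "x \<in> space M"
    have c: "F x \<in> carrier_mat n k" "G x \<in> carrier_mat k m"
      using F G x by (auto simp: measurable_mat_def)
    show "Matrix.mat n m (\<lambda>(i, j). \<Sum>l<k. F x $$ (i, l) * G x $$ (l, j)) = F x * G x"
      by (rule eq_matI) (use c in \<open>auto simp del: index_mult_mat(1) simp: mat_mult_index[OF c]\<close>)
  qed
qed

lemma measurable_mat_add:
  assumes F: "measurable_mat M n m F" and G: "measurable_mat M n m G"
  shows "measurable_mat M n m (\<lambda>x. F x + G x)"
proof -
  have "measurable_mat M n m (\<lambda>x. Matrix.mat n m (\<lambda>(i, j). F x $$ (i, j) + G x $$ (i, j)))"
    by (intro measurable_mat_entries borel_measurable_add measurable_mat_index[OF F] measurable_mat_index[OF G])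
  then show ?thesis
  proof (rule measurable_mat_cong)
    fix x assume x: "x \<in> space M"
    note d = carrier_matD[OF measurable_mat_carrier[OF F x]] carrier_matD[OF measurable_mat_carrier[OF G x]]
    show "Matrix.mat n m (\<lambda>(i, j). F x $$ (i, j) + G x $$ (i, j)) = F x + G x"
      by (rule eq_matI) (simp_all add: d)
  qed
qed

lemma measurable_mat_minus:
  assumes F: "measurable_mat M n m F" and G: "measurable_mat M n m G"
  shows "measurable_mat M n m (\<lambda>x. F x - G x)"
proof -
  have "measurable_mat M n m (\<lambda>x. Matrix.mat n m (\<lambda>(i, j). F x $$ (i, j) - G x $$ (i, j)))"
    by (intro measurable_mat_entries borel_measurable_diff measurable_mat_index[OF F] measurable_mat_index[OF G])
  then show ?thesis
  proof (rule measurable_mat_cong)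
    fix x assume x: "x \<in> space M"
    note d = carrier_matD[OF measurable_mat_carrier[OF F x]] carrier_matD[OF measurable_mat_carrier[OF G x]]
    show "Matrix.mat n m (\<lambda>(i, j). F x $$ (i, j) - G x $$ (i, j)) = F x - G x"
      by (rule eq_matI) (simp_all add: d)
  qed
qed

lemma measurable_mat_transpose:
  assumes F: "measurable_mat M n m F"
  shows "measurable_mat M m n (\<lambda>x. transpose_mat (F x))"
proof -
  have "measurable_mat M m n (\<lambda>x. Matrix.mat m n (\<lambda>(i, j). F x $$ (j, i)))"
    by (intro measurable_mat_entries measurable_mat_index[OF F])
  then show ?thesis
  proof (rule measurable_mat_cong)
    fix x assume x: "x \<in> space M"
    note d = carrier_matD[OF measurable_mat_carrier[OF F x]]
    show "Matrix.mat m n (\<lambda>(i, j). F x $$ (j, i)) = transpose_mat (F x)"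
      by (rule eq_matI) (simp_all add: d)
  qed
qed

lemma measurable_mat_trace:
  assumes F: "measurable_mat M n n F"
  shows "(\<lambda>x. mat_trace (F x)) \<in> borel_measurable M"
proof -
  have "(\<lambda>x. \<Sum>i<n. F x $$ (i, i)) \<in> borel_measurable M"
    by (intro borel_measurable_sum measurable_mat_index[OF F]) auto
  also have "?this \<longleftrightarrow> ?thesis"
    using measurable_mat_carrier[OF F] by (intro measurable_cong) (auto simp: mat_trace_def)
  finally show ?thesis .
qed

text \<open>Only the finitely many eigenvalues of the fixed matrix matter, so pointwise convergence
  of the functions suffices.\<close>

lemma mat_fun_limit:
  assumes B: "symmetric_mat n B" and lim: "\<And>t. (\<lambda>k. h k t) \<longlonglongrightarrow> g t" and ij: "i < n" "j < n"
  shows "(\<lambda>k. mat_fun (h k) B $$ (i, j)) \<longlonglongrightarrow> mat_fun g B $$ (i, j)"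
proof -
  obtain V \<mu> where V: "orthonormal_mat n V" and B': "B = spec n V \<mu>" using symmetric_mat_spec[OF B] .
  show ?thesis unfolding B' mat_fun_spec[OF V] spec_index[OF V ij]
    by (intro tendsto_sum tendsto_mult lim tendsto_const)
qed

lemma mat_fun_carrier:
  assumes B: "symmetric_mat n B"
  shows "mat_fun h B \<in> carrier_mat n n"
proof -
  obtain V \<mu> where V: "orthonormal_mat n V" and B': "B = spec n V \<mu>" using symmetric_mat_spec[OF B] .
  show ?thesis unfolding B' mat_fun_spec[OF V] by (rule spec_carrier[OF V])
qed

text \<open>\<open>operator_monotone f\<close> constrains \<open>f\<close> on the nonnegative reals
  only. This lemma allows \<open>f\<close> to be exchanged for a representative that is Borel on the
  whole line.\<close>

lemma mat_fun_cong_psd: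
  assumes B: "psd_mat n B" and eq: "\<And>x. 0 \<le> x \<Longrightarrow> g x = h x"
  shows "mat_fun g B = mat_fun h B"
proof -
  obtain V \<mu> where V: "orthonormal_mat n V" and B': "B = spec n V \<mu>"
    using symmetric_mat_spec[of n B] B unfolding psd_mat_def by blast
  show ?thesis unfolding B' mat_fun_spec[OF V]
    by (rule spec_cong[OF V]) (use B in \<open>simp add: eq B' psd_spec_iff[OF V]\<close>)
qed

text \<open>The convention \<open>inverse 0 = 0\<close> leaves the kernel at zero while all other
  eigenvalues are inverted, which is what the pseudoinverse does.\<close>

lemma is_moore_penrose_spec:
  assumes V: "orthonormal_mat n V"
  shows "is_moore_penrose (spec n V \<mu>) (spec n V (\<lambda>a. inverse (\<mu> a)))"
proof -
  have i: "x * inverse x * x = x" "inverse x * x * inverse x = inverse x" for x :: real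
    by (cases "x = 0"; simp)+
  have "transpose_mat (spec n V h) = spec n V h" for h
    using spec_symmetric[OF V] by (simp add: symmetric_mat_def)
  then show ?thesis
    unfolding is_moore_penrose_def spec_mult[OF V] i
    by (simp add: carrier_matD[OF spec_carrier[OF V]] spec_carrier[OF V])
qed

text \<open>As a Borel function of the matrix, the pseudoinverse falls under the functional
  calculus, in spite of its jumps where the rank drops.\<close>

lemma moore_penrose_symmetric:
  assumes B: "symmetric_mat n B"
  shows "moore_penrose B = mat_fun inverse B" "is_moore_penrose B (moore_penrose B)"
    "symmetric_mat n (moore_penrose B)"
proof -
  obtain V \<mu> where V: "orthonormal_mat n V" and B': "B = spec n V \<mu>" using symmetric_mat_spec[OF B] .
  have e: "moore_penrose B = spec n V (\<lambda>a. inverse (\<mu> a))"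
    unfolding B' by (rule moore_penrose_eqI[OF is_moore_penrose_spec[OF V]])
  show "moore_penrose B = mat_fun inverse B" by (simp only: e) (simp only: B' mat_fun_spec[OF V])
  show "is_moore_penrose B (moore_penrose B)" by (simp only: e) (simp only: B' is_moore_penrose_spec[OF V])
  show "symmetric_mat n (moore_penrose B)" unfolding e by (rule spec_symmetric[OF V])
qed

section \<open>From polynomials to Borel functions of a measurable family of symmetric
  matrices\<close>

context
  fixes M :: "'a measure" and n :: nat and B :: "'a \<Rightarrow> real mat"
  assumes B: "measurable_mat M n n B" and sym: "\<And>x. x \<in> space M \<Longrightarrow> symmetric_mat n (B x)"
begin

text \<open>Polynomials belong to this class because sums and products of matrices preserve
  entrywise measurability; \<open>good_limit\<close> adds continuous functions, indicators and all
  nonnegative Borel functions. This route avoids a measurable choice of eigenvectors.\<close>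

private definition good :: "(real \<Rightarrow> real) \<Rightarrow> bool" where
  "good h \<longleftrightarrow> measurable_mat M n n (\<lambda>x. mat_fun h (B x))"

private lemma good_limit:
  assumes "\<And>k. good (h k)" "\<And>t. (\<lambda>k. h k t) \<longlonglongrightarrow> g t"
  shows "good g"
  unfolding good_def
proof (rule measurable_matI)
  show "mat_fun g (B x) \<in> carrier_mat n n" if "x \<in> space M" for x
    by (rule mat_fun_carrier[OF sym[OF that]])
  fix i j assume ij: "i < n" "j < n"
  show "(\<lambda>x. mat_fun g (B x) $$ (i, j)) \<in> borel_measurable M"
  proof (rule borel_measurable_LIMSEQ_real)
    show "(\<lambda>k. mat_fun (h k) (B x) $$ (i, j)) \<longlonglongrightarrow> mat_fun g (B x) $$ (i, j)" if "x \<in> space M" for x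
      by (rule mat_fun_limit[OF sym[OF that] assms(2) ij])
    show "(\<lambda>x. mat_fun (h k) (B x) $$ (i, j)) \<in> borel_measurable M" for k
      using assms(1)[of k] ij unfolding good_def by (rule measurable_mat_index)
  qed
qed

private lemma good_const: "good (\<lambda>_. c)"
  unfolding good_def
proof (rule measurable_mat_cong)
  show "measurable_mat M n n (\<lambda>_. c \<cdot>\<^sub>m 1\<^sub>m n)" by (intro measurable_mat_const) simp
  fix x assume x: "x \<in> space M"
  obtain V \<mu> where V: "orthonormal_mat n V" and B': "B x = spec n V \<mu>"
    using symmetric_mat_spec[OF sym[OF x]] .
  show "c \<cdot>\<^sub>m 1\<^sub>m n = mat_fun (\<lambda>_. c) (B x)"
    unfolding B' mat_fun_spec[OF V] spec_one[OF V, symmetric] spec_smult[OF V] by simp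
qed

private lemma good_ident: "good (\<lambda>t. t)"
  unfolding good_def using B
proof (rule measurable_mat_cong)
  fix x assume x: "x \<in> space M"
  obtain V \<mu> where V: "orthonormal_mat n V" and B': "B x = spec n V \<mu>"
    using symmetric_mat_spec[OF sym[OF x]] .
  show "B x = mat_fun (\<lambda>t. t) (B x)" unfolding B' mat_fun_spec[OF V] ..
qed

private lemma good_add:
  assumes "good g" "good h"
  shows "good (\<lambda>t. g t + h t)"
  unfolding good_def
proof (rule measurable_mat_cong)
  show "measurable_mat M n n (\<lambda>x. mat_fun g (B x) + mat_fun h (B x))"
    using assms by (intro measurable_mat_add) (auto simp: good_def)
  fix x assume x: "x \<in> space M"
  obtain V \<mu> where V: "orthonormal_mat n V" and B': "B x = spec n V \<mu>"
    using symmetric_mat_spec[OF sym[OF x]] .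
  show "mat_fun g (B x) + mat_fun h (B x) = mat_fun (\<lambda>t. g t + h t) (B x)"
    unfolding B' mat_fun_spec[OF V] by (rule spec_add[OF V])
qed

private lemma good_mult:
  assumes "good g" "good h"
  shows "good (\<lambda>t. g t * h t)"
  unfolding good_def
proof (rule measurable_mat_cong)
  show "measurable_mat M n n (\<lambda>x. mat_fun g (B x) * mat_fun h (B x))"
    using assms by (intro measurable_mat_mult) (auto simp: good_def)
  fix x assume x: "x \<in> space M"
  obtain V \<mu> where V: "orthonormal_mat n V" and B': "B x = spec n V \<mu>"
    using symmetric_mat_spec[OF sym[OF x]] .
  show "mat_fun g (B x) * mat_fun h (B x) = mat_fun (\<lambda>t. g t * h t) (B x)"
    unfolding B' mat_fun_spec[OF V] by (rule spec_mult[OF V])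
qed

private lemma good_diff:
  assumes "good g" "good h"
  shows "good (\<lambda>t. g t - h t)"
  using good_add[OF assms(1) good_mult[OF good_const[of "- 1"] assms(2)]] by simp

private lemma good_polynomial: "real_polynomial_function p \<Longrightarrow> good p"
proof (induction rule: real_polynomial_function.induct)
  case (linear p)
  interpret bounded_linear p by (rule linear)
  have p: "p = (\<lambda>t. p 1 * t)"
  proof
    fix t
    have "p (t *\<^sub>R 1) = t *\<^sub>R p 1" by (rule scaleR)
    then show "p t = p 1 * t" by (simp add: mult.commute)
  qed
  show ?case by (subst p) (rule good_mult[OF good_const good_ident])
next
  case (const c)
  show ?case by (rule good_const)
next
  case (add g h)
  then show ?case by (intro good_add)
next
  case (mult g h)
  then show ?case by (intro good_mult)
qed

text \<open>The polynomials approximate \<open>h\<close> on growing intervals with shrinking error.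
  Every \<open>t\<close> lies in all but finitely many of these intervals, which gives convergence
  at each point of the line.\<close>

private lemma good_continuous:
  assumes "continuous_on UNIV h"
  shows "good h"
proof -
  have "\<exists>p. real_polynomial_function p \<and> (\<forall>t\<in>{- real k..real k}. \<bar>h t - p t\<bar> < 1 / real (Suc k))" for k
  proof -
    have c: "continuous_on {- real k..real k} h" by (rule continuous_on_subset[OF assms]) simp
    have "0 < 1 / real (Suc k)" by simp
    then obtain g where "real_polynomial_function g" "\<And>t. t \<in> {- real k..real k} \<Longrightarrow> \<bar>h t - g t\<bar> < 1 / real (Suc k)"
      by (rule Stone_Weierstrass_real_polynomial_function[OF compact_Icc c]) blast
    then show ?thesis by blast
  qed
  then obtain p where p: "\<And>k. real_polynomial_function (p k)"
    "\<And>k t. t \<in> {- real k..real k} \<Longrightarrow> \<bar>h t - p k t\<bar> < 1 / real (Suc k)"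
    by metis
  show ?thesis
  proof (rule good_limit[OF good_polynomial[OF p(1)]])
    fix t
    obtain K where K: "\<bar>t\<bar> \<le> real K" using real_arch_simple by blast
    have "(\<lambda>k. p k t - h t) \<longlonglongrightarrow> 0"
    proof (rule Lim_null_comparison)
      show "\<forall>\<^sub>F k in sequentially. norm (p k t - h t) \<le> 1 / real (Suc k)"
      proof (rule eventually_sequentiallyI[of K])
        fix k assume "K \<le> k"
        then have "t \<in> {- real k..real k}" using K by auto
        from p(2)[OF this] show "norm (p k t - h t) \<le> 1 / real (Suc k)" by simp
      qed
      show "(\<lambda>k. 1 / real (Suc k)) \<longlonglongrightarrow> 0"
        using LIMSEQ_inverse_real_of_nat by (simp add: inverse_eq_divide)
    qed
    then show "(\<lambda>k. p k t) \<longlonglongrightarrow> h t" by (simp only: LIM_zero_iff)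
  qed
qed

private lemma good_indicator_greaterThan: "good (indicator {a<..})"
proof (rule good_limit)
  \<comment> \<open>Ramps of slope \<open>k\<close> starting at \<open>a\<close>: they vanish up to
    and including \<open>a\<close>, and hence converge to the indicator of the open ray.\<close>
  show "good (\<lambda>t. min 1 (max 0 (real k * (t - a))))" for k
    by (intro good_continuous continuous_intros)
  fix t
  show "(\<lambda>k. min 1 (max 0 (real k * (t - a)))) \<longlonglongrightarrow> indicator {a<..} t"
  proof (cases "a < t")
    case True
    obtain K where K: "1 / (t - a) \<le> real K" using real_arch_simple by blast
    have "\<forall>\<^sub>F k in sequentially. min 1 (max 0 (real k * (t - a))) = 1"
    proof (rule eventually_sequentiallyI[of K])
      fix k assume "K \<le> k"
      then have "1 / (t - a) \<le> real k" using K by linarith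
      then have "1 \<le> real k * (t - a)" using True by (simp add: field_simps)
      then show "min 1 (max 0 (real k * (t - a))) = 1" by simp
    qed
    then show ?thesis using True by (simp add: tendsto_eventually)
  next
    case False
    then have "max 0 (real k * (t - a)) = 0" for k
      by (intro max_absorb1 mult_nonneg_nonpos) auto
    then show ?thesis using False by simp
  qed
qed

text \<open>Closure under products gives finite unions by inclusion-exclusion, and
  \<open>good_limit\<close> gives countable ones. So the induction can run over the sigma-algebra
  generated by the rays itself.\<close>

private lemma good_indicator:
  assumes "A \<in> sets (borel :: real measure)"
  shows "good (indicator A)"
proof -
  have "sets (borel :: real measure) = sigma_sets UNIV (range greaterThan)"
    by (subst borel_Ioi) (simp add: sets_measure_of)
  with assms have "A \<in> sigma_sets UNIV (range greaterThan)" by simp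
  then show ?thesis
  proof (induction rule: sigma_sets.induct)
    case (Basic A)
    then show ?case using good_indicator_greaterThan by auto
  next
    case Empty
    then show ?case using good_const[of 0] by (simp add: indicator_def[abs_def])
  next
    case (Compl A)
    have "indicator (UNIV - A) = (\<lambda>t. 1 - indicator A t :: real)" by (auto simp: indicator_def)
    then show ?case using good_diff[OF good_const Compl.IH] by simp
  next
    case (Union A)
    have fin: "good (indicator (\<Union>i<k. A i))" for k :: nat
    proof (induction k)
      case 0
      then show ?case using good_const[of 0] by (simp add: indicator_def[abs_def])
    next
      case (Suc k)
      have "indicator (\<Union>i<Suc k. A i) = (\<lambda>t. indicator (\<Union>i<k. A i) t + indicator (A k) t
          - indicator (\<Union>i<k. A i) t * indicator (A k) t :: real)"
        by (auto simp: indicator_def less_Suc_eq fun_eq_iff)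
      then show ?case using good_diff[OF good_add[OF Suc Union.IH] good_mult[OF Suc Union.IH]] by simp
    qed
    show ?case
    proof (rule good_limit[OF fin])
      fix t
      show "(\<lambda>k. indicator (\<Union>i<k. A i) t :: real) \<longlonglongrightarrow> indicator (\<Union>i. A i) t"
      proof (cases "t \<in> (\<Union>i. A i)")
        case True
        then obtain i where i: "t \<in> A i" by auto
        have "\<forall>\<^sub>F k in sequentially. indicator (\<Union>i<k. A i) t = (1 :: real)"
          using i by (intro eventually_sequentiallyI[of "Suc i"]) (auto simp: indicator_def)
        then show ?thesis using True by (simp add: tendsto_eventually)
      next
        case False
        then have "indicator (\<Union>i<k. A i) t = (0 :: real)" for k by (auto simp: indicator_def)
        then show ?thesis using False by simp
      qed
    qed
  qed
qed

private lemma good_nonneg: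
  assumes "h \<in> borel_measurable borel" "\<And>t. 0 \<le> h t"
  shows "good h"
  using assms
proof (induction rule: borel_measurable_induct_real)
  case (set A)
  then show ?case by (rule good_indicator)
next
  case (mult u c)
  show ?case by (rule good_mult[OF good_const mult.IH])
next
  case (add u v)
  show ?case by (rule good_add[OF add.IH(2) add.IH(1)])
next
  case (seq U)
  show ?case
  proof (rule good_limit)
    show "good (U k)" for k by (rule seq.IH)
    show "(\<lambda>k. U k t) \<longlonglongrightarrow> h t" for t by (rule seq.hyps(4)) simp
  qed
qed

lemma measurable_mat_fun:
  assumes h: "h \<in> borel_measurable borel"
  shows "measurable_mat M n n (\<lambda>x. mat_fun h (B x))"
proof -
  have "good (\<lambda>t. max 0 (h t))" by (rule good_nonneg) (use h in simp_all)
  moreover have "good (\<lambda>t. max 0 (- h t))" by (rule good_nonneg) (use h in simp_all)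
  ultimately have "good (\<lambda>t. max 0 (h t) - max 0 (- h t))" by (rule good_diff)
  also have "(\<lambda>t. max 0 (h t) - max 0 (- h t)) = h" by (intro ext) (simp add: max_def)
  finally show ?thesis by (simp only: good_def)
qed

lemma measurable_mat_moore_penrose: "measurable_mat M n n (\<lambda>x. moore_penrose (B x))"
proof (rule measurable_mat_cong)
  have "(\<lambda>t :: real. inverse t) \<in> borel_measurable borel"
    by (intro borel_measurable_inverse) simp
  then show "measurable_mat M n n (\<lambda>x. mat_fun inverse (B x))" by (rule measurable_mat_fun)
  show "mat_fun inverse (B x) = moore_penrose (B x)" if "x \<in> space M" for x
    using moore_penrose_symmetric(1)[OF sym[OF that]] by simp
qed

end

subsection \<open>Deterministic error bound for the Nystrom approximation\<close>

text \<open>The diagonal of \<open>Y Y\<^sup>T\<close> consists of the squared norms of the rows of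
  \<open>Y\<close>.\<close>

lemma mat_mult_transpose_eq_0:
  fixes Y :: "real mat"
  assumes Y: "Y \<in> carrier_mat m n" and 0: "Y * transpose_mat Y = 0\<^sub>m m m"
  shows "Y = 0\<^sub>m m n"
proof (rule eq_matI)
  fix i j assume "i < dim_row (0\<^sub>m m n :: real mat)" "j < dim_col (0\<^sub>m m n :: real mat)"
  then have ij: "i < m" "j < n" by auto
  have "(\<Sum>l<n. (Y $$ (i, l))\<^sup>2) = (\<Sum>l<n. Y $$ (i, l) * transpose_mat Y $$ (l, i))"
    using Y ij by (intro sum.cong) (auto simp: power2_eq_square)
  also have "\<dots> = (Y * transpose_mat Y) $$ (i, i)"
    using Y ij by (intro mat_mult_index[symmetric, of _ m n _ m]) auto
  finally have "(\<Sum>l<n. (Y $$ (i, l))\<^sup>2) = 0" using ij by (simp add: 0)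
  then show "Y $$ (i, j) = 0\<^sub>m m n $$ (i, j)"
    using ij by (subst (asm) sum_nonneg_eq_0_iff) auto
qed (use Y in auto)

lemma symmetric_mat_adjoint:
  assumes "symmetric_mat n B" "x \<in> carrier_vec n" "y \<in> carrier_vec n"
  shows "Matrix.scalar_prod (B *\<^sub>v x) y = Matrix.scalar_prod x (B *\<^sub>v y)"
  using transpose_vec_mult_scalar[of B n n y x] assms by (simp add: symmetric_mat_def)

lemma scalar_prod_nonneg: "0 \<le> Matrix.scalar_prod x (x :: real vec)"
  by (simp add: Matrix.scalar_prod_def sum_nonneg)

lemma scalar_prod_Cauchy_Schwarz:
  fixes x y :: "real vec"
  assumes "x \<in> carrier_vec n" "y \<in> carrier_vec n"
  shows "(Matrix.scalar_prod x y)\<^sup>2 \<le> Matrix.scalar_prod x x * Matrix.scalar_prod y y"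
  using Cauchy_Schwarz_ineq_sum[of "\<lambda>i. x $ i" "\<lambda>i. y $ i" "{0..<n}"] assms
  by (simp add: Matrix.scalar_prod_def power2_eq_square)

lemma symmetric_transpose_mult:
  assumes "Z \<in> carrier_mat n r"
  shows "symmetric_mat r (transpose_mat Z * Z)"
  using assms by (simp add: symmetric_mat_def transpose_mult[of _ r n _ r] mult_carrier_mat[of _ r n _ r])

text \<open>\<open>P\<close> is the orthogonal projector onto the column space of \<open>Z\<close>.
  Symmetry and idempotence are read off from the pseudoinverse of the Gram matrix; that
  \<open>P\<close> fixes the columns of \<open>Z\<close> requires a passage from the Gram matrix
  back to \<open>Z\<close>.\<close>

lemma range_projector:
  assumes Z: "Z \<in> carrier_mat n r"
  defines "P \<equiv> Z * moore_penrose (transpose_mat Z * Z) * transpose_mat Z"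
  shows "symmetric_mat n P" "P * P = P" "transpose_mat Z * P = transpose_mat Z"
proof -
  define M where "M = transpose_mat Z * Z"
  define X where "X = moore_penrose M"
  have sM: "symmetric_mat r M" unfolding M_def by (rule symmetric_transpose_mult[OF Z])
  have X: "symmetric_mat r X" "M * X * M = M" "X * M * X = X"
    using moore_penrose_symmetric(2,3)[OF sM] by (auto simp: X_def is_moore_penrose_def)
  have c [simp]: "Z \<in> carrier_mat n r" "transpose_mat Z \<in> carrier_mat r n"
    "M \<in> carrier_mat r r" "X \<in> carrier_mat r r"
    using Z sM X(1) by (auto simp: symmetric_mat_def)
  have T: "transpose_mat M = M" "transpose_mat X = X" using sM X(1) by (auto simp: symmetric_mat_def)
  have P: "P = Z * X * transpose_mat Z" by (simp add: P_def M_def X_def)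
  have cP [simp]: "P \<in> carrier_mat n n" by (simp add: P mult_carrier_mat[of _ n r])
  note m = mult_carrier_mat[of _ r r _ r] mult_carrier_mat[of _ n r _ r] mult_carrier_mat[of _ r r _ n]
    mult_carrier_mat[of _ n r _ n] mult_carrier_mat[of _ r n _ r] mult_carrier_mat[of _ r n _ n]
  have "transpose_mat P = transpose_mat (transpose_mat Z) * transpose_mat (Z * X)"
    unfolding P by (rule transpose_mult[of _ n r _ n]) (simp_all add: m)
  also have "transpose_mat (Z * X) = transpose_mat X * transpose_mat Z"
    by (rule transpose_mult[of _ n r _ r]) simp_all
  finally have "transpose_mat P = P"
    by (simp add: T P assoc_mult_mat[of _ n r _ r _ n])
  then show "symmetric_mat n P" by (simp add: symmetric_mat_def)
  have "P * P = Z * X * (transpose_mat Z * (Z * X * transpose_mat Z))"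
    unfolding P by (rule assoc_mult_mat[of _ n r _ n _ n]) (simp_all add: m)
  also have "transpose_mat Z * (Z * X * transpose_mat Z) = transpose_mat Z * (Z * X) * transpose_mat Z"
    by (rule assoc_mult_mat[symmetric, of _ r n _ r _ n]) (simp_all add: m)
  also have "transpose_mat Z * (Z * X) = M * X"
    unfolding M_def by (rule assoc_mult_mat[symmetric, of _ r n _ r _ r]) simp_all
  also have "Z * X * (M * X * transpose_mat Z) = Z * X * (M * X) * transpose_mat Z"
    by (rule assoc_mult_mat[symmetric, of _ n r _ r _ n]) (simp_all add: m)
  also have "Z * X * (M * X) = Z * (X * M * X)"
    by (simp add: assoc_mult_mat[of _ n r _ r _ r] assoc_mult_mat[of _ r r _ r _ r] m)
  finally show "P * P = P" by (simp add: X P)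
  \<comment> \<open>The transpose of \<open>(1 - P) Z\<close>. The identity
    \<open>M * X * M = M\<close> only yields \<open>Y Z = 0\<close>; but \<open>Y\<^sup>T\<close>
    has the form \<open>Z (1 - X M)\<close>, so \<open>Y Y\<^sup>T = 0\<close> follows.\<close>
  define Y where "Y = transpose_mat Z - M * X * transpose_mat Z"
  have cY: "Y \<in> carrier_mat r n" by (simp add: Y_def m minus_carrier_mat[of _ r n])
  have TY: "transpose_mat Y = Z - Z * (X * M)"
  proof -
    have "transpose_mat (M * X * transpose_mat Z) = transpose_mat (transpose_mat Z) * transpose_mat (M * X)"
      by (rule transpose_mult[of _ r r _ n]) (simp_all add: m)
    also have "transpose_mat (M * X) = X * M"
      by (subst transpose_mult[of _ r r _ r]) (simp_all add: T)
    finally show ?thesis unfolding Y_def by (subst transpose_minus[of _ r n]) (simp_all add: m)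
  qed
  have MXM: "M * X * M = M" by (rule X(2))
  have YZ: "Y * Z = 0\<^sub>m r r"
  proof -
    have "Y * Z = transpose_mat Z * Z - M * X * transpose_mat Z * Z"
      unfolding Y_def by (rule minus_mult_distrib_mat[of _ r n _ _ r]) (simp_all add: m)
    also have "M * X * transpose_mat Z * Z = M * X * M"
      unfolding M_def[symmetric] by (subst assoc_mult_mat[of _ r r _ n _ r]) (simp_all add: m M_def[symmetric])
    finally show ?thesis by (simp add: MXM M_def[symmetric])
  qed
  have "Y * transpose_mat Y = Y * Z - Y * (Z * (X * M))"
    unfolding TY by (rule mult_minus_distrib_mat[of _ r n _ r]) (simp_all add: m cY)
  also have "Y * (Z * (X * M)) = Y * Z * (X * M)"
    by (rule assoc_mult_mat[symmetric, of _ r n _ r _ r]) (simp_all add: m cY)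
  finally have "Y * transpose_mat Y = 0\<^sub>m r r" by (simp add: YZ m left_mult_zero_mat[of _ r r])
  then have Y0: "Y = 0\<^sub>m r n" by (rule mat_mult_transpose_eq_0[OF cY])
  have cW: "M * X * transpose_mat Z \<in> carrier_mat r n" by (simp add: m)
  have "transpose_mat Z = M * X * transpose_mat Z"
  proof (rule eq_matI)
    fix i j assume "i < dim_row (M * X * transpose_mat Z)" "j < dim_col (M * X * transpose_mat Z)"
    then have ij: "i < r" "j < n" by (simp_all only: carrier_matD[OF cW])
    have "Y $$ (i, j) = transpose_mat Z $$ (i, j) - (M * X * transpose_mat Z) $$ (i, j)"
      unfolding Y_def by (rule index_minus_mat(1)) (simp_all only: carrier_matD[OF cW] ij)
    then show "transpose_mat Z $$ (i, j) = (M * X * transpose_mat Z) $$ (i, j)"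
      using ij by (simp only: Y0 index_zero_mat(1))
  qed (simp_all only: carrier_matD[OF cW] carrier_matD[OF c(2)])
  also have "\<dots> = transpose_mat Z * P"
    unfolding P M_def by (simp add: assoc_mult_mat[of _ r n _ r _ r] assoc_mult_mat[of _ r n _ r _ n]
        assoc_mult_mat[of _ n r _ r _ n] assoc_mult_mat[of _ r r _ r _ n] m)
  finally show "transpose_mat Z * P = transpose_mat Z" ..
qed

text \<open>Let \<open>R = A^(1/2)\<close>, \<open>a = R x\<close> and \<open>e = a - P a\<close>.
  The forms of \<open>A\<close> and of the approximation at \<open>x\<close> are
  \<open>|a|\<^sup>2\<close> and \<open>|P a|\<^sup>2\<close>, so they differ by
  \<open>|e|\<^sup>2\<close>. In the premise \<open>kernel\<close> the vector \<open>c\<close> lists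
  eigencoordinates, and \<open>sqrt (\<mu> a) ^ (2 * q - 1)\<close> is the power of
  \<open>\<mu> a\<close> with the half-integer exponent \<open>q - 1/2\<close>.\<close>

lemma nystrom_perturbation:
  assumes V: "orthonormal_mat n V" and A: "A = spec n V \<mu>" and \<mu>: "\<And>a. a < n \<Longrightarrow> 0 \<le> \<mu> a"
    and \<Omega>: "\<Omega> \<in> carrier_mat n r" and q: "1 \<le> q" and \<tau>: "0 \<le> \<tau>"
    and kernel: "\<And>c. (\<And>j. j < r \<Longrightarrow>
        (\<Sum>a<n. (\<Sum>i<n. V $$ (i, a) * \<Omega> $$ (i, j)) * (sqrt (\<mu> a) ^ (2 * q - 1) * c a)) = 0) \<Longrightarrow>
      (\<Sum>a<n. \<mu> a * (c a)\<^sup>2) \<le> \<tau> * (\<Sum>a<n. (c a)\<^sup>2)"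
  shows "psd_mat n (nystrom q A \<Omega>)" "loewner_le n (nystrom q A \<Omega>) A"
    "x \<in> carrier_vec n \<Longrightarrow> Matrix.scalar_prod x (A *\<^sub>v x)
      \<le> Matrix.scalar_prod x (nystrom q A \<Omega> *\<^sub>v x) + \<tau> * Matrix.scalar_prod x x"
proof -
  define R where "R = spec n V (\<lambda>a. sqrt (\<mu> a))"
  define S where "S = spec n V (\<lambda>a. sqrt (\<mu> a) ^ (2 * q - 1))"
  define Z where "Z = S * \<Omega>"
  define X where "X = moore_penrose (transpose_mat Z * Z)"
  define P where "P = Z * X * transpose_mat Z"
  have sR: "symmetric_mat n R" and sS: "symmetric_mat n S"
    by (simp_all add: R_def S_def spec_symmetric[OF V])
  have [simp]: "R \<in> carrier_mat n n" "S \<in> carrier_mat n n" "\<Omega> \<in> carrier_mat n r"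
    using \<Omega> by (simp_all add: R_def S_def spec_carrier[OF V])
  have cZ [simp]: "Z \<in> carrier_mat n r" by (simp add: Z_def mult_carrier_mat[of _ n n _ r])
  have TR: "transpose_mat R = R" and TS: "transpose_mat S = S"
    using sR sS by (auto simp: symmetric_mat_def)
  note proj = range_projector[OF cZ, folded X_def P_def]
  have cP [simp]: "P \<in> carrier_mat n n" using proj(1) by (simp add: symmetric_mat_def)
  have cX [simp]: "X \<in> carrier_mat r r"
    using moore_penrose_symmetric(3)[OF symmetric_transpose_mult[OF cZ]]
    by (simp add: X_def symmetric_mat_def)
  note m = mult_carrier_mat[of _ n n _ n] mult_carrier_mat[of _ n n _ r] mult_carrier_mat[of _ n r _ r]
    mult_carrier_mat[of _ n r _ n] mult_carrier_mat[of _ r n _ n] mult_carrier_mat[of _ r n _ r]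
  have RR: "R * R = A"
    unfolding R_def A spec_mult[OF V] by (rule spec_cong[OF V]) (simp add: \<mu>)
  have Aq: "A ^\<^sub>m q = R * S"
    unfolding R_def S_def A spec_mult[OF V] spec_power[OF V]
  proof (rule spec_cong[OF V])
    fix a assume "a < n"
    have "sqrt (\<mu> a) * sqrt (\<mu> a) ^ (2 * q - 1) = sqrt (\<mu> a) ^ (2 * q)"
      using q by (cases q) auto
    then show "\<mu> a ^ q = sqrt (\<mu> a) * sqrt (\<mu> a) ^ (2 * q - 1)"
      using \<mu>[OF \<open>a < n\<close>] by (simp add: power_mult)
  qed
  have Ap: "A ^\<^sub>m (2 * q - 1) = S * S"
    unfolding S_def A spec_mult[OF V] spec_power[OF V]
    by (rule spec_cong[OF V]) (simp add: \<mu> power_mult_distrib[symmetric])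
  have "transpose_mat \<Omega> * (S * S) * \<Omega> = transpose_mat \<Omega> * S * (S * \<Omega>)"
    by (simp add: assoc_mult_mat[of _ r n _ n _ r] assoc_mult_mat[of _ r n _ n _ n] assoc_mult_mat[of _ n n _ n _ r] m)
  also have "transpose_mat \<Omega> * S = transpose_mat Z"
    unfolding Z_def by (subst transpose_mult[of _ n n _ r]) (simp_all add: TS)
  finally have M: "transpose_mat \<Omega> * A ^\<^sub>m (2 * q - 1) * \<Omega> = transpose_mat Z * Z"
    unfolding Ap Z_def[symmetric] .
  have AZ: "A ^\<^sub>m q * \<Omega> = R * Z"
    unfolding Aq Z_def by (rule assoc_mult_mat[of _ n n _ n _ r]) simp_all
  have H: "nystrom q A \<Omega> = R * P * R"
  proof -
    have "nystrom q A \<Omega> = R * Z * X * transpose_mat (R * Z)"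
      unfolding nystrom_def M AZ X_def ..
    also have "transpose_mat (R * Z) = transpose_mat Z * R"
      by (subst transpose_mult[of _ n n _ r]) (simp_all add: TR)
    finally show ?thesis unfolding P_def
      by (simp add: assoc_mult_mat[of _ n n _ r _ r] assoc_mult_mat[of _ n n _ r _ n] assoc_mult_mat[of _ n n _ n _ n]
          assoc_mult_mat[of _ n r _ r _ n] assoc_mult_mat[of _ r r _ r _ n] assoc_mult_mat[of _ n r _ n _ n]
          assoc_mult_mat[of _ r r _ n _ n] assoc_mult_mat[of _ r n _ n _ n] m mult_carrier_mat[of _ r r _ n])
  qed
  have cA: "A \<in> carrier_mat n n" by (simp add: A spec_carrier[OF V])
  have cH: "nystrom q A \<Omega> \<in> carrier_mat n n" by (simp add: H m)
  have sP: "symmetric_mat n P" by (rule proj(1))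
  have TP: "transpose_mat P = P" using sP by (simp add: symmetric_mat_def)
  have sH: "symmetric_mat n (nystrom q A \<Omega>)"
    unfolding symmetric_mat_def H
    by (simp add: m transpose_mult[of _ n n _ n] TP TR assoc_mult_mat[of _ n n _ n _ n])
  let ?ip = "Matrix.scalar_prod :: real vec \<Rightarrow> real vec \<Rightarrow> real"
  have main: "0 \<le> ?ip x (nystrom q A \<Omega> *\<^sub>v x)"
    "?ip x (nystrom q A \<Omega> *\<^sub>v x) \<le> ?ip x (A *\<^sub>v x)"
    "?ip x (A *\<^sub>v x) \<le> ?ip x (nystrom q A \<Omega> *\<^sub>v x) + \<tau> * ?ip x x" if x: "x \<in> carrier_vec n" for x
  proof -
    define a where "a = R *\<^sub>v x"
    define e where "e = a - P *\<^sub>v a"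
    have ca [simp]: "a \<in> carrier_vec n" using x by (simp add: a_def mult_mat_vec_carrier[of _ n n])
    have cPa [simp]: "P *\<^sub>v a \<in> carrier_vec n" by (simp add: mult_mat_vec_carrier[of _ n n])
    have ce [simp]: "e \<in> carrier_vec n" by (simp add: e_def)
    have cRe [simp]: "R *\<^sub>v e \<in> carrier_vec n" by (simp add: mult_mat_vec_carrier[of _ n n])
    have PPa: "P *\<^sub>v (P *\<^sub>v a) = P *\<^sub>v a"
      using assoc_mult_mat_vec[of P n n P n a] by (simp add: proj(2))
    have xA: "?ip x (A *\<^sub>v x) = ?ip a a"
      using x symmetric_mat_adjoint[OF sR x ca] unfolding RR[symmetric] a_def
      by (simp add: assoc_mult_mat_vec[of _ n n _ n])
    have xH: "?ip x (nystrom q A \<Omega> *\<^sub>v x) = ?ip a (P *\<^sub>v a)"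
    proof -
      have "nystrom q A \<Omega> *\<^sub>v x = R *\<^sub>v (P *\<^sub>v a)"
        using x by (simp add: H a_def assoc_mult_mat_vec[of _ n n _ n] m mult_mat_vec_carrier[of _ n n])
      then show ?thesis using symmetric_mat_adjoint[OF sR x cPa] by (simp add: a_def)
    qed
    have Pa2: "?ip (P *\<^sub>v a) (P *\<^sub>v a) = ?ip a (P *\<^sub>v a)"
      using symmetric_mat_adjoint[OF sP ca cPa] by (simp add: PPa)
    have eP: "?ip e (P *\<^sub>v a) = 0"
      unfolding e_def by (simp add: minus_scalar_prod_distrib[of _ n] Pa2)
    have ee: "?ip e e = ?ip e a"
      using eP scalar_prod_minus_distrib[of e n a "P *\<^sub>v a"] by (simp add: e_def[symmetric])
    have ee': "?ip e e = ?ip a a - ?ip a (P *\<^sub>v a)"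
      unfolding ee unfolding e_def
      by (simp add: minus_scalar_prod_distrib[of _ n] comm_scalar_prod[of "P *\<^sub>v a" n a])
    show "0 \<le> ?ip x (nystrom q A \<Omega> *\<^sub>v x)"
      unfolding xH Pa2[symmetric] by (rule scalar_prod_nonneg)
    show "?ip x (nystrom q A \<Omega> *\<^sub>v x) \<le> ?ip x (A *\<^sub>v x)"
      unfolding xH xA using ee' scalar_prod_nonneg[of e] by linarith
    define c where "c b = (\<Sum>i<n. V $$ (i, b) * e $ i)" for b
    \<comment> \<open>The projector fixes the columns of \<open>Z\<close>, so the residual
      \<open>e\<close> is orthogonal to them; in eigencoordinates this is the premise of
      \<open>kernel\<close>.\<close>
    have Ze: "transpose_mat Z *\<^sub>v e = 0\<^sub>v r"
    proof -
      have "transpose_mat Z *\<^sub>v (P *\<^sub>v a) = transpose_mat Z *\<^sub>v a"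
        using assoc_mult_mat_vec[of "transpose_mat Z" r n P n a] by (simp add: proj(3))
      then show ?thesis unfolding e_def
        by (subst mult_minus_distrib_mat_vec[of _ r n]) (auto simp: mult_mat_vec_carrier[of _ r n])
    qed
    have "(\<Sum>b<n. (\<Sum>i<n. V $$ (i, b) * \<Omega> $$ (i, j)) * (sqrt (\<mu> b) ^ (2 * q - 1) * c b)) = 0"
      if j: "j < r" for j
    proof -
      have Zij: "Z $$ (i, j) = (\<Sum>l<n. \<Sum>b<n. sqrt (\<mu> b) ^ (2 * q - 1) * V $$ (i, b) * V $$ (l, b) * \<Omega> $$ (l, j))"
        if "i < n" for i
        unfolding Z_def using that j
        by (subst mat_mult_index[of _ n n _ r]) (auto simp: S_def spec_index[OF V] spec_carrier[OF V] sum_distrib_right)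
      have "0 = (transpose_mat Z *\<^sub>v e) $ j" using Ze j by simp
      also have "\<dots> = (\<Sum>i<n. transpose_mat Z $$ (j, i) * e $ i)"
        by (rule mat_vec_index[of _ r n]) (use j in auto)
      also have "\<dots> = (\<Sum>i<n. Z $$ (i, j) * e $ i)"
        using j carrier_matD[OF cZ] by (intro sum.cong) auto
      also have "\<dots> = (\<Sum>i<n. \<Sum>l<n. \<Sum>b<n. sqrt (\<mu> b) ^ (2 * q - 1) * V $$ (i, b) * V $$ (l, b) * \<Omega> $$ (l, j) * e $ i)"
        by (simp add: Zij sum_distrib_right)
      also have "\<dots> = (\<Sum>i<n. \<Sum>b<n. \<Sum>l<n. sqrt (\<mu> b) ^ (2 * q - 1) * V $$ (i, b) * V $$ (l, b) * \<Omega> $$ (l, j) * e $ i)"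
        by (intro sum.cong refl sum.swap)
      also have "\<dots> = (\<Sum>b<n. \<Sum>i<n. \<Sum>l<n. sqrt (\<mu> b) ^ (2 * q - 1) * V $$ (i, b) * V $$ (l, b) * \<Omega> $$ (l, j) * e $ i)"
        by (rule sum.swap)
      also have "\<dots> = (\<Sum>b<n. (\<Sum>i<n. V $$ (i, b) * \<Omega> $$ (i, j)) * (sqrt (\<mu> b) ^ (2 * q - 1) * c b))"
      proof (intro sum.cong refl)
        fix b
        show "(\<Sum>i<n. \<Sum>l<n. sqrt (\<mu> b) ^ (2 * q - 1) * V $$ (i, b) * V $$ (l, b) * \<Omega> $$ (l, j) * e $ i)
            = (\<Sum>i<n. V $$ (i, b) * \<Omega> $$ (i, j)) * (sqrt (\<mu> b) ^ (2 * q - 1) * c b)"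
          unfolding c_def sum_distrib_left sum_distrib_right sum_product by (simp add: mult_ac)
      qed
      finally show ?thesis by simp
    qed
    from kernel[of c, OF this] have "?ip e (A *\<^sub>v e) \<le> \<tau> * ?ip e e"
      unfolding A spec_quadratic_form[OF V ce] norm_coords[OF V ce, symmetric] c_def .
    also have "?ip e (A *\<^sub>v e) = ?ip (R *\<^sub>v e) (R *\<^sub>v e)"
      using symmetric_mat_adjoint[OF sR ce cRe] unfolding RR[symmetric]
      by (simp add: assoc_mult_mat_vec[of _ n n _ n])
    finally have Re: "?ip (R *\<^sub>v e) (R *\<^sub>v e) \<le> \<tau> * ?ip e e" .
    \<comment> \<open>Moving \<open>R\<close> from \<open>x\<close> to \<open>e\<close> leaves
      \<open>|e|\<^sup>2 \<le> |R e| |x|\<close>, and \<open>|R e|\<^sup>2\<close> is the form of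
      \<open>A\<close> at \<open>e\<close>, which \<open>kernel\<close> bounds by
      \<open>\<tau> |e|\<^sup>2\<close>. After squaring, one factor \<open>|e|\<^sup>2\<close>
      cancels.\<close>
    have "?ip e e = ?ip (R *\<^sub>v e) x"
      unfolding ee unfolding a_def using symmetric_mat_adjoint[OF sR ce x] by simp
    then have "(?ip e e)\<^sup>2 \<le> ?ip (R *\<^sub>v e) (R *\<^sub>v e) * ?ip x x"
      using scalar_prod_Cauchy_Schwarz[OF cRe x] by simp
    also have "\<dots> \<le> \<tau> * ?ip e e * ?ip x x"
      by (rule mult_right_mono[OF Re scalar_prod_nonneg])
    finally have "?ip e e * ?ip e e \<le> ?ip e e * (\<tau> * ?ip x x)"
      by (simp add: power2_eq_square mult_ac)
    then have "?ip e e \<le> \<tau> * ?ip x x"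
      using scalar_prod_nonneg[of e] \<tau> scalar_prod_nonneg[of x]
      by (cases "?ip e e = 0") (auto simp: mult_le_cancel_left)
    then show "?ip x (A *\<^sub>v x) \<le> ?ip x (nystrom q A \<Omega> *\<^sub>v x) + \<tau> * ?ip x x"
      unfolding xA xH using ee' by linarith
  qed
  show "psd_mat n (nystrom q A \<Omega>)" using sH main(1) by (simp add: psd_mat_def)
  show "loewner_le n (nystrom q A \<Omega>) A"
    using sH main(2) by (intro loewner_leI) (simp_all add: A spec_symmetric[OF V])
  show "?ip x (A *\<^sub>v x) \<le> ?ip x (nystrom q A \<Omega> *\<^sub>v x) + \<tau> * ?ip x x" if "x \<in> carrier_vec n"
    by (rule main(3)[OF that])
qed

subsection \<open>Nets of the Euclidean ball and quadratic forms\<close>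

lemma sum_half_power_abs:
  "(\<Sum>z = - int L..int L. (1 / 2 :: real) ^ nat \<bar>z\<bar>) = 3 - 2 * (1 / 2) ^ L"
proof (induction L)
  case (Suc L)
  have "{- int (Suc L)..int (Suc L)} = insert (- int (Suc L)) (insert (int (Suc L)) {- int L..int L})"
    by auto
  then show ?case using Suc by (simp add: nat_add_distrib)
qed simp

lemma abs_le_square_int: "\<bar>k\<bar> \<le> (k\<^sup>2 :: int)"
proof (cases "k = 0")
  case False
  then have "\<bar>k\<bar> * 1 \<le> \<bar>k\<bar> * \<bar>k\<bar>" by (intro mult_left_mono) auto
  then show ?thesis by (simp add: power2_eq_square)
qed simp

text \<open>Every point of the ball has weight at least \<open>1\<close> under
  \<open>exp (R - |z|\<^sup>2)\<close>. Summed over a surrounding box this weight factorises over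
  the coordinates, and each coordinate factor is dominated by the two-sided geometric series with
  sum \<open>3\<close>.\<close>

lemma card_integer_points_ball:
  fixes J :: "'a set" and R :: nat
  assumes J: "finite J"
  defines "Z \<equiv> {z \<in> J \<rightarrow>\<^sub>E (UNIV :: int set). (\<Sum>j\<in>J. (z j)\<^sup>2) \<le> int R}"
  shows "finite Z" "real (card Z) \<le> exp (real R) * 3 ^ card J"
proof -
  define P where "P = J \<rightarrow>\<^sub>E {- int R..int R}"
  have fP: "finite P" using J by (simp add: P_def finite_PiE)
  have sub: "Z \<subseteq> P"
  proof
    fix z assume z: "z \<in> Z"
    have "z j \<in> {- int R..int R}" if "j \<in> J" for j
    proof -
      have "\<bar>z j\<bar> \<le> (z j)\<^sup>2" by (rule abs_le_square_int)
      also have "\<dots> \<le> (\<Sum>j\<in>J. (z j)\<^sup>2)"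
        using J that by (intro member_le_sum) auto
      also have "\<dots> \<le> int R" using z by (simp add: Z_def)
      finally show ?thesis by auto
    qed
    with z show "z \<in> P" by (auto simp: Z_def P_def PiE_def)
  qed
  show "finite Z" using sub fP finite_subset by blast
  have half: "exp (- (real_of_int k)\<^sup>2) \<le> (1 / 2) ^ nat \<bar>k\<bar>" for k :: int
  proof -
    have "exp (- (real_of_int k)\<^sup>2) \<le> exp (- real (nat \<bar>k\<bar>))"
    proof -
      have "real_of_int \<bar>k\<bar> \<le> real_of_int (k\<^sup>2)"
        unfolding of_int_le_iff by (rule abs_le_square_int)
      then show ?thesis by simp
    qed
    also have "\<dots> = exp (- 1) ^ nat \<bar>k\<bar>" by (simp add: exp_of_nat_mult[symmetric])
    also have "\<dots> \<le> (1 / 2) ^ nat \<bar>k\<bar>"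
    proof (rule power_mono)
      have "2 \<le> exp (1 :: real)" using exp_ge_add_one_self[of 1] by simp
      then show "exp (- 1) \<le> (1 / 2 :: real)" by (simp add: exp_minus field_simps)
    qed simp
    finally show ?thesis .
  qed
  have "real (card Z) = (\<Sum>z\<in>Z. 1)" by simp
  also have "\<dots> \<le> (\<Sum>z\<in>Z. exp (real R) * (\<Prod>j\<in>J. exp (- (real_of_int (z j))\<^sup>2)))"
  proof (rule sum_mono)
    fix z assume "z \<in> Z"
    then have "real_of_int (\<Sum>j\<in>J. (z j)\<^sup>2) \<le> real_of_int (int R)"
      unfolding Z_def of_int_le_iff by simp
    then have "1 \<le> exp (real R - (\<Sum>j\<in>J. (real_of_int (z j))\<^sup>2))" by simp
    also have "\<dots> = exp (real R) * (\<Prod>j\<in>J. exp (- (real_of_int (z j))\<^sup>2))"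
      by (simp only: diff_conv_add_uminus exp_add sum_negf[symmetric] exp_sum[OF J])
    finally show "1 \<le> exp (real R) * (\<Prod>j\<in>J. exp (- (real_of_int (z j))\<^sup>2))" .
  qed
  also have "\<dots> \<le> (\<Sum>z\<in>P. exp (real R) * (\<Prod>j\<in>J. exp (- (real_of_int (z j))\<^sup>2)))"
    using sub fP by (intro sum_mono2) (auto intro!: mult_nonneg_nonneg prod_nonneg)
  also have "\<dots> = exp (real R) * (\<Prod>j\<in>J. \<Sum>z = - int R..int R. exp (- (real_of_int z)\<^sup>2))"
    unfolding P_def by (subst prod_sum_PiE) (simp_all add: J sum_distrib_left)
  also have "\<dots> \<le> exp (real R) * (\<Prod>j\<in>J. 3)"
  proof (intro mult_left_mono prod_mono conjI)
    fix j
    have "(\<Sum>z = - int R..int R. exp (- (real_of_int z)\<^sup>2)) \<le> (\<Sum>z = - int R..int R. (1 / 2) ^ nat \<bar>z\<bar>)"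
      by (intro sum_mono half)
    also have "\<dots> \<le> 3" unfolding sum_half_power_abs by simp
    finally show "(\<Sum>z = - int R..int R. exp (- (real_of_int z)\<^sup>2)) \<le> 3" .
  qed (auto intro: sum_nonneg)
  finally show "real (card Z) \<le> exp (real R) * 3 ^ card J" by simp
qed

text \<open>The net consists of the points of \<open>\<int>\<^sup>J / (4 \<surd>d)\<close> in the ball, \<open>d\<close> being the dimension; a
  point of the ball is approximated by rounding its coordinates towards zero.\<close>

lemma ball_net:
  fixes J :: "'a set"
  assumes J: "finite J"
  obtains N :: "('a \<Rightarrow> real) set" where "finite N" "real (card N) \<le> exp (18 * real (card J))"
    "\<And>z. z \<in> N \<Longrightarrow> (\<Sum>j\<in>J. (z j)\<^sup>2) \<le> 1"
    "\<And>x. (\<Sum>j\<in>J. (x j)\<^sup>2) \<le> 1 \<Longrightarrow> \<exists>z\<in>N. (\<Sum>j\<in>J. (x j - z j)\<^sup>2) \<le> 1 / 16"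
proof -
  define d where "d = card J"
  \<comment> \<open>The spacing \<open>1 / \<rho>\<close> leaves a squared rounding error of at most
    \<open>d / \<rho>\<^sup>2 = 1 / 16\<close>. The scaled ball has squared radius
    \<open>\<rho>\<^sup>2 = 16 d\<close>, and the resulting count \<open>exp (16 d) * 3 ^ d\<close>
    stays below \<open>exp (18 d)\<close>.\<close>
  define \<rho> where "\<rho> = 4 * sqrt (real d)"
  have rho2: "\<rho>\<^sup>2 = 16 * real d" by (simp add: \<rho>_def power_mult_distrib)
  define Z where "Z = {z \<in> J \<rightarrow>\<^sub>E (UNIV :: int set). (\<Sum>j\<in>J. (z j)\<^sup>2) \<le> int (16 * d)}"
  note Z = card_integer_points_ball[OF J, of "16 * d", folded Z_def]
  define N where "N = (\<lambda>z j. real_of_int (z j) / \<rho>) ` Z"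
  have dpos: "0 < \<rho>" if "j \<in> J" for j
    using J that by (auto simp: \<rho>_def d_def card_gt_0_iff)
  show ?thesis
  proof
    show "finite N" using Z(1) by (simp add: N_def)
    have "real (card N) \<le> real (card Z)" using Z(1) by (simp add: N_def card_image_le)
    also have "\<dots> \<le> exp (real (16 * d)) * 3 ^ d" using Z(2) by (simp add: d_def)
    also have "\<dots> \<le> exp (real (16 * d)) * exp 2 ^ d"
      using exp_ge_add_one_self[of 2] by (intro mult_left_mono power_mono) auto
    also have "\<dots> = exp (18 * real (card J))"
      by (simp add: exp_of_nat_mult[symmetric] exp_add[symmetric] d_def)
    finally show "real (card N) \<le> exp (18 * real (card J))" .
  next
    fix z assume "z \<in> N"
    then obtain y where y: "y \<in> Z" and z: "z = (\<lambda>j. real_of_int (y j) / \<rho>)" by (auto simp: N_def)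
    have "real_of_int (\<Sum>j\<in>J. (y j)\<^sup>2) \<le> real_of_int (int (16 * d))"
      using y unfolding Z_def of_int_le_iff by simp
    then have "(\<Sum>j\<in>J. (real_of_int (y j))\<^sup>2) \<le> \<rho>\<^sup>2" by (simp add: rho2)
    then show "(\<Sum>j\<in>J. (z j)\<^sup>2) \<le> 1"
      by (cases "\<rho> = 0") (simp_all add: z power_divide sum_divide_distrib[symmetric] divide_le_eq)
  next
    fix x :: "'a \<Rightarrow> real" assume x: "(\<Sum>j\<in>J. (x j)\<^sup>2) \<le> 1"
    define y :: "'a \<Rightarrow> int" where
      "y = (\<lambda>j\<in>J. if 0 \<le> x j then \<lfloor>\<rho> * x j\<rfloor> else \<lceil>\<rho> * x j\<rceil>)"
    have ya: "(real_of_int (y j))\<^sup>2 \<le> (\<rho> * x j)\<^sup>2" "(\<rho> * x j - real_of_int (y j))\<^sup>2 \<le> 1"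
      if j: "j \<in> J" for j
    proof -
      have *: "\<bar>real_of_int (y j)\<bar> \<le> \<bar>\<rho> * x j\<bar> \<and> \<bar>\<rho> * x j - real_of_int (y j)\<bar> \<le> 1"
      proof (cases "0 \<le> x j")
        case True
        then have "0 \<le> \<rho> * x j" using dpos[OF j] by simp
        then have "0 \<le> \<lfloor>\<rho> * x j\<rfloor>" by simp
        then show ?thesis using True j \<open>0 \<le> \<rho> * x j\<close> unfolding y_def by simp linarith
      next
        case False
        then have "\<rho> * x j \<le> 0" using dpos[OF j] by (simp add: mult_le_0_iff)
        then have "\<lceil>\<rho> * x j\<rceil> \<le> 0" by simp
        then show ?thesis using False j \<open>\<rho> * x j \<le> 0\<close> unfolding y_def by simp linarith
      qed
      from * show "(real_of_int (y j))\<^sup>2 \<le> (\<rho> * x j)\<^sup>2" by (simp only: abs_le_square_iff)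
      from * show "(\<rho> * x j - real_of_int (y j))\<^sup>2 \<le> 1" by (simp add: abs_square_le_1)
    qed
    have "real_of_int (\<Sum>j\<in>J. (y j)\<^sup>2) \<le> (\<Sum>j\<in>J. (\<rho> * x j)\<^sup>2)"
      using ya(1) by (simp add: sum_mono)
    also have "\<dots> = \<rho>\<^sup>2 * (\<Sum>j\<in>J. (x j)\<^sup>2)" by (simp add: power_mult_distrib sum_distrib_left)
    also have "\<dots> \<le> \<rho>\<^sup>2" using x by (simp add: mult_left_le)
    also have "\<dots> = real_of_int (int (16 * d))" by (simp add: rho2)
    finally have "(\<Sum>j\<in>J. (y j)\<^sup>2) \<le> int (16 * d)" by (simp only: of_int_le_iff)
    then have "y \<in> Z" by (auto simp: Z_def y_def)
    moreover have "(\<Sum>j\<in>J. (x j - real_of_int (y j) / \<rho>)\<^sup>2) \<le> (\<Sum>j\<in>J. 1 / \<rho>\<^sup>2)"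
    proof (rule sum_mono)
      fix j assume j: "j \<in> J"
      have "(x j - real_of_int (y j) / \<rho>)\<^sup>2 = (\<rho> * x j - real_of_int (y j))\<^sup>2 / \<rho>\<^sup>2"
        using dpos[OF j] by (simp add: power_divide[symmetric] diff_divide_distrib)
      also have "\<dots> \<le> 1 / \<rho>\<^sup>2" using ya(2)[OF j] by (intro divide_right_mono) auto
      finally show "(x j - real_of_int (y j) / \<rho>)\<^sup>2 \<le> 1 / \<rho>\<^sup>2" .
    qed
    moreover have "(\<Sum>j\<in>J. 1 / \<rho>\<^sup>2) \<le> 1 / 16" by (simp add: rho2 d_def)
    ultimately show "\<exists>z\<in>N. (\<Sum>j\<in>J. (x j - z j)\<^sup>2) \<le> 1 / 16"
      unfolding N_def by (intro bexI[of _ "\<lambda>j. real_of_int (y j) / \<rho>"] imageI) (rule order.trans)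
  qed
qed

text \<open>A self-bounding argument: if \<open>K\<close> is the supremum of the form over the unit
  ball, then passing to a neighbour in the net changes the value by at most \<open>K / 2\<close>, so
  \<open>K \<le> \<beta> + K / 2\<close>. The absorption is legitimate because \<open>bdd\<close>
  makes \<open>K\<close> a genuine supremum.\<close>

lemma quadratic_form_le_net:
  fixes M :: "'a \<Rightarrow> 'a \<Rightarrow> real"
  assumes J: "finite J"
    and sym: "\<And>a b. a \<in> J \<Longrightarrow> b \<in> J \<Longrightarrow> M a b = M b a"
    and net: "\<And>x. (\<Sum>j\<in>J. (x j)\<^sup>2) \<le> 1 \<Longrightarrow> \<exists>z\<in>N. (\<Sum>j\<in>J. (x j - z j)\<^sup>2) \<le> 1 / 16"
    and ball: "\<And>z. z \<in> N \<Longrightarrow> (\<Sum>j\<in>J. (z j)\<^sup>2) \<le> 1"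
    and bound: "\<And>z. z \<in> N \<Longrightarrow> \<bar>\<Sum>a\<in>J. \<Sum>b\<in>J. M a b * z a * z b\<bar> \<le> \<beta>"
  shows "\<bar>\<Sum>a\<in>J. \<Sum>b\<in>J. M a b * x a * x b\<bar> \<le> 2 * \<beta> * (\<Sum>j\<in>J. (x j)\<^sup>2)"
proof -
  define B where "B u v = (\<Sum>a\<in>J. \<Sum>b\<in>J. M a b * u a * v b)" for u v
  define nn where "nn u = (\<Sum>j\<in>J. (u j)\<^sup>2)" for u :: "'a \<Rightarrow> real"
  define S where "S = (\<lambda>x. \<bar>B x x\<bar>) ` {x. nn x \<le> 1}"
  define K where "K = Sup S"
  have nn_nonneg: "0 \<le> nn u" for u by (simp add: nn_def sum_nonneg)
  have Bsym: "B u v = B v u" for u v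
    unfolding B_def by (subst sum.swap) (intro sum.cong refl, use sym in \<open>auto simp: mult_ac\<close>)
  have Badd: "B (\<lambda>i. u i + w i) v = B u v + B w v" for u v w
    unfolding B_def by (simp add: algebra_simps sum.distrib)
  have Bdiff: "B (\<lambda>i. u i - w i) v = B u v - B w v" for u v w
    unfolding B_def by (simp add: algebra_simps sum_subtractf)
  have Bscale: "B (\<lambda>i. c * u i) v = c * B u v" for c u v
    unfolding B_def by (simp add: algebra_simps sum_distrib_left)
  have Badd2: "B v (\<lambda>i. u i + w i) = B v u + B v w" for u v w
    by (simp add: Bsym[of v] Badd)
  have Bdiff2: "B v (\<lambda>i. u i - w i) = B v u - B v w" for u v w
    by (simp add: Bsym[of v] Bdiff)
  have Bscale2: "B v (\<lambda>i. c * u i) = c * B v u" for c u v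
    by (simp add: Bsym[of v] Bscale)
  have nn_scale: "nn (\<lambda>i. c * u i) = c\<^sup>2 * nn u" for c u
    by (simp add: nn_def power_mult_distrib sum_distrib_left)
  have par: "nn (\<lambda>i. u i + v i) + nn (\<lambda>i. u i - v i) = 2 * nn u + 2 * nn v" for u v
    unfolding nn_def
    by (simp add: power2_sum power2_diff sum.distrib sum_subtractf sum_distrib_left)
  have comp: "\<bar>x j\<bar> \<le> 1" if "nn x \<le> 1" "j \<in> J" for x j
  proof -
    have "(x j)\<^sup>2 \<le> nn x" unfolding nn_def using J that by (intro member_le_sum) auto
    then have "(x j)\<^sup>2 \<le> 1" using that(1) by linarith
    then show ?thesis by (simp add: abs_square_le_1)
  qed
  have bdd: "bdd_above S"
  proof (rule bdd_aboveI)
    fix s assume "s \<in> S"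
    then obtain x where x: "nn x \<le> 1" "s = \<bar>B x x\<bar>" by (auto simp: S_def)
    have "\<bar>B x x\<bar> \<le> (\<Sum>a\<in>J. \<Sum>b\<in>J. \<bar>M a b * x a * x b\<bar>)"
      unfolding B_def by (intro order.trans[OF sum_abs] sum_mono order_refl)
    also have "\<dots> \<le> (\<Sum>a\<in>J. \<Sum>b\<in>J. \<bar>M a b\<bar> * 1)"
      unfolding abs_mult mult.assoc
      by (intro sum_mono mult_left_mono mult_le_one) (use comp[OF x(1)] in auto)
    finally show "s \<le> (\<Sum>a\<in>J. \<Sum>b\<in>J. \<bar>M a b\<bar> * 1)" using x by simp
  qed
  have le1: "\<bar>B x x\<bar> \<le> K" if "nn x \<le> 1" for x
    unfolding K_def using bdd that by (intro cSup_upper) (auto simp: S_def)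
  have le: "\<bar>B x x\<bar> \<le> K * nn x" for x
  proof (cases "nn x = 0")
    case True
    then have "\<forall>j\<in>J. x j = 0" using J by (simp add: nn_def sum_nonneg_eq_0_iff)
    then show ?thesis using True by (simp add: B_def)
  next
    case False
    then have pos: "0 < nn x" using nn_nonneg[of x] by simp
    have "nn (\<lambda>i. (1 / sqrt (nn x)) * x i) \<le> 1"
      unfolding nn_scale using pos by (simp add: power_divide)
    then have "\<bar>B (\<lambda>i. (1 / sqrt (nn x)) * x i) (\<lambda>i. (1 / sqrt (nn x)) * x i)\<bar> \<le> K"
      by (rule le1)
    then have "\<bar>B x x / nn x\<bar> \<le> K"
      unfolding Bscale Bscale2 using pos by (simp add: real_sqrt_mult_self)
    then show ?thesis using pos by (simp add: field_simps)
  qed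
  have K0: "0 \<le> K" using le1[of "\<lambda>_. 0"] by (simp add: nn_def B_def)
  have pol: "\<bar>B u v\<bar> \<le> K * (nn u + nn v) / 2" for u v
  proof -
    have "4 * B u v = B (\<lambda>i. u i + v i) (\<lambda>i. u i + v i) - B (\<lambda>i. u i - v i) (\<lambda>i. u i - v i)"
      unfolding Badd Badd2 Bdiff Bdiff2 by (simp add: Bsym[of v u])
    then have "4 * \<bar>B u v\<bar> \<le> K * nn (\<lambda>i. u i + v i) + K * nn (\<lambda>i. u i - v i)"
      using le[of "\<lambda>i. u i + v i"] le[of "\<lambda>i. u i - v i"] by linarith
    also have "\<dots> = K * (2 * nn u + 2 * nn v)" by (simp only: par distrib_left[symmetric])
    finally show ?thesis by (simp add: algebra_simps)
  qed
  have half: "\<bar>B x x\<bar> \<le> \<beta> + K / 2" if x: "nn x \<le> 1" for x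
  proof -
    obtain z where z: "z \<in> N" "nn (\<lambda>i. x i - z i) \<le> 1 / 16" using net x by (auto simp: nn_def)
    have nz: "nn z \<le> 1" using ball z by (simp add: nn_def)
    \<comment> \<open>By symmetry the difference of the form at \<open>x\<close> and at
      \<open>z\<close> is the bilinear form at \<open>x + z\<close> and \<open>x - z\<close>. The
      factors \<open>1 / 2\<close> and \<open>4\<close> rescale these two vectors into the unit
      ball, where \<open>pol\<close> bounds the bilinear form by \<open>K\<close>.\<close>
    define u where "u = (\<lambda>i. (1 / 2) * (x i + z i))"
    define v where "v = (\<lambda>i. 4 * (x i - z i))"
    have "nn u \<le> 1" using par[of x z] nn_nonneg[of "\<lambda>i. x i - z i"] x nz
      unfolding u_def nn_scale by (simp add: power2_eq_square)
    moreover have "nn v \<le> 1" using z unfolding v_def nn_scale by simp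
    ultimately have "nn u + nn v \<le> 2" by simp
    then have "K * (nn u + nn v) \<le> K * 2" using K0 by (rule mult_left_mono)
    then have "\<bar>B u v\<bar> \<le> K" using pol[of u v] by linarith
    moreover have "2 * B u v = 4 * (B x x - B z z)"
      unfolding u_def v_def Bscale Bscale2 Badd Bdiff2 by (simp add: Bsym[of z x])
    moreover have "\<bar>B z z\<bar> \<le> \<beta>" using bound[OF z(1)] by (simp add: B_def)
    ultimately have "B x x = B u v / 2 + B z z" "\<bar>B u v\<bar> \<le> K" "\<bar>B z z\<bar> \<le> \<beta>"
      by (simp_all add: field_simps)
    then show ?thesis by (auto simp: abs_if split: if_splits)
  qed
  have "K \<le> \<beta> + K / 2" unfolding K_def
  proof (rule cSup_least)
    show "S \<noteq> {}" by (auto simp: S_def nn_def intro!: exI[of _ "\<lambda>_. 0"])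
    show "s \<le> \<beta> + Sup S / 2" if "s \<in> S" for s using that half by (auto simp: S_def K_def)
  qed
  then have "K \<le> 2 * \<beta>" by simp
  then have "K * nn x \<le> 2 * \<beta> * nn x" using nn_nonneg by (intro mult_right_mono) auto
  then show ?thesis using le[of x] by (simp add: B_def nn_def)
qed

subsection \<open>Gaussian quadratic forms\<close>

abbreviation gauss :: "'i set \<Rightarrow> ('i \<Rightarrow> real) measure" where
  "gauss I \<equiv> PiM I (\<lambda>_. std_normal_distribution)"

interpretation std_normal: prob_space std_normal_distribution
  by (rule prob_space_normal_density) simp

interpretation std_normal_product: product_prob_space "\<lambda>_. std_normal_distribution" I for I
  by standard

section \<open>Moment generating functions of Gaussian linear and quadratic forms\<close>

lemma nn_integral_exp_linear:
  "(\<integral>\<^sup>+ x. ennreal (exp (a * x)) \<partial>std_normal_distribution) = ennreal (exp (a\<^sup>2 / 2))"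
proof -
  have "(\<integral>\<^sup>+ x. ennreal (exp (a * x)) \<partial>std_normal_distribution)
      = (\<integral>\<^sup>+ x. ennreal (exp (a\<^sup>2 / 2)) * ennreal (normal_density a 1 x) \<partial>lborel)"
    by (subst nn_integral_density, simp, simp, intro nn_integral_cong)
      (simp add: ennreal_mult[symmetric] normal_density_def exp_add[symmetric] field_simps power2_eq_square)
  also have "\<dots> = ennreal (exp (a\<^sup>2 / 2)) * ennreal 1"
    by (subst nn_integral_cmult) (simp_all add: nn_integral_eq_integral normal_density_nonneg)
  finally show ?thesis by simp
qed

lemma nn_integral_exp_square:
  assumes "2 * s < 1"
  shows "(\<integral>\<^sup>+ x. ennreal (exp (s * x\<^sup>2)) \<partial>std_normal_distribution) = ennreal (1 / sqrt (1 - 2 * s))"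
proof -
  define \<sigma> where "\<sigma> = 1 / sqrt (1 - 2 * s)"
  have \<sigma>: "0 < \<sigma>" "\<sigma>\<^sup>2 = 1 / (1 - 2 * s)" using assms by (auto simp: \<sigma>_def power_divide)
  have "(\<integral>\<^sup>+ x. ennreal (exp (s * x\<^sup>2)) \<partial>std_normal_distribution)
      = (\<integral>\<^sup>+ x. ennreal \<sigma> * ennreal (normal_density 0 \<sigma> x) \<partial>lborel)"
  proof (subst nn_integral_density, simp, simp, intro nn_integral_cong)
    fix x :: real
    have "normal_density 0 1 x * exp (s * x\<^sup>2) = \<sigma> * normal_density 0 \<sigma> x"
      using \<sigma> assms
      by (simp add: normal_density_def exp_add[symmetric] real_sqrt_mult real_sqrt_divide \<sigma>_def field_simps)
    then show "ennreal (normal_density 0 1 x) * ennreal (exp (s * x\<^sup>2)) = ennreal \<sigma> * ennreal (normal_density 0 \<sigma> x)"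
      using \<sigma> by (simp add: ennreal_mult[symmetric])
  qed
  also have "\<dots> = ennreal \<sigma> * ennreal 1"
    using \<sigma> by (subst nn_integral_cmult) (simp_all add: nn_integral_eq_integral normal_density_nonneg)
  finally show ?thesis by (simp add: \<sigma>_def)
qed

lemma nn_integral_gauss_exp_linear:
  assumes "finite I"
  shows "(\<integral>\<^sup>+ x. ennreal (exp (\<Sum>i\<in>I. a i * x i)) \<partial>gauss I) = ennreal (exp (\<Sum>i\<in>I. (a i)\<^sup>2 / 2))"
proof -
  have "(\<integral>\<^sup>+ x. ennreal (exp (\<Sum>i\<in>I. a i * x i)) \<partial>gauss I)
      = (\<integral>\<^sup>+ x. (\<Prod>i\<in>I. ennreal (exp (a i * x i))) \<partial>gauss I)"
    using assms by (simp add: exp_sum prod_ennreal)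
  also have "\<dots> = (\<Prod>i\<in>I. \<integral>\<^sup>+ x. ennreal (exp (a i * x)) \<partial>std_normal_distribution)"
    using assms by (intro std_normal_product.product_nn_integral_prod) auto
  finally show ?thesis using assms by (simp add: nn_integral_exp_linear prod_ennreal exp_sum)
qed

lemma nn_integral_gauss_exp_square:
  assumes "finite I" "\<And>i. i \<in> I \<Longrightarrow> 2 * s i < 1"
  shows "(\<integral>\<^sup>+ x. ennreal (exp (\<Sum>i\<in>I. s i * (x i)\<^sup>2)) \<partial>gauss I)
    = ennreal (\<Prod>i\<in>I. 1 / sqrt (1 - 2 * s i))"
proof -
  have "(\<integral>\<^sup>+ x. ennreal (exp (\<Sum>i\<in>I. s i * (x i)\<^sup>2)) \<partial>gauss I)
      = (\<integral>\<^sup>+ x. (\<Prod>i\<in>I. ennreal (exp (s i * (x i)\<^sup>2))) \<partial>gauss I)"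
    using assms by (simp add: exp_sum prod_ennreal)
  also have "\<dots> = (\<Prod>i\<in>I. \<integral>\<^sup>+ x. ennreal (exp (s i * x\<^sup>2)) \<partial>std_normal_distribution)"
    using assms by (intro std_normal_product.product_nn_integral_prod) auto
  also have "\<dots> = (\<Prod>i\<in>I. ennreal (1 / sqrt (1 - 2 * s i)))"
    using assms by (intro prod.cong refl nn_integral_exp_square) auto
  finally show ?thesis using assms(2)
    by (subst (asm) prod_ennreal) (auto simp: less_imp_le)
qed

lemma sum_square_orthogonal:
  fixes v :: "'b \<Rightarrow> 'i \<Rightarrow> real"
  assumes "finite J" "\<And>b c. b \<in> J \<Longrightarrow> c \<in> J \<Longrightarrow> b \<noteq> c \<Longrightarrow> (\<Sum>i\<in>I. v b i * v c i) = 0"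
  shows "(\<Sum>i\<in>I. (\<Sum>b\<in>J. h b * v b i)\<^sup>2) = (\<Sum>b\<in>J. (h b)\<^sup>2 * (\<Sum>i\<in>I. (v b i)\<^sup>2))"
proof -
  have "(\<Sum>i\<in>I. (\<Sum>b\<in>J. h b * v b i)\<^sup>2) = (\<Sum>i\<in>I. \<Sum>b\<in>J. \<Sum>c\<in>J. h b * h c * (v b i * v c i))"
    by (simp add: power2_eq_square sum_product mult_ac)
  also have "\<dots> = (\<Sum>b\<in>J. \<Sum>c\<in>J. h b * h c * (\<Sum>i\<in>I. v b i * v c i))"
    by (subst sum.swap, intro sum.cong refl, subst sum.swap) (simp add: sum_distrib_left)
  also have "\<dots> = (\<Sum>b\<in>J. \<Sum>c\<in>J. if b = c then (h b)\<^sup>2 * (\<Sum>i\<in>I. (v b i)\<^sup>2) else 0)"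
    using assms(2) by (intro sum.cong refl) (auto simp: power2_eq_square)
  finally show ?thesis using assms(1) by simp
qed

lemma sum_half_square_scale:
  fixes w s :: real
  assumes "w\<^sup>2 = 2 * s"
  shows "(\<Sum>b\<in>K. (w * A b)\<^sup>2 / 2) = s * (\<Sum>b\<in>K. (A b)\<^sup>2)"
  using assms by (simp add: power_mult_distrib sum_distrib_left)

text \<open>Decoupling: with an independent Gaussian vector \<open>h\<close>, \<open>exp (a\<^sup>2 / 2)\<close> is the expectation of
  \<open>exp (a h)\<close>, so after exchanging the integrals only linear forms in \<open>x\<close> have to be integrated.
  This replaces the rotation invariance of the Gaussian law.\<close>

lemma gauss_mgf_pos:
  fixes v :: "'b \<Rightarrow> 'i \<Rightarrow> real"
  assumes I: "finite I" and J: "finite J"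
    and orth: "\<And>b c. b \<in> J \<Longrightarrow> c \<in> J \<Longrightarrow> b \<noteq> c \<Longrightarrow> (\<Sum>i\<in>I. v b i * v c i) = 0"
    and d: "\<And>b. b \<in> J \<Longrightarrow> d b = (\<Sum>i\<in>I. (v b i)\<^sup>2)"
    and s: "0 \<le> s" "\<And>b. b \<in> J \<Longrightarrow> 2 * (s * d b) < 1"
  shows "(\<integral>\<^sup>+ x. ennreal (exp (s * (\<Sum>b\<in>J. (\<Sum>i\<in>I. v b i * x i)\<^sup>2))) \<partial>gauss I)
    = ennreal (\<Prod>b\<in>J. 1 / sqrt (1 - 2 * (s * d b)))"
proof -
  define w where "w = sqrt (2 * s)"
  have w2: "w\<^sup>2 = 2 * s" using s by (simp add: w_def)
  interpret GI: prob_space "gauss I" by (intro prob_space_PiM std_normal.prob_space_axioms)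
  interpret GJ: prob_space "gauss J" by (intro prob_space_PiM std_normal.prob_space_axioms)
  interpret pair_sigma_finite "gauss I" "gauss J" by standard
  have meas: "(\<lambda>(x, h). ennreal (exp (\<Sum>b\<in>J. w * (\<Sum>i\<in>I. v b i * x i) * h b)))
      \<in> borel_measurable (gauss I \<Otimes>\<^sub>M gauss J)"
    using I J by measurable
  have "(\<integral>\<^sup>+ x. ennreal (exp (s * (\<Sum>b\<in>J. (\<Sum>i\<in>I. v b i * x i)\<^sup>2))) \<partial>gauss I)
      = (\<integral>\<^sup>+ x. \<integral>\<^sup>+ h. ennreal (exp (\<Sum>b\<in>J. w * (\<Sum>i\<in>I. v b i * x i) * h b)) \<partial>gauss J \<partial>gauss I)"
    unfolding nn_integral_gauss_exp_linear[OF J] sum_half_square_scale[OF w2] ..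
  also have "\<dots> = (\<integral>\<^sup>+ h. \<integral>\<^sup>+ x. ennreal (exp (\<Sum>b\<in>J. w * (\<Sum>i\<in>I. v b i * x i) * h b)) \<partial>gauss I \<partial>gauss J)"
    using Fubini'[OF meas] by simp
  also have "\<dots> = (\<integral>\<^sup>+ h. \<integral>\<^sup>+ x. ennreal (exp (\<Sum>i\<in>I. (w * (\<Sum>b\<in>J. h b * v b i)) * x i)) \<partial>gauss I \<partial>gauss J)"
  proof -
    have "(\<Sum>b\<in>J. w * (\<Sum>i\<in>I. v b i * x i) * h b) = (\<Sum>i\<in>I. (w * (\<Sum>b\<in>J. h b * v b i)) * x i)"
      for x :: "'i \<Rightarrow> real" and h
      by (simp add: sum_distrib_left sum_distrib_right, subst sum.swap) (simp add: mult_ac)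
    then show ?thesis by simp
  qed
  also have "\<dots> = (\<integral>\<^sup>+ h. ennreal (exp (\<Sum>b\<in>J. (s * d b) * (h b)\<^sup>2)) \<partial>gauss J)"
  proof -
    have "(\<Sum>i\<in>I. (w * (\<Sum>b\<in>J. h b * v b i))\<^sup>2 / 2) = (\<Sum>b\<in>J. (s * d b) * (h b)\<^sup>2)" for h
    proof -
      have "(\<Sum>i\<in>I. (w * (\<Sum>b\<in>J. h b * v b i))\<^sup>2 / 2) = s * (\<Sum>i\<in>I. (\<Sum>b\<in>J. h b * v b i)\<^sup>2)"
        by (rule sum_half_square_scale[OF w2])
      also have "\<dots> = s * (\<Sum>b\<in>J. (h b)\<^sup>2 * d b)"
        using sum_square_orthogonal[OF J orth, where h = h] d by simp
      finally show ?thesis by (simp add: sum_distrib_left mult_ac)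
    qed
    then show ?thesis unfolding nn_integral_gauss_exp_linear[OF I] by simp
  qed
  also have "\<dots> = ennreal (\<Prod>b\<in>J. 1 / sqrt (1 - 2 * (s * d b)))"
    by (rule nn_integral_gauss_exp_square[OF J s(2)])
  finally show ?thesis .
qed

lemma integral_gauss_iexp_linear:
  assumes "finite I"
  shows "(CLINT x|gauss I. iexp (\<Sum>i\<in>I. a i * x i)) = complex_of_real (exp (- (\<Sum>i\<in>I. (a i)\<^sup>2 / 2)))"
proof -
  have int: "integrable std_normal_distribution (\<lambda>x. iexp (c * x))" for c
    by (rule std_normal.integrable_const_bound[of _ 1]) auto
  have "(CLINT x|gauss I. iexp (\<Sum>i\<in>I. a i * x i)) = (CLINT x|gauss I. (\<Prod>i\<in>I. iexp (a i * x i)))"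
    using assms by (simp add: exp_sum[symmetric] sum_distrib_left)
  also have "\<dots> = (\<Prod>i\<in>I. CLINT x|std_normal_distribution. iexp (a i * x))"
    using assms int by (intro std_normal_product.product_integral_prod) auto
  also have "\<dots> = (\<Prod>i\<in>I. complex_of_real (exp (- (a i)\<^sup>2 / 2)))"
    using char_std_normal_distribution by (simp add: char_def fun_eq_iff)
  also have "\<dots> = complex_of_real (exp (- (\<Sum>i\<in>I. (a i)\<^sup>2 / 2)))"
    using assms by (simp add: sum_negf[symmetric] exp_sum)
  finally show ?thesis .
qed

text \<open>The decoupling of \<open>gauss_mgf_pos\<close> with a characteristic function:
  \<open>exp (- a\<^sup>2 / 2)\<close> is the expectation of \<open>exp (i a h)\<close>. The
  integrands are complex of modulus one, so Fubini is applied to Bochner integrals, and the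
  nonnegative integrals are recovered afterwards.\<close>

lemma gauss_mgf_neg:
  fixes v :: "'b \<Rightarrow> 'i \<Rightarrow> real"
  assumes I: "finite I" and J: "finite J"
    and orth: "\<And>b c. b \<in> J \<Longrightarrow> c \<in> J \<Longrightarrow> b \<noteq> c \<Longrightarrow> (\<Sum>i\<in>I. v b i * v c i) = 0"
    and d: "\<And>b. b \<in> J \<Longrightarrow> d b = (\<Sum>i\<in>I. (v b i)\<^sup>2)"
    and s: "0 \<le> s"
  shows "(\<integral>\<^sup>+ x. ennreal (exp (- s * (\<Sum>b\<in>J. (\<Sum>i\<in>I. v b i * x i)\<^sup>2))) \<partial>gauss I)
    = ennreal (\<Prod>b\<in>J. 1 / sqrt (1 + 2 * (s * d b)))"
proof -
  define w where "w = sqrt (2 * s)"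
  have w2: "w\<^sup>2 = 2 * s" using s by (simp add: w_def)
  have dn: "0 \<le> d b" if "b \<in> J" for b using d[OF that] by (simp add: sum_nonneg)
  interpret GI: prob_space "gauss I" by (intro prob_space_PiM std_normal.prob_space_axioms)
  interpret GJ: prob_space "gauss J" by (intro prob_space_PiM std_normal.prob_space_axioms)
  interpret P: pair_prob_space "gauss I" "gauss J" by standard
  define F :: "('i \<Rightarrow> real) \<Rightarrow> ('b \<Rightarrow> real) \<Rightarrow> complex" where
    "F = (\<lambda>x h. iexp (\<Sum>b\<in>J. w * (\<Sum>i\<in>I. v b i * x i) * h b))"
  have "(\<lambda>p. \<Sum>b\<in>J. w * (\<Sum>i\<in>I. v b i * fst p i) * snd p b) \<in> borel_measurable (gauss I \<Otimes>\<^sub>M gauss J)"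
    using I J by measurable
  then have "(\<lambda>p. F (fst p) (snd p)) \<in> borel_measurable (gauss I \<Otimes>\<^sub>M gauss J)"
    unfolding F_def by measurable
  then have int: "integrable (gauss I \<Otimes>\<^sub>M gauss J) (case_prod F)"
    by (intro P.integrable_const_bound[of _ 1]) (auto simp: F_def split_beta)
  let ?Q = "\<lambda>x :: 'i \<Rightarrow> real. \<Sum>b\<in>J. (\<Sum>i\<in>I. v b i * x i)\<^sup>2"
  have Fx: "(CLINT h|gauss J. F x h) = complex_of_real (exp (- s * ?Q x))" for x
    unfolding F_def integral_gauss_iexp_linear[OF J] sum_half_square_scale[OF w2] by simp
  have Fh: "(CLINT x|gauss I. F x h) = complex_of_real (exp (\<Sum>b\<in>J. (- (s * d b)) * (h b)\<^sup>2))" for h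
  proof -
    have 1: "(\<Sum>b\<in>J. w * (\<Sum>i\<in>I. v b i * x i) * h b) = (\<Sum>i\<in>I. (w * (\<Sum>b\<in>J. h b * v b i)) * x i)"
      for x :: "'i \<Rightarrow> real"
      by (simp add: sum_distrib_left sum_distrib_right, subst sum.swap) (simp add: mult_ac)
    have "(\<Sum>i\<in>I. (w * (\<Sum>b\<in>J. h b * v b i))\<^sup>2 / 2) = s * (\<Sum>i\<in>I. (\<Sum>b\<in>J. h b * v b i)\<^sup>2)"
      by (rule sum_half_square_scale[OF w2])
    also have "\<dots> = s * (\<Sum>b\<in>J. (h b)\<^sup>2 * d b)"
      using sum_square_orthogonal[OF J orth, where h = h] d by simp
    finally show ?thesis
      unfolding F_def 1 integral_gauss_iexp_linear[OF I]
      by (simp add: sum_distrib_left mult_ac sum_negf)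
  qed
  have "(CLINT x|gauss I. complex_of_real (exp (- s * ?Q x)))
      = (CLINT h|gauss J. complex_of_real (exp (\<Sum>b\<in>J. (- (s * d b)) * (h b)\<^sup>2)))"
    using P.Fubini_integral[OF int] unfolding Fx Fh by simp
  then have eq: "(\<integral>x. exp (- s * ?Q x) \<partial>gauss I) = (\<integral>h. exp (\<Sum>b\<in>J. (- (s * d b)) * (h b)\<^sup>2) \<partial>gauss J)"
    unfolding integral_complex_of_real of_real_eq_iff .
  have mQ: "(\<lambda>x. exp (- s * ?Q x)) \<in> borel_measurable (gauss I)" using I J by measurable
  have mh: "(\<lambda>h. exp (\<Sum>b\<in>J. (- (s * d b)) * (h b)\<^sup>2)) \<in> borel_measurable (gauss J)"
    using J by measurable
  have "(\<integral>\<^sup>+ x. ennreal (exp (- s * ?Q x)) \<partial>gauss I) = ennreal (\<integral>x. exp (- s * ?Q x) \<partial>gauss I)"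
    using mQ s by (intro nn_integral_eq_integral std_normal_product.integrable_const_bound[of _ 1])
      (auto intro!: mult_nonneg_nonneg sum_nonneg)
  also have "\<dots> = (\<integral>\<^sup>+ h. ennreal (exp (\<Sum>b\<in>J. (- (s * d b)) * (h b)\<^sup>2)) \<partial>gauss J)"
    unfolding eq using mh s dn
    by (intro nn_integral_eq_integral[symmetric] std_normal_product.integrable_const_bound[of _ 1])
      (auto intro!: sum_nonpos simp: mult_nonneg_nonneg)
  also have "\<dots> = ennreal (\<Prod>b\<in>J. 1 / sqrt (1 - 2 * (- (s * d b))))"
  proof (rule nn_integral_gauss_exp_square[OF J])
    show "2 * - (s * d b) < 1" if "b \<in> J" for b
      using mult_nonneg_nonneg[OF s dn[OF that]] by linarith
  qed
  finally show ?thesis by simp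
qed

section \<open>Chernoff bounds for sums of squares of Gaussian linear forms\<close>

lemma inverse_sqrt_le_exp_pos:
  assumes "0 \<le> x" "x \<le> (1 / 4 :: real)"
  shows "1 / sqrt (1 - 2 * x) \<le> exp (x + 4 * x\<^sup>2)"
proof -
  have "- (2 * x) - 2 * (2 * x)\<^sup>2 \<le> ln (1 - 2 * x)"
    using assms by (intro ln_one_minus_pos_lower_bound) auto
  then have "- ln (1 - 2 * x) / 2 \<le> x + 4 * x\<^sup>2" by (simp add: power2_eq_square)
  then have "exp (- ln (1 - 2 * x) / 2) \<le> exp (x + 4 * x\<^sup>2)" by simp
  moreover have "1 / sqrt (1 - 2 * x) = exp (- ln (1 - 2 * x) / 2)"
    using assms by (simp add: ln_sqrt[symmetric] exp_minus inverse_eq_divide)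
  ultimately show ?thesis by simp
qed

lemma inverse_sqrt_le_exp_neg:
  assumes "0 \<le> x" "x \<le> (1 / 4 :: real)"
  shows "1 / sqrt (1 + 2 * x) \<le> exp (- x + 4 * x\<^sup>2)"
proof -
  have "2 * x - (2 * x)\<^sup>2 \<le> ln (1 + 2 * x)"
    using assms by (intro ln_one_plus_pos_lower_bound) auto
  then have "- ln (1 + 2 * x) / 2 \<le> - x + 4 * x\<^sup>2"
    using zero_le_power2[of x] unfolding power_mult_distrib power2_eq_square by linarith
  then have "exp (- ln (1 + 2 * x) / 2) \<le> exp (- x + 4 * x\<^sup>2)" by simp
  moreover have "1 / sqrt (1 + 2 * x) = exp (- ln (1 + 2 * x) / 2)"
    using assms by (simp add: ln_sqrt[symmetric] exp_minus inverse_eq_divide)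
  ultimately show ?thesis by simp
qed

lemma gauss_exponential_markov:
  assumes [measurable]: "Q \<in> borel_measurable (gauss I)"
    and b: "(\<integral>\<^sup>+ x. ennreal (exp (Q x)) \<partial>gauss I) \<le> ennreal b" "0 \<le> b"
  shows "measure (gauss I) {x \<in> space (gauss I). u \<le> Q x} \<le> exp (- u) * b"
proof -
  let ?M = "gauss I"
  have "emeasure ?M {x \<in> space ?M. u \<le> Q x}
      \<le> emeasure ?M {x \<in> space ?M. 1 \<le> ennreal (exp (- u)) * ennreal (exp (Q x))}"
    by (rule emeasure_mono) (auto simp: ennreal_mult[symmetric] exp_add[symmetric])
  also have "\<dots> \<le> ennreal (exp (- u)) * (\<integral>\<^sup>+ x. ennreal (exp (Q x)) * indicator (space ?M) x \<partial>?M)"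
    by (rule nn_integral_Markov_inequality) measurable
  also have "(\<integral>\<^sup>+ x. ennreal (exp (Q x)) * indicator (space ?M) x \<partial>?M) = (\<integral>\<^sup>+ x. ennreal (exp (Q x)) \<partial>?M)"
    by (intro nn_integral_cong) (simp add: indicator_def)
  also have "ennreal (exp (- u)) * \<dots> \<le> ennreal (exp (- u)) * ennreal b"
    by (rule mult_left_mono[OF b(1)]) simp
  also have "\<dots> = ennreal (exp (- u) * b)" using b(2) by (simp add: ennreal_mult)
  finally show ?thesis using b(2) unfolding measure_def by (intro enn2real_leI) auto
qed

context
  fixes I :: "'i set" and J :: "'b set" and v :: "'b \<Rightarrow> 'i \<Rightarrow> real" and d :: "'b \<Rightarrow> real" and s :: real
  assumes I: "finite I" and J: "finite J"
    and orth: "\<And>b c. b \<in> J \<Longrightarrow> c \<in> J \<Longrightarrow> b \<noteq> c \<Longrightarrow> (\<Sum>i\<in>I. v b i * v c i) = 0"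
    and d: "\<And>b. b \<in> J \<Longrightarrow> d b = (\<Sum>i\<in>I. (v b i)\<^sup>2)"
    and s: "0 \<le> s" "\<And>b. b \<in> J \<Longrightarrow> s * d b \<le> 1 / 4"
begin

text \<open>The sign \<open>e\<close> covers both tails with one computation. The restriction
  \<open>s * d b \<le> 1 / 4\<close> keeps each factor of the moment generating function below
  \<open>exp (e * x + 4 * x\<^sup>2)\<close> with \<open>x = s * d b\<close>, and the linear part
  cancels against the mean.\<close>

lemma gauss_tail_aux:
  assumes e: "\<bar>e\<bar> = (1 :: real)"
    and mgf: "(\<integral>\<^sup>+ x. ennreal (exp (e * s * (\<Sum>b\<in>J. (\<Sum>i\<in>I. v b i * x i)\<^sup>2))) \<partial>gauss I)
      = ennreal (\<Prod>b\<in>J. 1 / sqrt (1 - 2 * (e * (s * d b))))"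
    and le: "\<And>x. 0 \<le> x \<Longrightarrow> x \<le> 1 / 4 \<Longrightarrow> 1 / sqrt (1 - 2 * (e * x)) \<le> exp (e * x + 4 * x\<^sup>2)"
  shows "measure (gauss I) {x \<in> space (gauss I). t \<le> e * ((\<Sum>b\<in>J. (\<Sum>i\<in>I. v b i * x i)\<^sup>2) - (\<Sum>b\<in>J. d b))}
    \<le> exp (- s * t + 4 * s\<^sup>2 * (\<Sum>b\<in>J. (d b)\<^sup>2))"
proof -
  define Q where "Q x = (\<Sum>b\<in>J. (\<Sum>i\<in>I. v b i * x i)\<^sup>2)" for x :: "'i \<Rightarrow> real"
  define D where "D = (\<Sum>b\<in>J. d b)"
  define B where "B = exp (e * s * D + 4 * s\<^sup>2 * (\<Sum>b\<in>J. (d b)\<^sup>2))"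
  have Qm [measurable]: "Q \<in> borel_measurable (gauss I)" unfolding Q_def[abs_def] using I J by measurable
  have dn: "0 \<le> s * d b" if "b \<in> J" for b using d[OF that] s by (simp add: sum_nonneg)
  have "(\<Prod>b\<in>J. 1 / sqrt (1 - 2 * (e * (s * d b)))) \<le> (\<Prod>b\<in>J. exp (e * (s * d b) + 4 * (s * d b)\<^sup>2))"
  proof (intro prod_mono conjI le dn s(2))
    fix b assume b: "b \<in> J"
    have "e \<le> 1" using e by linarith
    then have "e * (s * d b) \<le> 1 * (s * d b)" using dn[OF b] by (rule mult_right_mono)
    then show "0 \<le> 1 / sqrt (1 - 2 * (e * (s * d b)))" using s(2)[OF b] by simp
  qed
  also have "\<dots> = exp (\<Sum>b\<in>J. e * (s * d b) + 4 * (s * d b)\<^sup>2)" by (rule exp_sum[OF J, symmetric])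
  also have "(\<Sum>b\<in>J. e * (s * d b) + 4 * (s * d b)\<^sup>2) = e * s * D + 4 * s\<^sup>2 * (\<Sum>b\<in>J. (d b)\<^sup>2)"
    by (simp add: D_def sum.distrib sum_distrib_left power_mult_distrib mult.assoc)
  finally have mgf': "(\<integral>\<^sup>+ x. ennreal (exp (e * s * Q x)) \<partial>gauss I) \<le> ennreal B"
    unfolding mgf Q_def B_def by (rule ennreal_leI)
  have "measure (gauss I) {x \<in> space (gauss I). t \<le> e * (Q x - D)}
      \<le> measure (gauss I) {x \<in> space (gauss I). s * t + e * s * D \<le> e * s * Q x}"
  proof (rule std_normal_product.finite_measure_mono)
    show "{x \<in> space (gauss I). t \<le> e * (Q x - D)} \<subseteq> {x \<in> space (gauss I). s * t + e * s * D \<le> e * s * Q x}"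
    proof safe
      fix x assume "t \<le> e * (Q x - D)"
      then have "s * t \<le> s * (e * (Q x - D))" using s(1) by (rule mult_left_mono)
      also have "\<dots> = e * s * Q x - e * s * D" by (simp add: algebra_simps)
      finally show "s * t + e * s * D \<le> e * s * Q x" by linarith
    qed
  qed measurable
  also have "\<dots> \<le> exp (- (s * t + e * s * D)) * B"
    by (rule gauss_exponential_markov[OF _ mgf']) (simp_all add: B_def)
  also have "\<dots> = exp (- s * t + 4 * s\<^sup>2 * (\<Sum>b\<in>J. (d b)\<^sup>2))" by (simp add: B_def exp_add[symmetric])
  finally show ?thesis by (simp only: Q_def D_def)
qed

lemma gauss_upper_tail:
  "measure (gauss I) {x \<in> space (gauss I). (\<Sum>b\<in>J. d b) + t \<le> (\<Sum>b\<in>J. (\<Sum>i\<in>I. v b i * x i)\<^sup>2)}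
    \<le> exp (- s * t + 4 * s\<^sup>2 * (\<Sum>b\<in>J. (d b)\<^sup>2))"
proof -
  have "2 * (s * d b) < 1" if "b \<in> J" for b using s(2)[OF that] by linarith
  from gauss_mgf_pos[OF I J orth d s(1) this]
  show ?thesis
    using gauss_tail_aux[of 1 t] inverse_sqrt_le_exp_pos by (simp add: le_diff_eq add.commute)
qed

lemma gauss_lower_tail:
  "measure (gauss I) {x \<in> space (gauss I). (\<Sum>b\<in>J. (\<Sum>i\<in>I. v b i * x i)\<^sup>2) \<le> (\<Sum>b\<in>J. d b) - t}
    \<le> exp (- s * t + 4 * s\<^sup>2 * (\<Sum>b\<in>J. (d b)\<^sup>2))"
proof -
  have e: "t \<le> - 1 * (a - c) \<longleftrightarrow> a \<le> c - t" for a c :: real by auto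
  show ?thesis
    using gauss_tail_aux[of "- 1" t] gauss_mgf_neg[OF I J orth d s(1)] inverse_sqrt_le_exp_neg
    unfolding e by simp
qed

end

subsection \<open>Random events\<close>

lemma gauss_complement_bound:
  assumes N: "finite N" and B: "\<And>z. z \<in> N \<Longrightarrow> B z \<in> sets (gauss I)"
    and b: "\<And>z. z \<in> N \<Longrightarrow> measure (gauss I) (B z) \<le> b"
  shows "space (gauss I) - (\<Union>z\<in>N. B z) \<in> sets (gauss I)"
    "1 - real (card N) * b \<le> measure (gauss I) (space (gauss I) - (\<Union>z\<in>N. B z))"
proof -
  have U: "(\<Union>z\<in>N. B z) \<in> sets (gauss I)" using N B by (intro sets.finite_UN) auto
  then show "space (gauss I) - (\<Union>z\<in>N. B z) \<in> sets (gauss I)" by auto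
  have "measure (gauss I) (\<Union>z\<in>N. B z) \<le> (\<Sum>z\<in>N. measure (gauss I) (B z))"
    by (rule measure_UNION_le[OF N B])
  also have "\<dots> \<le> (\<Sum>z\<in>N. b)" by (rule sum_mono[OF b])
  finally show "1 - real (card N) * b \<le> measure (gauss I) (space (gauss I) - (\<Union>z\<in>N. B z))"
    using std_normal_product.prob_compl[OF U] by simp
qed

section \<open>Singular value bounds for a Gaussian matrix in eigencoordinates\<close>

context
  fixes n r :: nat and V :: "real mat"
  assumes V: "orthonormal_mat n V"
begin

text \<open>The entries of \<open>V\<^sup>T \<Omega>\<close>. They are kept as linear forms in the
  independent entries of \<open>\<Omega>\<close>, with orthogonality inherited from the columns of
  \<open>V\<close>, so that the tail bounds apply to them as they stand.\<close>

definition sketch :: "(nat \<times> nat \<Rightarrow> real) \<Rightarrow> nat \<Rightarrow> nat \<Rightarrow> real" where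
  "sketch \<omega> a j = (\<Sum>i<n. V $$ (i, a) * \<omega> (i, j))"

lemma sum_pairs: "(\<Sum>p\<in>{..<n} \<times> {..<r}. g (fst p) (snd p)) = (\<Sum>i<n. \<Sum>j<r. g i j)"
  by (simp add: sum.cartesian_product split_beta)

lemma orthonormal_combination:
  assumes "S \<subseteq> {..<n}"
  shows "(\<Sum>i<n. (\<Sum>a\<in>S. z a * V $$ (i, a))\<^sup>2) = (\<Sum>a\<in>S. (z a)\<^sup>2)"
proof -
  have S: "finite S" using assms finite_subset by blast
  have "(\<Sum>i<n. (\<Sum>a\<in>S. z a * V $$ (i, a))\<^sup>2) = (\<Sum>a\<in>S. (z a)\<^sup>2 * (\<Sum>i<n. (V $$ (i, a))\<^sup>2))"
    using assms by (intro sum_square_orthogonal S) (auto simp: orthonormal_cols[OF V] subset_eq)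
  also have "\<dots> = (\<Sum>a\<in>S. (z a)\<^sup>2)"
  proof (intro sum.cong refl)
    fix a assume "a \<in> S"
    then have "a < n" using assms by auto
    then show "(z a)\<^sup>2 * (\<Sum>i<n. (V $$ (i, a))\<^sup>2) = (z a)\<^sup>2"
      using orthonormal_cols[OF V, of a a] by (simp add: power2_eq_square)
  qed
  finally show ?thesis .
qed

lemma sketch_combination:
  "(\<Sum>i<n. (\<Sum>a\<in>S. z a * V $$ (i, a)) * \<omega> (i, j)) = (\<Sum>a\<in>S. z a * sketch \<omega> a j)"
  unfolding sketch_def sum_distrib_left sum_distrib_right
  by (subst sum.swap) (simp add: mult_ac)

text \<open>For fixed \<open>z\<close> the forms belonging to different columns \<open>j\<close>
  have disjoint supports and are therefore orthogonal; each has squared norm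
  \<open>|z|\<^sup>2\<close>, so the tail bounds apply with \<open>r\<close> equal weights.\<close>

lemma sketch_rows_tails:
  assumes S: "S \<subseteq> {..<n}" and z: "(\<Sum>a\<in>S. (z a)\<^sup>2) \<le> 1"
  defines "M \<equiv> gauss ({..<n} \<times> {..<r})"
  defines "Q \<equiv> \<lambda>\<omega>. \<Sum>j<r. (\<Sum>a\<in>S. z a * sketch \<omega> a j)\<^sup>2"
  shows "measure M {\<omega> \<in> space M. real r * (\<Sum>a\<in>S. (z a)\<^sup>2) + real r / 4 \<le> Q \<omega>} \<le> exp (- real r / 256)"
    and "measure M {\<omega> \<in> space M. Q \<omega> \<le> real r * (\<Sum>a\<in>S. (z a)\<^sup>2) - real r / 4} \<le> exp (- real r / 256)"
proof -
  define I where "I = {..<n} \<times> {..<r}"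
  define d where "d = (\<Sum>a\<in>S. (z a)\<^sup>2)"
  define w where "w i = (\<Sum>a\<in>S. z a * V $$ (i, a))" for i
  define v :: "nat \<Rightarrow> nat \<times> nat \<Rightarrow> real" where "v j p = (if snd p = j then w (fst p) else 0)" for j p
  have d: "0 \<le> d" "d \<le> 1" using z by (auto simp: d_def sum_nonneg)
  have I: "finite I" by (simp add: I_def)
  have orth: "(\<Sum>p\<in>I. v b p * v c p) = 0" if "b \<noteq> c" for b c
    using that by (intro sum.neutral) (auto simp: v_def)
  have norm: "d = (\<Sum>p\<in>I. (v j p)\<^sup>2)" if "j \<in> {..<r}" for j
  proof -
    have "(\<Sum>p\<in>I. (v j p)\<^sup>2) = (\<Sum>i<n. \<Sum>l<r. if l = j then (w i)\<^sup>2 else 0)"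
      unfolding I_def v_def by (subst sum_pairs[symmetric]) (intro sum.cong refl, auto)
    also have "\<dots> = d" using that orthonormal_combination[OF S] by (simp add: w_def d_def)
    finally show ?thesis ..
  qed
  have form: "(\<Sum>p\<in>I. v j p * \<omega> p) = (\<Sum>a\<in>S. z a * sketch \<omega> a j)" if "j \<in> {..<r}" for j \<omega>
  proof -
    have "(\<Sum>p\<in>I. v j p * \<omega> p) = (\<Sum>i<n. \<Sum>l<r. if l = j then w i * \<omega> (i, j) else 0)"
      unfolding I_def v_def by (subst sum_pairs[symmetric]) (intro sum.cong refl, auto)
    also have "\<dots> = (\<Sum>i<n. w i * \<omega> (i, j))" using that by simp
    finally show ?thesis by (simp add: w_def sketch_combination)
  qed
  have Q: "(\<Sum>j<r. (\<Sum>p\<in>I. v j p * \<omega> p)\<^sup>2) = Q \<omega>" for \<omega>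
    unfolding Q_def by (intro sum.cong refl) (simp add: form)
  \<comment> \<open>The parameter \<open>s = 1 / 32\<close> minimises
    \<open>- s r / 4 + 4 s\<^sup>2 r\<close>, and the minimum is \<open>- r / 256\<close>.\<close>
  have e: "- (1 / 32) * (real r / 4) + 4 * (1 / 32)\<^sup>2 * (\<Sum>j<r. d\<^sup>2) \<le> - real r / 256"
  proof -
    have "d\<^sup>2 \<le> 1" using d by (simp add: power_le_one)
    then have "real r * d\<^sup>2 \<le> real r" by (simp add: mult_left_le)
    then show ?thesis by (simp add: power2_eq_square)
  qed
  have s: "(1 / 32) * d \<le> 1 / 4" using d by simp
  have "measure (gauss I) {\<omega> \<in> space (gauss I). (\<Sum>j<r. d) + real r / 4 \<le> (\<Sum>j<r. (\<Sum>p\<in>I. v j p * \<omega> p)\<^sup>2)}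
      \<le> exp (- (1 / 32) * (real r / 4) + 4 * (1 / 32)\<^sup>2 * (\<Sum>j<r. d\<^sup>2))"
    by (rule gauss_upper_tail[OF I]) (use orth norm s in auto)
  also have "\<dots> \<le> exp (- real r / 256)" using e by (simp only: exp_le_cancel_iff)
  finally show "measure M {\<omega> \<in> space M. real r * (\<Sum>a\<in>S. (z a)\<^sup>2) + real r / 4 \<le> Q \<omega>} \<le> exp (- real r / 256)"
    unfolding M_def Q by (simp add: I_def d_def)
  have "measure (gauss I) {\<omega> \<in> space (gauss I). (\<Sum>j<r. (\<Sum>p\<in>I. v j p * \<omega> p)\<^sup>2) \<le> (\<Sum>j<r. d) - real r / 4}
      \<le> exp (- (1 / 32) * (real r / 4) + 4 * (1 / 32)\<^sup>2 * (\<Sum>j<r. d\<^sup>2))"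
    by (rule gauss_lower_tail[OF I]) (use orth norm s in auto)
  also have "\<dots> \<le> exp (- real r / 256)" using e by (simp only: exp_le_cancel_iff)
  finally show "measure M {\<omega> \<in> space M. Q \<omega> \<le> real r * (\<Sum>a\<in>S. (z a)\<^sup>2) - real r / 4} \<le> exp (- real r / 256)"
    unfolding M_def Q by (simp add: I_def d_def)
qed

lemma sketch_borel_measurable [measurable]:
  assumes "j < r"
  shows "(\<lambda>\<omega>. sketch \<omega> a j) \<in> borel_measurable (gauss ({..<n} \<times> {..<r}))"
  unfolding sketch_def
proof (intro borel_measurable_sum borel_measurable_times borel_measurable_const)
  fix i assume "i \<in> {..<n}"
  then have "(\<lambda>\<omega>. \<omega> (i, j)) \<in> measurable (gauss ({..<n} \<times> {..<r})) std_normal_distribution"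
    using assms by (intro measurable_component_singleton) auto
  then show "(\<lambda>\<omega>. \<omega> (i, j)) \<in> borel_measurable (gauss ({..<n} \<times> {..<r}))" by simp
qed

text \<open>A lower bound on the least singular value of the leading rows. The net has at most
  \<open>exp (r / 512)\<close> points, so the union bound uses up half of the exponent
  \<open>r / 256\<close>. At the points of the net the Gram matrix minus \<open>r\<close> times the
  identity has a form of size at most \<open>r / 4\<close>; the passage to all vectors doubles
  this.\<close>

lemma sketch_lower_bound_event:
  assumes S: "S \<subseteq> {..<n}" and small: "18 * real (card S) \<le> real r / 512"
  obtains E where "E \<in> sets (gauss ({..<n} \<times> {..<r}))"
    "1 - 2 * exp (- real r / 512) \<le> measure (gauss ({..<n} \<times> {..<r})) E"
    "\<And>\<omega> y. \<omega> \<in> E \<Longrightarrow> real r / 2 * (\<Sum>a\<in>S. (y a)\<^sup>2) \<le> (\<Sum>j<r. (\<Sum>a\<in>S. y a * sketch \<omega> a j)\<^sup>2)"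
proof -
  define M where "M = gauss ({..<n} \<times> {..<r})"
  have fS: "finite S" using S finite_subset by blast
  obtain N :: "(nat \<Rightarrow> real) set" where N: "finite N" "real (card N) \<le> exp (18 * real (card S))"
    "\<And>z. z \<in> N \<Longrightarrow> (\<Sum>j\<in>S. (z j)\<^sup>2) \<le> 1"
    "\<And>x. (\<Sum>j\<in>S. (x j)\<^sup>2) \<le> 1 \<Longrightarrow> \<exists>z\<in>N. (\<Sum>j\<in>S. (x j - z j)\<^sup>2) \<le> 1 / 16"
    using ball_net[OF fS] by blast
  define Q where "Q z \<omega> = (\<Sum>j<r. (\<Sum>a\<in>S. z a * sketch \<omega> a j)\<^sup>2)" for z \<omega>
  have Qm: "Q z \<in> borel_measurable M" for z
    unfolding Q_def[abs_def] M_def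
    by (intro borel_measurable_sum borel_measurable_power borel_measurable_times borel_measurable_const
        sketch_borel_measurable) auto
  define Up where "Up z = {\<omega> \<in> space M. real r * (\<Sum>a\<in>S. (z a)\<^sup>2) + real r / 4 \<le> Q z \<omega>}" for z
  define Lo where "Lo z = {\<omega> \<in> space M. Q z \<omega> \<le> real r * (\<Sum>a\<in>S. (z a)\<^sup>2) - real r / 4}" for z
  have sets: "Up z \<in> sets M" "Lo z \<in> sets M" for z
    using Qm[of z] unfolding Up_def Lo_def by measurable
  have bad: "measure M (Up z \<union> Lo z) \<le> 2 * exp (- real r / 256)" if "z \<in> N" for z
  proof -
    have "measure M (Up z \<union> Lo z) \<le> measure M (Up z) + measure M (Lo z)"
      by (rule measure_Un_le[OF sets])
    also have "\<dots> \<le> exp (- real r / 256) + exp (- real r / 256)"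
      unfolding Up_def Lo_def M_def Q_def
      by (intro add_mono sketch_rows_tails S N(3) that)
    finally show ?thesis by simp
  qed
  define E where "E = space M - (\<Union>z\<in>N. Up z \<union> Lo z)"
  have E: "E \<in> sets M" "1 - real (card N) * (2 * exp (- real r / 256)) \<le> measure M E"
    using gauss_complement_bound[OF N(1), of "\<lambda>z. Up z \<union> Lo z"] sets bad
    unfolding M_def E_def by (auto simp del: space_PiM)
  have card: "real (card N) * (2 * exp (- real r / 256)) \<le> 2 * exp (- real r / 512)"
  proof -
    have "real (card N) * (2 * exp (- real r / 256)) \<le> exp (real r / 512) * (2 * exp (- real r / 256))"
      using N(2) small by (intro mult_right_mono) (auto intro: order.trans)
    also have "\<dots> = 2 * exp (- real r / 512)" by (simp add: exp_add[symmetric])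
    finally show ?thesis .
  qed
  have bound: "real r / 2 * (\<Sum>a\<in>S. (y a)\<^sup>2) \<le> (\<Sum>j<r. (\<Sum>a\<in>S. y a * sketch \<omega> a j)\<^sup>2)"
    if \<omega>: "\<omega> \<in> E" for \<omega> y
  proof -
    define K where "K a b = (\<Sum>j<r. sketch \<omega> a j * sketch \<omega> b j) - (if a = b then real r else 0)" for a b
    have form: "(\<Sum>a\<in>S. \<Sum>b\<in>S. K a b * x a * x b) = Q x \<omega> - real r * (\<Sum>a\<in>S. (x a)\<^sup>2)" for x
    proof -
      have "Q x \<omega> = (\<Sum>j<r. \<Sum>a\<in>S. \<Sum>b\<in>S. sketch \<omega> a j * sketch \<omega> b j * x a * x b)"
        by (simp add: Q_def power2_eq_square sum_product mult_ac)
      also have "\<dots> = (\<Sum>a\<in>S. \<Sum>j<r. \<Sum>b\<in>S. sketch \<omega> a j * sketch \<omega> b j * x a * x b)"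
        by (rule sum.swap)
      also have "\<dots> = (\<Sum>a\<in>S. \<Sum>b\<in>S. \<Sum>j<r. sketch \<omega> a j * sketch \<omega> b j * x a * x b)"
        by (intro sum.cong refl sum.swap)
      finally have Qx: "Q x \<omega> = (\<Sum>a\<in>S. \<Sum>b\<in>S. (\<Sum>j<r. sketch \<omega> a j * sketch \<omega> b j) * x a * x b)"
        by (simp add: sum_distrib_right)
      have "(\<Sum>a\<in>S. \<Sum>b\<in>S. (if a = b then real r else 0) * x a * x b) = (\<Sum>a\<in>S. real r * x a * x a)"
      proof (intro sum.cong refl)
        fix a assume "a \<in> S"
        have "(\<Sum>b\<in>S. (if a = b then real r else 0) * x a * x b) = (\<Sum>b\<in>S. if a = b then real r * x a * x b else 0)"
          by (intro sum.cong refl) auto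
        then show "(\<Sum>b\<in>S. (if a = b then real r else 0) * x a * x b) = real r * x a * x a"
          using fS \<open>a \<in> S\<close> by simp
      qed
      then show ?thesis unfolding Qx K_def left_diff_distrib sum_subtractf
        by (simp add: sum_distrib_left power2_eq_square mult.assoc)
    qed
    have "\<bar>\<Sum>a\<in>S. \<Sum>b\<in>S. K a b * y a * y b\<bar> \<le> 2 * (real r / 4) * (\<Sum>a\<in>S. (y a)\<^sup>2)"
    proof (rule quadratic_form_le_net[OF fS _ N(4) N(3)])
      show "K a b = K b a" for a b by (simp add: K_def mult.commute)
      fix z assume "z \<in> N"
      then have "\<omega> \<notin> Up z" "\<omega> \<notin> Lo z" "\<omega> \<in> space M" using \<omega> by (auto simp: E_def)
      then have "Q z \<omega> < real r * (\<Sum>a\<in>S. (z a)\<^sup>2) + real r / 4"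
        "real r * (\<Sum>a\<in>S. (z a)\<^sup>2) - real r / 4 < Q z \<omega>"
        by (auto simp: Up_def Lo_def)
      then show "\<bar>\<Sum>a\<in>S. \<Sum>b\<in>S. K a b * z a * z b\<bar> \<le> real r / 4"
        unfolding form abs_le_iff by linarith
    qed auto
    then have "real r * (\<Sum>a\<in>S. (y a)\<^sup>2) - Q y \<omega> \<le> real r / 2 * (\<Sum>a\<in>S. (y a)\<^sup>2)"
      unfolding form by linarith
    then have "real r / 2 * (\<Sum>a\<in>S. (y a)\<^sup>2) \<le> Q y \<omega>" by (simp add: field_simps)
    then show ?thesis by (simp add: Q_def)
  qed
  show ?thesis
  proof (rule that[OF _ _ bound])
    show "E \<in> sets (gauss ({..<n} \<times> {..<r}))" using E(1) by (simp only: M_def)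
    show "1 - 2 * exp (- real r / 512) \<le> measure (gauss ({..<n} \<times> {..<r})) E"
      using E(2) card unfolding M_def by linarith
  qed
qed

text \<open>The counterpart of \<open>sketch_rows_tails\<close> in which the fixed direction
  \<open>u\<close> combines columns. The number of eigencoordinates is unbounded here and enters
  only through the sum of the weights \<open>w\<close>.\<close>

lemma sketch_columns_tail:
  fixes w :: "nat \<Rightarrow> real"
  assumes S: "S \<subseteq> {..<n}" and w: "\<And>a. a \<in> S \<Longrightarrow> 0 \<le> w a" "\<And>a. a \<in> S \<Longrightarrow> w a \<le> \<theta>" and \<theta>: "0 < \<theta>"
    and u: "(\<Sum>j<r. (u j)\<^sup>2) \<le> 1"
  defines "M \<equiv> gauss ({..<n} \<times> {..<r})"
  shows "measure M {\<omega> \<in> space M. 2 * (\<Sum>a\<in>S. w a) + 80 * real r * \<theta>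
      \<le> (\<Sum>a\<in>S. w a * (\<Sum>j<r. u j * sketch \<omega> a j)\<^sup>2)} \<le> exp (- 20 * real r)"
proof -
  define I where "I = {..<n} \<times> {..<r}"
  have I: "finite I" by (simp add: I_def)
  have fS: "finite S" using S finite_subset by blast
  define U where "U = (\<Sum>j<r. (u j)\<^sup>2)"
  have U: "0 \<le> U" "U \<le> 1" using u by (auto simp: U_def sum_nonneg)
  define v :: "nat \<Rightarrow> nat \<times> nat \<Rightarrow> real" where "v a p = sqrt (w a) * V $$ (fst p, a) * u (snd p)" for a p
  define d where "d a = w a * U" for a
  have inner: "(\<Sum>p\<in>I. v a p * v b p) = sqrt (w a) * sqrt (w b) * (if a = b then 1 else 0) * U"
    if "a \<in> S" "b \<in> S" for a b
  proof -
    have "(\<Sum>p\<in>I. v a p * v b p) = (\<Sum>i<n. \<Sum>j<r. sqrt (w a) * sqrt (w b) * (V $$ (i, a) * V $$ (i, b)) * (u j)\<^sup>2)"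
      unfolding I_def v_def sum_pairs[symmetric] by (intro sum.cong refl) (simp add: power2_eq_square mult_ac)
    also have "\<dots> = sqrt (w a) * sqrt (w b) * (\<Sum>i<n. V $$ (i, a) * V $$ (i, b)) * U"
      unfolding U_def sum_distrib_left sum_distrib_right by (rule sum.swap)
    finally show ?thesis using that S orthonormal_cols[OF V, of a b] by (auto simp: subset_eq)
  qed
  have orth: "(\<Sum>p\<in>I. v b p * v c p) = 0" if "b \<in> S" "c \<in> S" "b \<noteq> c" for b c
    using inner[OF that(1,2)] that(3) by simp
  have norm: "d a = (\<Sum>p\<in>I. (v a p)\<^sup>2)" if "a \<in> S" for a
    using inner[OF that that] w(1)[OF that] by (simp add: d_def power2_eq_square)
  have form: "(\<Sum>p\<in>I. v a p * \<omega> p)\<^sup>2 = w a * (\<Sum>j<r. u j * sketch \<omega> a j)\<^sup>2" if "a \<in> S" for a \<omega>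
  proof -
    have "(\<Sum>p\<in>I. v a p * \<omega> p) = (\<Sum>i<n. \<Sum>j<r. sqrt (w a) * (u j * (V $$ (i, a) * \<omega> (i, j))))"
      unfolding I_def v_def sum_pairs[symmetric] by (intro sum.cong refl) (simp add: mult_ac)
    also have "\<dots> = sqrt (w a) * (\<Sum>j<r. u j * sketch \<omega> a j)"
      unfolding sketch_def sum_distrib_left by (rule sum.swap)
    finally show ?thesis using w(1)[OF that] by (simp add: power_mult_distrib)
  qed
  \<comment> \<open>The largest parameter that is safe for all weights up to
    \<open>\<theta>\<close>. In \<open>t\<close>, the sum of the \<open>w a\<close> pays for the
    second-order term, and \<open>80 r \<theta>\<close> yields the exponent \<open>- 20 r\<close>,
    enough against the \<open>exp (18 r)\<close> points of a net in dimension
    \<open>r\<close>.\<close>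
  define s where "s = 1 / (4 * \<theta>)"
  define t where "t = (\<Sum>a\<in>S. w a) + 80 * real r * \<theta>"
  have s0: "0 \<le> s" using \<theta> by (simp add: s_def)
  have dw: "0 \<le> d a" "d a \<le> w a" if "a \<in> S" for a
    using w(1)[OF that] U by (auto simp: d_def mult_left_le)
  have sd: "s * d a \<le> 1 / 4" if "a \<in> S" for a
    using order.trans[OF dw(2)[OF that] w(2)[OF that]] \<theta> by (simp add: s_def field_simps)
  have "d a \<le> \<theta>" if "a \<in> S" for a using dw(2)[OF that] w(2)[OF that] by linarith
  then have "(\<Sum>a\<in>S. (d a)\<^sup>2) \<le> (\<Sum>a\<in>S. \<theta> * w a)"
    unfolding power2_eq_square using dw \<theta> by (intro sum_mono mult_mono) auto
  then have "4 * s\<^sup>2 * (\<Sum>a\<in>S. (d a)\<^sup>2) \<le> 4 * s\<^sup>2 * (\<theta> * (\<Sum>a\<in>S. w a))"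
    by (intro mult_left_mono) (auto simp: sum_distrib_left)
  also have "\<dots> = (\<Sum>a\<in>S. w a) / (4 * \<theta>)" using \<theta> by (simp add: s_def power2_eq_square field_simps)
  finally have "- s * t + 4 * s\<^sup>2 * (\<Sum>a\<in>S. (d a)\<^sup>2) \<le> - s * t + (\<Sum>a\<in>S. w a) / (4 * \<theta>)" by simp
  also have "\<dots> = - 20 * real r" using \<theta> by (simp add: s_def t_def field_simps)
  finally have e: "- s * t + 4 * s\<^sup>2 * (\<Sum>a\<in>S. (d a)\<^sup>2) \<le> - 20 * real r" .
  have Q: "(\<Sum>a\<in>S. (\<Sum>p\<in>I. v a p * \<omega> p)\<^sup>2) = (\<Sum>a\<in>S. w a * (\<Sum>j<r. u j * sketch \<omega> a j)\<^sup>2)" for \<omega>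
    by (intro sum.cong refl form)
  have "measure (gauss I) {\<omega> \<in> space (gauss I). 2 * (\<Sum>a\<in>S. w a) + 80 * real r * \<theta>
      \<le> (\<Sum>a\<in>S. (\<Sum>p\<in>I. v a p * \<omega> p)\<^sup>2)}
    \<le> measure (gauss I) {\<omega> \<in> space (gauss I). (\<Sum>a\<in>S. d a) + t \<le> (\<Sum>a\<in>S. (\<Sum>p\<in>I. v a p * \<omega> p)\<^sup>2)}"
  proof (rule std_normal_product.finite_measure_mono)
    have "(\<Sum>a\<in>S. d a) \<le> (\<Sum>a\<in>S. w a)" by (intro sum_mono dw(2))
    then show "{\<omega> \<in> space (gauss I). 2 * (\<Sum>a\<in>S. w a) + 80 * real r * \<theta> \<le> (\<Sum>a\<in>S. (\<Sum>p\<in>I. v a p * \<omega> p)\<^sup>2)}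
      \<subseteq> {\<omega> \<in> space (gauss I). (\<Sum>a\<in>S. d a) + t \<le> (\<Sum>a\<in>S. (\<Sum>p\<in>I. v a p * \<omega> p)\<^sup>2)}"
      by (auto simp: t_def simp del: space_PiM)
    have "(\<lambda>\<omega>. \<Sum>a\<in>S. (\<Sum>p\<in>I. v a p * \<omega> p)\<^sup>2) \<in> borel_measurable (gauss I)" using I fS by measurable
    then show "{\<omega> \<in> space (gauss I). (\<Sum>a\<in>S. d a) + t \<le> (\<Sum>a\<in>S. (\<Sum>p\<in>I. v a p * \<omega> p)\<^sup>2)} \<in> sets (gauss I)"
      by measurable
  qed
  also have "\<dots> \<le> exp (- s * t + 4 * s\<^sup>2 * (\<Sum>a\<in>S. (d a)\<^sup>2))"
    by (rule gauss_upper_tail[OF I fS orth norm s0 sd])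
  also have "\<dots> \<le> exp (- 20 * real r)" using e by (simp only: exp_le_cancel_iff)
  finally show ?thesis unfolding M_def Q by (simp only: I_def)
qed

text \<open>The net is taken in the space of the \<open>r\<close> columns, so its size does not
  depend on \<open>n\<close>. The passage from the net to all \<open>u\<close> doubles the threshold
  of \<open>sketch_columns_tail\<close>.\<close>

lemma sketch_upper_bound_event:
  fixes w :: "nat \<Rightarrow> real"
  assumes S: "S \<subseteq> {..<n}" and w: "\<And>a. a \<in> S \<Longrightarrow> 0 \<le> w a" "\<And>a. a \<in> S \<Longrightarrow> w a \<le> \<theta>" and \<theta>: "0 \<le> \<theta>"
  obtains E where "E \<in> sets (gauss ({..<n} \<times> {..<r}))"
    "1 - exp (- 2 * real r) \<le> measure (gauss ({..<n} \<times> {..<r})) E"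
    "\<And>\<omega> u. \<omega> \<in> E \<Longrightarrow> (\<Sum>a\<in>S. w a * (\<Sum>j<r. u j * sketch \<omega> a j)\<^sup>2)
      \<le> (4 * (\<Sum>a\<in>S. w a) + 160 * real r * \<theta>) * (\<Sum>j<r. (u j)\<^sup>2)"
proof (cases "\<theta> = 0")
  \<comment> \<open>The Chernoff parameter \<open>1 / (4 \<theta>)\<close> needs a positive
    \<open>\<theta>\<close>; for \<open>\<theta> = 0\<close> all weights vanish and every outcome
    will do.\<close>
  case True
  have w0: "w a = 0" if "a \<in> S" for a using w[OF that] True by simp
  have "measure (gauss ({..<n} \<times> {..<r})) (space (gauss ({..<n} \<times> {..<r}))) = 1"
    by (intro prob_space.prob_space prob_space_PiM std_normal.prob_space_axioms)
  then show ?thesis using True w0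
    by (intro that[of "space (gauss ({..<n} \<times> {..<r}))"] sets.top) (simp_all del: space_PiM)
next
  case False
  with \<theta> have \<theta>: "0 < \<theta>" by simp
  define M where "M = gauss ({..<n} \<times> {..<r})"
  define W where "W = (\<Sum>a\<in>S. w a)"
  have W: "0 \<le> W" using w by (simp add: W_def sum_nonneg)
  obtain N :: "(nat \<Rightarrow> real) set" where N: "finite N" "real (card N) \<le> exp (18 * real (card {..<r}))"
    "\<And>z. z \<in> N \<Longrightarrow> (\<Sum>j<r. (z j)\<^sup>2) \<le> 1"
    "\<And>x. (\<Sum>j<r. (x j)\<^sup>2) \<le> 1 \<Longrightarrow> \<exists>z\<in>N. (\<Sum>j<r. (x j - z j)\<^sup>2) \<le> 1 / 16"
    using ball_net[of "{..<r}"] by blast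
  define Q where "Q z \<omega> = (\<Sum>a\<in>S. w a * (\<Sum>j<r. z j * sketch \<omega> a j)\<^sup>2)" for z \<omega>
  have Qm: "Q z \<in> borel_measurable M" for z
    unfolding Q_def[abs_def] M_def
    by (intro borel_measurable_sum borel_measurable_power borel_measurable_times borel_measurable_const
        sketch_borel_measurable) auto
  define Up where "Up z = {\<omega> \<in> space M. 2 * W + 80 * real r * \<theta> \<le> Q z \<omega>}" for z
  have sets: "Up z \<in> sets M" for z
    using Qm[of z] unfolding Up_def by measurable
  have bad: "measure M (Up z) \<le> exp (- 20 * real r)" if "z \<in> N" for z
    unfolding Up_def M_def Q_def W_def
    by (rule sketch_columns_tail[OF S w \<theta> N(3)[OF that]])
  define E where "E = space M - (\<Union>z\<in>N. Up z)"
  have E: "E \<in> sets M" "1 - real (card N) * exp (- 20 * real r) \<le> measure M E"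
    using gauss_complement_bound[OF N(1), of Up] sets bad
    unfolding M_def E_def by (auto simp del: space_PiM)
  have card: "real (card N) * exp (- 20 * real r) \<le> exp (- 2 * real r)"
  proof -
    have "real (card N) * exp (- 20 * real r) \<le> exp (18 * real r) * exp (- 20 * real r)"
      using N(2) by (intro mult_right_mono) auto
    also have "\<dots> = exp (- 2 * real r)" by (simp add: exp_add[symmetric])
    finally show ?thesis .
  qed
  have bound: "Q u \<omega> \<le> (4 * W + 160 * real r * \<theta>) * (\<Sum>j<r. (u j)\<^sup>2)" if \<omega>: "\<omega> \<in> E" for \<omega> u
  proof -
    define K where "K j l = (\<Sum>a\<in>S. w a * sketch \<omega> a j * sketch \<omega> a l)" for j l
    have form: "(\<Sum>j<r. \<Sum>l<r. K j l * x j * x l) = Q x \<omega>" for x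
    proof -
      have "Q x \<omega> = (\<Sum>a\<in>S. \<Sum>j<r. \<Sum>l<r. w a * sketch \<omega> a j * sketch \<omega> a l * x j * x l)"
        by (simp add: Q_def power2_eq_square sum_product sum_distrib_left mult_ac)
      also have "\<dots> = (\<Sum>j<r. \<Sum>a\<in>S. \<Sum>l<r. w a * sketch \<omega> a j * sketch \<omega> a l * x j * x l)"
        by (rule sum.swap)
      also have "\<dots> = (\<Sum>j<r. \<Sum>l<r. \<Sum>a\<in>S. w a * sketch \<omega> a j * sketch \<omega> a l * x j * x l)"
        by (intro sum.cong refl sum.swap)
      finally show ?thesis by (simp add: K_def sum_distrib_right)
    qed
    have "\<bar>\<Sum>j<r. \<Sum>l<r. K j l * u j * u l\<bar> \<le> 2 * (2 * W + 80 * real r * \<theta>) * (\<Sum>j<r. (u j)\<^sup>2)"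
    proof (rule quadratic_form_le_net[OF _ _ N(4) N(3)])
      show "K j l = K l j" for j l by (simp add: K_def mult_ac)
      fix z assume "z \<in> N"
      then have "\<omega> \<notin> Up z" "\<omega> \<in> space M" using \<omega> by (auto simp: E_def)
      moreover have "0 \<le> Q z \<omega>" unfolding Q_def using w by (intro sum_nonneg mult_nonneg_nonneg) auto
      ultimately show "\<bar>\<Sum>j<r. \<Sum>l<r. K j l * z j * z l\<bar> \<le> 2 * W + 80 * real r * \<theta>"
        unfolding form Up_def by simp
    qed auto
    moreover have "2 * (2 * W + 80 * real r * \<theta>) = 4 * W + 160 * real r * \<theta>" by simp
    ultimately show ?thesis unfolding form by (simp only: abs_le_iff)
  qed
  show ?thesis
  proof (rule that[OF _ _ bound[unfolded Q_def W_def]])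
    show "E \<in> sets (gauss ({..<n} \<times> {..<r}))" using E(1) by (simp only: M_def)
    show "1 - exp (- 2 * real r) \<le> measure (gauss ({..<n} \<times> {..<r})) E"
      using E(2) card unfolding M_def by linarith
  qed
qed

text \<open>On the kernel the contributions of \<open>S\<close> and of its complement cancel in
  every column, so their common size \<open>|u|\<close> can be estimated from below through the
  leading rows and from above through the others. The constants are \<open>8 = 2 * 4\<close> and
  \<open>321 = 2 * 160 + 1\<close>, the \<open>1\<close> coming from the coordinates outside
  \<open>S\<close> themselves.\<close>

lemma sketch_kernel_event:
  fixes \<sigma> :: "nat \<Rightarrow> real"
  assumes S: "S \<subseteq> {..<n}" and small: "18 * real (card S) \<le> real r / 512" and r: "0 < r"
    and \<theta>: "0 \<le> \<theta>" "\<And>a. a \<in> {..<n} - S \<Longrightarrow> (\<sigma> a)\<^sup>2 \<le> \<theta>"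
  obtains E where "E \<in> sets (gauss ({..<n} \<times> {..<r}))"
    "1 - 3 * exp (- real r / 512) \<le> measure (gauss ({..<n} \<times> {..<r})) E"
    "\<And>\<omega> c. \<omega> \<in> E \<Longrightarrow> (\<And>j. j < r \<Longrightarrow> (\<Sum>a<n. sketch \<omega> a j * (\<sigma> a * c a)) = 0) \<Longrightarrow>
      (\<Sum>a<n. (\<sigma> a * c a)\<^sup>2) \<le> (8 * (\<Sum>a\<in>{..<n} - S. (\<sigma> a)\<^sup>2) / real r + 321 * \<theta>) * (\<Sum>a<n. (c a)\<^sup>2)"
proof -
  define T where "T = {..<n} - S"
  define W where "W = (\<Sum>a\<in>T. (\<sigma> a)\<^sup>2)"
  define M where "M = gauss ({..<n} \<times> {..<r})"
  interpret prob_space M unfolding M_def by (intro prob_space_PiM std_normal.prob_space_axioms)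
  have T: "T \<subseteq> {..<n}" by (auto simp: T_def)
  have fS: "finite S" and fT: "finite T" using S T finite_subset by blast+
  have split: "(\<Sum>a<n. g a) = (\<Sum>a\<in>S. g a) + (\<Sum>a\<in>T. g a)" for g :: "nat \<Rightarrow> real"
    unfolding T_def using S by (simp add: sum.subset_diff[of S "{..<n}"])
  obtain E1 where E1: "E1 \<in> sets M" "1 - 2 * exp (- real r / 512) \<le> measure M E1"
    "\<And>\<omega> y. \<omega> \<in> E1 \<Longrightarrow> real r / 2 * (\<Sum>a\<in>S. (y a)\<^sup>2) \<le> (\<Sum>j<r. (\<Sum>a\<in>S. y a * sketch \<omega> a j)\<^sup>2)"
    using sketch_lower_bound_event[OF S small] unfolding M_def by blast
  obtain E2 where E2: "E2 \<in> sets M" "1 - exp (- 2 * real r) \<le> measure M E2"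
    "\<And>\<omega> u. \<omega> \<in> E2 \<Longrightarrow> (\<Sum>a\<in>T. (\<sigma> a)\<^sup>2 * (\<Sum>j<r. u j * sketch \<omega> a j)\<^sup>2)
      \<le> (4 * W + 160 * real r * \<theta>) * (\<Sum>j<r. (u j)\<^sup>2)"
    using sketch_upper_bound_event[OF T, of "\<lambda>a. (\<sigma> a)\<^sup>2" \<theta>] \<theta> unfolding M_def W_def T_def by auto
  show ?thesis
  proof
    show "E1 \<inter> E2 \<in> sets (gauss ({..<n} \<times> {..<r}))" using E1(1) E2(1) by (auto simp: M_def)
    have "measure M (space M - (E1 \<inter> E2)) \<le> measure M (space M - E1) + measure M (space M - E2)"
      unfolding Diff_Int using E1(1) E2(1) by (intro measure_Un_le) auto
    then have "1 - measure M (E1 \<inter> E2) \<le> (1 - measure M E1) + (1 - measure M E2)"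
      using E1(1) E2(1) by (simp add: prob_compl)
    moreover have "exp (- 2 * real r) \<le> exp (- real r / 512)" by simp
    ultimately have "1 - 3 * exp (- real r / 512) \<le> measure M (E1 \<inter> E2)" using E1(2) E2(2) by linarith
    then show "1 - 3 * exp (- real r / 512) \<le> measure (gauss ({..<n} \<times> {..<r})) (E1 \<inter> E2)" by (simp add: M_def)
  next
    fix \<omega> c
    assume \<omega>: "\<omega> \<in> E1 \<inter> E2" and ker: "\<And>j. j < r \<Longrightarrow> (\<Sum>a<n. sketch \<omega> a j * (\<sigma> a * c a)) = 0"
    define y where "y a = \<sigma> a * c a" for a
    define u where "u j = (\<Sum>a\<in>T. y a * sketch \<omega> a j)" for j
    define K where "K = 4 * W + 160 * real r * \<theta>"
    define C where "C = (\<Sum>a\<in>T. (c a)\<^sup>2)"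
    define uu where "uu = (\<Sum>j<r. (u j)\<^sup>2)"
    have K0: "0 \<le> K" using \<theta> by (auto simp: K_def W_def intro!: add_nonneg_nonneg sum_nonneg)
    have C0: "0 \<le> C" and uu0: "0 \<le> uu" by (auto simp: C_def uu_def sum_nonneg)
    have Su: "(\<Sum>a\<in>S. y a * sketch \<omega> a j) = - u j" if "j < r" for j
      using ker[OF that] by (simp add: split u_def y_def mult.commute)
    \<comment> \<open>\<open>E2\<close> bounds the weighted sketch, whereas \<open>u\<close> is its
      transpose applied to \<open>c\<close>. Pairing \<open>u\<close> with itself moves the sketch
      onto \<open>u\<close>; Cauchy-Schwarz gives
      \<open>|u|\<^sup>2 \<le> sqrt C sqrt K |u|\<close>, and after squaring one factor
      \<open>|u|\<^sup>2\<close> cancels.\<close>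
    have "uu = (\<Sum>j<r. \<Sum>a\<in>T. u j * (y a * sketch \<omega> a j))"
      by (simp add: uu_def power2_eq_square u_def sum_distrib_left)
    also have "\<dots> = (\<Sum>a\<in>T. c a * (\<sigma> a * (\<Sum>j<r. u j * sketch \<omega> a j)))"
      by (subst sum.swap) (simp add: y_def sum_distrib_left mult_ac)
    finally have "uu\<^sup>2 \<le> C * (\<Sum>a\<in>T. (\<sigma> a * (\<Sum>j<r. u j * sketch \<omega> a j))\<^sup>2)"
      unfolding C_def by (simp only: Cauchy_Schwarz_ineq_sum)
    also have "\<dots> \<le> C * (K * uu)"
      using E2(3)[of \<omega> u] \<omega> C0 unfolding K_def uu_def power_mult_distrib by (intro mult_left_mono) auto
    finally have "uu * uu \<le> uu * (C * K)" by (simp add: power2_eq_square mult_ac)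
    then have uuK: "uu \<le> K * C"
      using uu0 K0 C0 by (cases "uu = 0") (auto simp: mult_le_cancel_left mult.commute)
    have "real r / 2 * (\<Sum>a\<in>S. (y a)\<^sup>2) \<le> (\<Sum>j<r. (\<Sum>a\<in>S. y a * sketch \<omega> a j)\<^sup>2)"
      using E1(3) \<omega> by blast
    also have "\<dots> = uu" unfolding uu_def by (intro sum.cong refl) (simp add: Su)
    also note uuK
    finally have "(\<Sum>a\<in>S. (y a)\<^sup>2) \<le> 2 / real r * K * C"
      using r by (simp add: field_simps)
    also have "2 / real r * K = 8 * W / real r + 320 * \<theta>" using r by (simp add: K_def field_simps)
    finally have yS: "(\<Sum>a\<in>S. (y a)\<^sup>2) \<le> (8 * W / real r + 320 * \<theta>) * C" .
    have yT: "(\<Sum>a\<in>T. (y a)\<^sup>2) \<le> \<theta> * C"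
      unfolding C_def sum_distrib_left y_def power_mult_distrib
      using \<theta>(2) by (intro sum_mono mult_right_mono) (auto simp: T_def)
    have "(\<Sum>a<n. (y a)\<^sup>2) \<le> (8 * W / real r + 321 * \<theta>) * C"
      using yS yT unfolding split by (simp add: algebra_simps)
    also have "\<dots> \<le> (8 * W / real r + 321 * \<theta>) * (\<Sum>a<n. (c a)\<^sup>2)"
      using \<theta>(1) unfolding C_def split
      by (intro mult_left_mono) (auto simp: W_def intro!: add_nonneg_nonneg divide_nonneg_nonneg sum_nonneg)
    finally show "(\<Sum>a<n. (\<sigma> a * c a)\<^sup>2) \<le> (8 * (\<Sum>a\<in>{..<n} - S. (\<sigma> a)\<^sup>2) / real r + 321 * \<theta>) * (\<Sum>a<n. (c a)\<^sup>2)"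
      by (simp only: y_def W_def T_def)
  qed
qed

end

subsection \<open>The spectral threshold\<close>

lemma power_mean_weighted:
  fixes x w :: "'a \<Rightarrow> real"
  assumes I: "finite I" and x: "\<And>i. i \<in> I \<Longrightarrow> 0 \<le> x i" and w: "\<And>i. i \<in> I \<Longrightarrow> 0 \<le> w i"
    and 1: "(\<Sum>i\<in>I. w i) = 1"
  shows "(\<Sum>i\<in>I. w i * x i) ^ p \<le> (\<Sum>i\<in>I. w i * x i ^ p)"
proof -
  have "I \<noteq> {}" using 1 by auto
  have "convex_on {0::real..} (\<lambda>x. x ^ p)" by (cases "even p") (auto intro: convex_power_odd convex_on_subset[OF convex_power_even])
  from convex_on_sum[OF I \<open>I \<noteq> {}\<close> this 1 w, of x] show ?thesis using x by simp
qed

text \<open>The eigenvalues with \<open>f (\<mu> a) > 9216 T / r\<close> number less than \<open>r / 9216\<close>, so they are captured by the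
  sketch; the remaining ones are controlled by their maximum and their mean of order \<open>p\<close>. The constants
  are \<open>9216 = 18 * 512\<close>, from the net of the leading eigenspace, and \<open>329 = 8 + 321\<close>, from \<open>sketch_kernel_event\<close>.\<close>

definition nystrom_const :: real where "nystrom_const = 329 * 9216"

lemma spectral_threshold:
  fixes \<mu> :: "nat \<Rightarrow> real"
  assumes om: "operator_monotone f" and f0: "f 0 = 0" and \<mu>: "\<And>a. a < n \<Longrightarrow> 0 \<le> \<mu> a"
    and r: "0 < r" and p: "1 \<le> p"
  defines "T \<equiv> \<Sum>a<n. f (\<mu> a)" and "\<sigma> \<equiv> \<lambda>a. sqrt (\<mu> a) ^ p"
  obtains S \<theta> \<tau> where "S \<subseteq> {..<n}" "18 * real (card S) \<le> real r / 512" "0 \<le> \<theta>"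
    "\<And>a. a \<in> {..<n} - S \<Longrightarrow> (\<sigma> a)\<^sup>2 \<le> \<theta>" "0 \<le> \<tau>" "f \<tau> \<le> nystrom_const * T / real r"
    "\<And>c. (\<Sum>a<n. (\<sigma> a * c a)\<^sup>2)
        \<le> (8 * (\<Sum>a\<in>{..<n} - S. (\<sigma> a)\<^sup>2) / real r + 321 * \<theta>) * (\<Sum>a<n. (c a)\<^sup>2) \<Longrightarrow>
      (\<Sum>a<n. \<mu> a * (c a)\<^sup>2) \<le> \<tau> * (\<Sum>a<n. (c a)\<^sup>2)"
proof -
  have fnn: "0 \<le> f x" if "0 \<le> x" for x using operator_monotone_mono[OF om, of 0 x] f0 that by simp
  have T0: "0 \<le> T" unfolding T_def using \<mu> fnn by (intro sum_nonneg) auto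
  have \<sigma>2: "(\<sigma> a)\<^sup>2 = \<mu> a ^ p" if "a < n" for a
    using \<mu>[OF that] by (simp add: \<sigma>_def power_mult[symmetric] mult.commute[of p]) (simp add: power_mult)
  define S where "S = {a \<in> {..<n}. 9216 * T / real r < f (\<mu> a)}"
  define R where "R = {..<n} - S"
  have S: "S \<subseteq> {..<n}" by (auto simp: S_def)
  have fS: "finite S" and fR: "finite R" by (auto simp: S_def R_def)
  have fmuR: "f (\<mu> a) \<le> 9216 * T / real r" if "a \<in> R" for a using that by (auto simp: R_def S_def)
  have card: "18 * real (card S) \<le> real r / 512"
  proof (cases "T = 0")
    case True
    have "f (\<mu> a) \<le> T" if "a < n" for a
      unfolding T_def using that \<mu> fnn by (intro member_le_sum) auto
    then have "S = {}" using True by (fastforce simp: S_def)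
    then show ?thesis by simp
  next
    case False
    then have T: "0 < T" using T0 by simp
    have "real (card S) * (9216 * T / real r) = (\<Sum>a\<in>S. 9216 * T / real r)" by simp
    also have "\<dots> \<le> (\<Sum>a\<in>S. f (\<mu> a))" by (intro sum_mono) (auto simp: S_def)
    also have "\<dots> \<le> T" unfolding T_def using S \<mu> fnn by (intro sum_mono2) auto
    finally show ?thesis using T r by (simp add: field_simps)
  qed
  \<comment> \<open>Inserting \<open>0\<close> covers an empty \<open>R\<close>; the bound on
    \<open>f m\<close> survives because \<open>f 0 = 0\<close>.\<close>
  define m where "m = Max (insert 0 (\<mu> ` R))"
  have mR: "\<mu> a \<le> m" if "a \<in> R" for a
    unfolding m_def using fR that by (intro Max_ge) auto
  have m0: "0 \<le> m" unfolding m_def using fR by (intro Max_ge) auto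
  have "m \<in> insert 0 (\<mu> ` R)" unfolding m_def using fR by (intro Max_in) auto
  then have fm: "f m \<le> 9216 * T / real r" using fmuR f0 T0 by auto
  define W where "W = (\<Sum>a\<in>R. \<mu> a ^ p)"
  have W0: "0 \<le> W" unfolding W_def using \<mu> by (intro sum_nonneg) (auto simp: R_def)
  have W: "(\<Sum>a\<in>R. (\<sigma> a)\<^sup>2) = W" unfolding W_def by (intro sum.cong refl \<sigma>2) (auto simp: R_def)
  \<comment> \<open>The least level with \<open>m \<le> t\<close> and \<open>W \<le> r t^p\<close>,
    so that both terms of the kernel estimate become multiples of \<open>t^p\<close>.\<close>
  define t where "t = max m (root p (W / real r))"
  have t0: "0 \<le> t" using m0 by (simp add: t_def)
  have tp: "m ^ p \<le> t ^ p" using m0 by (intro power_mono) (auto simp: t_def)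
  have root: "root p (W / real r) ^ p = W / real r" using p W0 by (intro real_root_pow_pos2) auto
  have "root p (W / real r) ^ p \<le> t ^ p"
    using W0 by (intro power_mono real_root_ge_zero divide_nonneg_nonneg) (simp_all add: t_def)
  then have Wt: "W / real r \<le> t ^ p" by (simp only: root)
  have ft: "f t \<le> 9216 * T / real r"
  proof (cases "root p (W / real r) \<le> m")
    case True
    then show ?thesis using fm by (simp add: t_def)
  next
    case False
    then have t: "t = root p (W / real r)" and tm: "m < t" by (auto simp: t_def)
    have tpos: "0 < t" using tm m0 by linarith
    \<comment> \<open>Here the powers \<open>(\<mu> a / t) ^ p\<close> sum to exactly
      \<open>r\<close>. All quotients are at most \<open>1\<close>, so their first powers sum to at
      least \<open>r\<close>, and the decreasing ratio \<open>f x / x\<close> turns this into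
      \<open>r * f t \<le> T\<close>.\<close>
    have "real r = W / t ^ p" using root[folded t] tpos r by (auto simp: field_simps)
    also have "\<dots> = (\<Sum>a\<in>R. (\<mu> a / t) ^ p)" by (simp add: W_def power_divide sum_divide_distrib)
    also have "\<dots> \<le> (\<Sum>a\<in>R. \<mu> a / t)"
    proof (rule sum_mono)
      fix a assume a: "a \<in> R"
      then have "0 \<le> \<mu> a / t" "\<mu> a / t \<le> 1" using \<mu> mR[OF a] tm tpos by (auto simp: R_def)
      then show "(\<mu> a / t) ^ p \<le> \<mu> a / t"
        using power_decreasing[of 1 p "\<mu> a / t"] p by simp
    qed
    finally have "real r * f t \<le> (\<Sum>a\<in>R. \<mu> a / t) * f t"
      using fnn[OF t0] by (rule mult_right_mono)
    also have "\<dots> = (\<Sum>a\<in>R. \<mu> a * f t / t)" by (simp add: sum_distrib_right)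
    also have "\<dots> \<le> (\<Sum>a\<in>R. f (\<mu> a))"
    proof (rule sum_mono)
      fix a assume a: "a \<in> R"
      have "\<mu> a * f t \<le> t * f (\<mu> a)"
        using a \<mu> mR[OF a] tm by (intro operator_monotone_ratio[OF om f0]) (auto simp: R_def)
      then show "\<mu> a * f t / t \<le> f (\<mu> a)" using tpos by (simp add: field_simps)
    qed
    also have "\<dots> \<le> T" unfolding T_def using \<mu> fnn by (intro sum_mono2) (auto simp: R_def)
    finally have "f t \<le> T / real r" using r by (simp add: field_simps)
    also have "\<dots> \<le> 9216 * T / real r" using T0 r by (intro divide_right_mono) auto
    finally show ?thesis .
  qed
  define \<tau> where "\<tau> = 329 * t"
  have "f \<tau> \<le> 329 * f t" unfolding \<tau>_def by (rule operator_monotone_scale[OF om f0 t0]) simp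
  also have "\<dots> \<le> 329 * (9216 * T / real r)" using ft by (intro mult_left_mono) auto
  also have "\<dots> = nystrom_const * T / real r" by (simp add: nystrom_const_def)
  finally have f\<tau>: "f \<tau> \<le> nystrom_const * T / real r" .
  show ?thesis
  proof (rule that[OF S card, of "m ^ p" \<tau>])
    show "0 \<le> m ^ p" using m0 by simp
    show "(\<sigma> a)\<^sup>2 \<le> m ^ p" if "a \<in> {..<n} - S" for a
      using that \<mu> mR[of a] by (auto simp: \<sigma>2 R_def intro!: power_mono)
    show "0 \<le> \<tau>" using t0 by (simp add: \<tau>_def)
    show "f \<tau> \<le> nystrom_const * T / real r" by (rule f\<tau>)
    fix c :: "nat \<Rightarrow> real"
    define C where "C = (\<Sum>a<n. (c a)\<^sup>2)"
    assume "(\<Sum>a<n. (\<sigma> a * c a)\<^sup>2)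
        \<le> (8 * (\<Sum>a\<in>{..<n} - S. (\<sigma> a)\<^sup>2) / real r + 321 * m ^ p) * (\<Sum>a<n. (c a)\<^sup>2)"
    also have "(8 * (\<Sum>a\<in>{..<n} - S. (\<sigma> a)\<^sup>2) / real r + 321 * m ^ p) * (\<Sum>a<n. (c a)\<^sup>2) \<le> 329 * t ^ p * C"
      unfolding C_def[symmetric] R_def[symmetric] W
      using Wt tp by (intro mult_right_mono) (auto simp: C_def sum_nonneg)
    also have "(\<Sum>a<n. (\<sigma> a * c a)\<^sup>2) = (\<Sum>a<n. \<mu> a ^ p * (c a)\<^sup>2)"
      by (intro sum.cong refl) (simp add: power_mult_distrib \<sigma>2)
    finally have le: "(\<Sum>a<n. \<mu> a ^ p * (c a)\<^sup>2) \<le> 329 * t ^ p * C" .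
    show "(\<Sum>a<n. \<mu> a * (c a)\<^sup>2) \<le> \<tau> * (\<Sum>a<n. (c a)\<^sup>2)"
    proof (cases "C = 0")
      case True
      then have "\<forall>a<n. c a = 0" unfolding C_def by (subst (asm) sum_nonneg_eq_0_iff) auto
      then show ?thesis by simp
    next
      case False
      then have C: "0 < C" by (simp add: C_def less_le sum_nonneg)
      \<comment> \<open>Jensen with the weights \<open>(c a)\<^sup>2 / C\<close>, which sum to
        \<open>1\<close>. Enlarging \<open>329\<close> to \<open>329 ^ p\<close> afterwards lets the
        root be taken with a factor that does not depend on \<open>p\<close>.\<close>
      have "(\<Sum>a<n. (c a)\<^sup>2 / C * \<mu> a) ^ p \<le> (\<Sum>a<n. (c a)\<^sup>2 / C * \<mu> a ^ p)"
        using \<mu> C by (intro power_mean_weighted) (auto simp: sum_divide_distrib[symmetric] C_def[symmetric])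
      also have "\<dots> = (\<Sum>a<n. \<mu> a ^ p * (c a)\<^sup>2) / C" by (simp add: sum_divide_distrib mult.commute)
      also have "\<dots> \<le> 329 * t ^ p" using le C by (simp add: field_simps)
      also have "\<dots> \<le> 329 ^ p * t ^ p"
        using p t0 by (intro mult_right_mono self_le_power) auto
      also have "\<dots> = \<tau> ^ p" by (simp add: \<tau>_def power_mult_distrib)
      finally have pow: "(\<Sum>a<n. (c a)\<^sup>2 / C * \<mu> a) ^ p \<le> \<tau> ^ p" .
      obtain k where k: "p = Suc k" using p by (cases p) auto
      have "(\<Sum>a<n. (c a)\<^sup>2 / C * \<mu> a) \<le> \<tau>"
        by (rule power_le_imp_le_base[OF pow[unfolded k]]) (simp add: \<tau>_def t0)
      moreover have "(\<Sum>a<n. (c a)\<^sup>2 / C * \<mu> a) = (\<Sum>a<n. \<mu> a * (c a)\<^sup>2) / C"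
        by (simp add: sum_divide_distrib mult.commute)
      ultimately have "(\<Sum>a<n. \<mu> a * (c a)\<^sup>2) / C \<le> \<tau>" by simp
      then have "(\<Sum>a<n. \<mu> a * (c a)\<^sup>2) \<le> \<tau> * C" using C by (simp add: pos_divide_le_eq)
      then show ?thesis by (simp only: C_def)
    qed
  qed
qed

subsection \<open>Stochastic trace estimation\<close>

lemma trace_estimate_spec:
  assumes W: "orthonormal_mat n W"
  shows "trace_estimate (Matrix.mat n r \<phi>) (spec n W d)
    = (\<Sum>(a, j)\<in>{..<n} \<times> {..<r}. d a * (sketch n W \<phi> a j)\<^sup>2) / real r"
proof -
  define F where "F = Matrix.mat n r \<phi>"
  have F: "F \<in> carrier_mat n r" by (simp add: F_def)
  have D: "spec n W d \<in> carrier_mat n n" by (rule spec_carrier[OF W])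
  have DF: "spec n W d * F \<in> carrier_mat n r" by (rule mult_carrier_mat[OF D F])
  have TF: "transpose_mat F \<in> carrier_mat r n" using F by simp
  have entry: "(transpose_mat F * spec n W d * F) $$ (j, j) = (\<Sum>a<n. d a * (sketch n W \<phi> a j)\<^sup>2)"
    if j: "j < r" for j
  proof -
    have c: "col F j \<in> carrier_vec n" using F j by auto
    have "(transpose_mat F * spec n W d * F) $$ (j, j) = (transpose_mat F * (spec n W d * F)) $$ (j, j)"
      by (simp only: assoc_mult_mat[OF TF D F])
    also have "\<dots> = Matrix.scalar_prod (row (transpose_mat F) j) (col (spec n W d * F) j)"
      using j carrier_matD[OF TF] carrier_matD[OF DF] by (intro index_mult_mat(1)) auto
    also have "\<dots> = Matrix.scalar_prod (col F j) (spec n W d *\<^sub>v col F j)"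
      using j F col_mult2[OF D F j] by simp
    also have "\<dots> = (\<Sum>a<n. d a * (\<Sum>i<n. W $$ (i, a) * col F j $ i)\<^sup>2)"
      by (rule spec_quadratic_form[OF W c])
    also have "\<dots> = (\<Sum>a<n. d a * (sketch n W \<phi> a j)\<^sup>2)"
      unfolding sketch_def[OF W] using j by (intro sum.cong refl) (simp add: F_def)
    finally show ?thesis .
  qed
  have FDF: "transpose_mat F * spec n W d * F \<in> carrier_mat r r"
    by (rule mult_carrier_mat[OF mult_carrier_mat[OF TF D] F])
  have "mat_trace (transpose_mat F * spec n W d * F) = (\<Sum>j<r. \<Sum>a<n. d a * (sketch n W \<phi> a j)\<^sup>2)"
    unfolding mat_trace_def carrier_matD(1)[OF FDF] by (intro sum.cong refl entry) simp
  also have "\<dots> = (\<Sum>(a, j)\<in>{..<n} \<times> {..<r}. d a * (sketch n W \<phi> a j)\<^sup>2)"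
    by (subst sum.swap) (simp add: sum.cartesian_product)
  finally show ?thesis by (simp add: trace_estimate_def F_def)
qed

text \<open>The largest \<open>d a\<close> times their sum controls the sum of squares; repeated
  over the \<open>r\<close> samples it is at most \<open>K T\<^sup>2\<close>. The separate
  \<open>e \<le> 1\<close> reflects that the Chernoff parameter is capped by
  \<open>s * d a \<le> 1 / 4\<close>: for a large \<open>\<epsilon>\<close> the exponent is only
  that of a bounded deviation.\<close>

lemma trace_estimate_concentration:
  assumes W: "orthonormal_mat n W" and r: "0 < r" and T: "0 < T" and K: "0 < K"
    and d: "\<And>a. a < n \<Longrightarrow> 0 \<le> d a" "\<And>a. a < n \<Longrightarrow> d a \<le> K * T / real r" and sum: "(\<Sum>a<n. d a) \<le> T"
    and e: "0 < e" "e \<le> 1" "e \<le> \<epsilon>"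
  defines "M \<equiv> gauss ({..<n} \<times> {..<r})"
  shows "measure M {\<phi> \<in> space M. \<epsilon> * T < \<bar>trace_estimate (Matrix.mat n r \<phi>) (spec n W d) - (\<Sum>a<n. d a)\<bar>}
    \<le> 2 * exp (- ((real r * e)\<^sup>2 / (16 * K)))"
proof -
  define I where "I = {..<n} \<times> {..<r}"
  have I: "finite I" by (simp add: I_def)
  define v :: "nat \<times> nat \<Rightarrow> nat \<times> nat \<Rightarrow> real" where
    "v b p = (if snd p = snd b then sqrt (d (fst b)) * W $$ (fst p, fst b) else 0)" for b p
  define dd where "dd b = d (fst b)" for b :: "nat \<times> nat"
  have inner: "(\<Sum>p\<in>I. v b p * v c p) = (if b = c then d (fst b) else 0)" if b: "b \<in> I" and c: "c \<in> I" for b c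
  proof (cases "snd b = snd c")
    case False
    then show ?thesis by (auto simp: v_def intro!: sum.neutral)
  next
    case True
    have bc: "fst b < n" "fst c < n" "snd b < r" using b c by (auto simp: I_def)
    have "(\<Sum>p\<in>I. v b p * v c p) = (\<Sum>i<n. \<Sum>l<r. if l = snd b
        then sqrt (d (fst b)) * sqrt (d (fst c)) * (W $$ (i, fst b) * W $$ (i, fst c)) else 0)"
      unfolding I_def v_def sum_pairs[OF W, symmetric] using True by (intro sum.cong refl) (auto simp: mult_ac)
    also have "\<dots> = sqrt (d (fst b)) * sqrt (d (fst c)) * (\<Sum>i<n. W $$ (i, fst b) * W $$ (i, fst c))"
      using bc by (simp add: sum_distrib_left)
    finally show ?thesis using True orthonormal_cols[OF W bc(1,2)] d(1)[OF bc(1)] by (auto simp: prod_eq_iff)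
  qed
  have orth: "(\<Sum>p\<in>I. v b p * v c p) = 0" if "b \<in> I" "c \<in> I" "b \<noteq> c" for b c
    using inner[OF that(1,2)] that(3) by simp
  have norm: "dd b = (\<Sum>p\<in>I. (v b p)\<^sup>2)" if "b \<in> I" for b
    using inner[OF that that] by (simp add: dd_def power2_eq_square)
  define Q where "Q \<phi> = (\<Sum>b\<in>I. (\<Sum>p\<in>I. v b p * \<phi> p)\<^sup>2)" for \<phi>
  have form: "(\<Sum>p\<in>I. v b p * \<phi> p)\<^sup>2 = d (fst b) * (sketch n W \<phi> (fst b) (snd b))\<^sup>2" if b: "b \<in> I" for b \<phi>
  proof -
    have bb: "fst b < n" "snd b < r" using b by (auto simp: I_def)
    have "(\<Sum>p\<in>I. v b p * \<phi> p) = (\<Sum>i<n. \<Sum>l<r. if l = snd b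
        then sqrt (d (fst b)) * (W $$ (i, fst b) * \<phi> (i, snd b)) else 0)"
      unfolding I_def v_def sum_pairs[OF W, symmetric] by (intro sum.cong refl) (auto simp: mult_ac)
    also have "\<dots> = sqrt (d (fst b)) * sketch n W \<phi> (fst b) (snd b)"
      using bb by (simp add: sketch_def[OF W] sum_distrib_left)
    finally show ?thesis using d(1)[OF bb(1)] by (simp add: power_mult_distrib)
  qed
  have te: "trace_estimate (Matrix.mat n r \<phi>) (spec n W d) = Q \<phi> / real r" for \<phi>
    unfolding trace_estimate_spec[OF W] Q_def I_def[symmetric]
    by (intro arg_cong[where f = "\<lambda>x. x / real r"] sum.cong refl) (auto simp: form)
  have sumdd: "(\<Sum>b\<in>I. dd b) = real r * (\<Sum>a<n. d a)"
    unfolding I_def dd_def using sum_pairs[OF W, where g = "\<lambda>a j. d a"] by (simp add: sum_distrib_left)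
  have sumdd2: "(\<Sum>b\<in>I. (dd b)\<^sup>2) \<le> K * T\<^sup>2"
  proof -
    have "(\<Sum>b\<in>I. (dd b)\<^sup>2) = real r * (\<Sum>a<n. (d a)\<^sup>2)"
      unfolding I_def dd_def using sum_pairs[OF W, where g = "\<lambda>a j. (d a)\<^sup>2"] by (simp add: sum_distrib_left)
    also have "\<dots> \<le> real r * (\<Sum>a<n. K * T / real r * d a)"
      unfolding power2_eq_square using d by (intro mult_left_mono sum_mono mult_right_mono) auto
    also have "\<dots> = K * T * (\<Sum>a<n. d a)" using r by (simp add: sum_distrib_left)
    also have "\<dots> \<le> K * T * T" using K T sum by (intro mult_left_mono) auto
    finally show ?thesis by (simp add: power2_eq_square mult.assoc)
  qed
  \<comment> \<open>The minimiser of \<open>- s r e T + 4 s\<^sup>2 K T\<^sup>2\<close>. It is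
    admissible because it makes \<open>s * dd b\<close> at most \<open>e / 8\<close>.\<close>
  define s where "s = real r * e / (8 * K * T)"
  define t where "t = real r * (\<epsilon> * T)"
  have s0: "0 \<le> s" using r e K T by (simp add: s_def)
  have sd: "s * dd b \<le> 1 / 4" if b: "b \<in> I" for b
  proof -
    have "s * dd b \<le> s * (K * T / real r)"
      using b s0 d(2) by (intro mult_left_mono) (auto simp: dd_def I_def)
    also have "\<dots> = e / 8" using r K T by (simp add: s_def field_simps)
    finally show ?thesis using e by simp
  qed
  have e2: "- s * t + 4 * s\<^sup>2 * (\<Sum>b\<in>I. (dd b)\<^sup>2) \<le> - ((real r * e)\<^sup>2 / (16 * K))"
  proof -
    have "s * (real r * (e * T)) \<le> s * t"
      unfolding t_def using s0 e T by (intro mult_left_mono mult_right_mono) auto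
    moreover have "s * (real r * (e * T)) = (real r * e)\<^sup>2 / (8 * K)"
      using T K by (simp add: s_def power2_eq_square field_simps)
    moreover have "4 * s\<^sup>2 * (\<Sum>b\<in>I. (dd b)\<^sup>2) \<le> 4 * s\<^sup>2 * (K * T\<^sup>2)"
      using sumdd2 by (intro mult_left_mono) auto
    moreover have "4 * s\<^sup>2 * (K * T\<^sup>2) = (real r * e)\<^sup>2 / (16 * K)"
      using T K by (simp add: s_def power2_eq_square field_simps)
    moreover have "(real r * e)\<^sup>2 / (8 * K) = 2 * ((real r * e)\<^sup>2 / (16 * K))" by simp
    ultimately show ?thesis by linarith
  qed
  have Qm: "Q \<in> borel_measurable (gauss I)" unfolding Q_def[abs_def] using I by measurable
  define Up where "Up = {\<phi> \<in> space (gauss I). (\<Sum>b\<in>I. dd b) + t \<le> Q \<phi>}"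
  define Lo where "Lo = {\<phi> \<in> space (gauss I). Q \<phi> \<le> (\<Sum>b\<in>I. dd b) - t}"
  have sets: "Up \<in> sets (gauss I)" "Lo \<in> sets (gauss I)"
    using Qm unfolding Up_def Lo_def by measurable
  have "{\<phi> \<in> space (gauss I). \<epsilon> * T < \<bar>Q \<phi> / real r - (\<Sum>a<n. d a)\<bar>} \<subseteq> Up \<union> Lo"
  proof
    fix \<phi> assume "\<phi> \<in> {\<phi> \<in> space (gauss I). \<epsilon> * T < \<bar>Q \<phi> / real r - (\<Sum>a<n. d a)\<bar>}"
    then have sp: "\<phi> \<in> space (gauss I)" and lt: "\<epsilon> * T < \<bar>Q \<phi> / real r - (\<Sum>a<n. d a)\<bar>" by auto
    have "real r * (\<epsilon> * T) < real r * \<bar>Q \<phi> / real r - (\<Sum>a<n. d a)\<bar>"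
      using lt r by (intro mult_strict_left_mono) auto
    also have "\<dots> = \<bar>real r * (Q \<phi> / real r - (\<Sum>a<n. d a))\<bar>" by (simp add: abs_mult)
    also have "real r * (Q \<phi> / real r - (\<Sum>a<n. d a)) = Q \<phi> - real r * (\<Sum>a<n. d a)"
      using r by (simp add: right_diff_distrib)
    finally have "t < \<bar>Q \<phi> - (\<Sum>b\<in>I. dd b)\<bar>" by (simp only: sumdd t_def)
    then have "(\<Sum>b\<in>I. dd b) + t \<le> Q \<phi> \<or> Q \<phi> \<le> (\<Sum>b\<in>I. dd b) - t" by linarith
    then show "\<phi> \<in> Up \<union> Lo" using sp by (simp only: Up_def Lo_def Un_iff mem_Collect_eq) blast
  qed
  then have "measure (gauss I) {\<phi> \<in> space (gauss I). \<epsilon> * T < \<bar>Q \<phi> / real r - (\<Sum>a<n. d a)\<bar>}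
      \<le> measure (gauss I) (Up \<union> Lo)"
    using sets by (intro std_normal_product.finite_measure_mono) auto
  also have "\<dots> \<le> measure (gauss I) Up + measure (gauss I) Lo" by (rule measure_Un_le[OF sets])
  also have "\<dots> \<le> exp (- s * t + 4 * s\<^sup>2 * (\<Sum>b\<in>I. (dd b)\<^sup>2)) + exp (- s * t + 4 * s\<^sup>2 * (\<Sum>b\<in>I. (dd b)\<^sup>2))"
    unfolding Up_def Lo_def Q_def
    by (intro add_mono gauss_upper_tail[OF I I orth norm s0 sd] gauss_lower_tail[OF I I orth norm s0 sd])
  also have "\<dots> \<le> 2 * exp (- ((real r * e)\<^sup>2 / (16 * K)))" using e2 by simp
  finally show ?thesis unfolding M_def te I_def .
qed

subsection \<open>Measurability of the estimator\<close>

lemma symmetric_mat_congruence: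
  assumes S: "symmetric_mat n S" and F: "F \<in> carrier_mat n r"
  shows "symmetric_mat r (transpose_mat F * S * F)"
proof -
  have c: "S \<in> carrier_mat n n" "transpose_mat S = S" "transpose_mat F \<in> carrier_mat r n"
    using S F by (auto simp: symmetric_mat_def)
  note FS = mult_carrier_mat[OF c(3,1)]
  have "transpose_mat (transpose_mat F * S * F) = transpose_mat F * (S * F)"
    using transpose_mult[OF FS F] transpose_mult[OF c(3,1)] by (simp only: c(2) transpose_transpose)
  also have "\<dots> = transpose_mat F * S * F" by (rule assoc_mult_mat[symmetric, OF c(3,1) F])
  finally show ?thesis using mult_carrier_mat[OF FS F] by (simp add: symmetric_mat_def)
qed

lemma measurable_mat_nystrom:
  assumes A: "symmetric_mat n A" and F: "measurable_mat M n r F"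
  shows "measurable_mat M n n (\<lambda>x. nystrom q A (F x))"
proof -
  obtain V \<mu> where V: "orthonormal_mat n V" and A': "A = spec n V \<mu>" using symmetric_mat_spec[OF A] .
  have pow: "symmetric_mat n (A ^\<^sub>m k)" for k
    unfolding A' spec_power[OF V] by (rule spec_symmetric[OF V])
  then have cpow: "A ^\<^sub>m k \<in> carrier_mat n n" for k by (simp add: symmetric_mat_def)
  have AF: "measurable_mat M n r (\<lambda>x. A ^\<^sub>m q * F x)"
    by (rule measurable_mat_mult[OF measurable_mat_const[OF cpow] F])
  have "measurable_mat M r r (\<lambda>x. transpose_mat (F x) * A ^\<^sub>m (2 * q - 1) * F x)"
    by (rule measurable_mat_mult[OF measurable_mat_mult[OF measurable_mat_transpose[OF F]
            measurable_mat_const[OF cpow]] F])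
  then have "measurable_mat M r r (\<lambda>x. moore_penrose (transpose_mat (F x) * A ^\<^sub>m (2 * q - 1) * F x))"
    by (rule measurable_mat_moore_penrose) (rule symmetric_mat_congruence[OF pow measurable_mat_carrier[OF F]])
  then show ?thesis
    unfolding nystrom_def
    by (intro measurable_mat_mult[OF measurable_mat_mult[OF AF] measurable_mat_transpose[OF AF]])
qed

lemma psd_nystrom:
  assumes A: "psd_mat n A" and F: "F \<in> carrier_mat n r" and q: "1 \<le> q"
  shows "psd_mat n (nystrom q A F)"
proof -
  obtain V \<mu> where V: "orthonormal_mat n V" and A': "A = spec n V \<mu>"
    using symmetric_mat_spec[OF psd_symmetric[OF A]] .
  have \<mu>: "0 \<le> \<mu> a" if "a < n" for a using A that by (simp add: A' psd_spec_iff[OF V])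
  show ?thesis
  proof (rule nystrom_perturbation(1)[OF V A' \<mu> F q])
    \<comment> \<open>The trace of \<open>A\<close> dominates every eigenvalue, so as
      \<open>\<tau>\<close> it satisfies the kernel premise for every sketch; only positivity is
      wanted here, and for all outcomes.\<close>
    show "0 \<le> (\<Sum>a<n. \<mu> a)" using \<mu> by (intro sum_nonneg) auto
    show "(\<Sum>a<n. \<mu> a * (c a)\<^sup>2) \<le> (\<Sum>a<n. \<mu> a) * (\<Sum>a<n. (c a)\<^sup>2)" for c
      unfolding sum_distrib_left
      by (intro sum_mono mult_right_mono member_le_sum) (use \<mu> in auto)
  qed
qed

lemma fun_nystrom_pp_measurable:
  assumes om: "operator_monotone f" and A: "psd_mat n A" and q: "1 \<le> q"
  shows "(\<lambda>p. fun_nystrom_pp f q A (Matrix.mat n r (fst p)) (Matrix.mat n r (snd p)))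
    \<in> borel_measurable (gauss ({..<n} \<times> {..<r}) \<Otimes>\<^sub>M gauss ({..<n} \<times> {..<r}))"
    (is "_ \<in> borel_measurable (?M \<Otimes>\<^sub>M ?M)")
proof -
  let ?P = "?M \<Otimes>\<^sub>M ?M"
  have comp: "(\<lambda>\<omega>. \<omega> (i, j)) \<in> borel_measurable ?M" if "i < n" "j < r" for i j
  proof -
    have "(\<lambda>\<omega>. \<omega> (i, j)) \<in> measurable ?M std_normal_distribution"
      using that by (intro measurable_component_singleton) auto
    then show ?thesis by simp
  qed
  have F1: "measurable_mat ?P n r (\<lambda>p. Matrix.mat n r (fst p))"
  proof (rule measurable_matI)
    show "(\<lambda>p. Matrix.mat n r (fst p) $$ (i, j)) \<in> borel_measurable ?P" if "i < n" "j < r" for i j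
      using measurable_compose[OF measurable_fst comp[OF that]] that by simp
  qed simp
  have F2: "measurable_mat ?P n r (\<lambda>p. Matrix.mat n r (snd p))"
  proof (rule measurable_matI)
    show "(\<lambda>p. Matrix.mat n r (snd p) $$ (i, j)) \<in> borel_measurable ?P" if "i < n" "j < r" for i j
      using measurable_compose[OF measurable_snd comp[OF that]] that by simp
  qed simp
  \<comment> \<open>Monotone on the whole line and hence Borel, and equal to \<open>f\<close> on the
    spectrum of a positive semi-definite matrix.\<close>
  define h where "h x = f (max 0 x)" for x
  have "mono h" unfolding h_def by (intro monoI operator_monotone_mono[OF om]) auto
  then have h: "h \<in> borel_measurable borel" by (rule borel_measurable_mono)
  define H where "H p = nystrom q A (Matrix.mat n r (fst p))" for p :: "(nat \<times> nat \<Rightarrow> real) \<times> (nat \<times> nat \<Rightarrow> real)"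
  have psd: "psd_mat n (H p)" for p unfolding H_def by (rule psd_nystrom[OF A _ q, where r = r]) simp
  have "measurable_mat ?P n n H"
    unfolding H_def by (rule measurable_mat_nystrom[OF psd_symmetric[OF A] F1])
  then have "measurable_mat ?P n n (\<lambda>p. mat_fun h (H p))"
    using psd_symmetric[OF psd] h by (rule measurable_mat_fun)
  then have fH: "measurable_mat ?P n n (\<lambda>p. mat_fun f (H p))"
    by (rule measurable_mat_cong) (rule mat_fun_cong_psd[OF psd], simp add: h_def)
  have fA: "mat_fun f A \<in> carrier_mat n n" by (rule mat_fun_carrier[OF psd_symmetric[OF A]])
  have "measurable_mat ?P r r (\<lambda>p. transpose_mat (Matrix.mat n r (snd p)) * (mat_fun f A - mat_fun f (H p)) * Matrix.mat n r (snd p))"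
    by (rule measurable_mat_mult[OF measurable_mat_mult[OF measurable_mat_transpose[OF F2]
            measurable_mat_minus[OF measurable_mat_const[OF fA] fH]] F2])
  from measurable_mat_trace[OF this] measurable_mat_trace[OF fH]
  show ?thesis unfolding fun_nystrom_pp_def trace_estimate_def H_def by simp
qed

subsection \<open>The main theorem\<close>

text \<open>Slices over \<open>E\<close> contribute at most \<open>b\<close>, all others at most
  \<open>1\<close>. The independence of \<open>\<Omega>\<close> and \<open>\<Phi>\<close> enters in
  this form: for a frozen \<open>\<Omega>\<close> the eigenbasis of \<open>f A - f H\<close> is
  deterministic.\<close>

lemma (in pair_prob_space) measure_pair_le:
  assumes X: "X \<in> sets (M1 \<Otimes>\<^sub>M M2)" and E: "E \<in> sets M1" and b: "0 \<le> b"
    and slice: "\<And>x. x \<in> E \<Longrightarrow> measure M2 (Pair x -` X) \<le> b"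
  shows "measure (M1 \<Otimes>\<^sub>M M2) X \<le> b + (1 - measure M1 E)"
proof -
  have "emeasure (M1 \<Otimes>\<^sub>M M2) X = (\<integral>\<^sup>+ x. emeasure M2 (Pair x -` X) \<partial>M1)"
    by (rule M2.emeasure_pair_measure_alt[OF X])
  also have "\<dots> \<le> (\<integral>\<^sup>+ x. ennreal b + indicator (space M1 - E) x \<partial>M1)"
  proof (rule nn_integral_mono)
    fix x assume x: "x \<in> space M1"
    show "emeasure M2 (Pair x -` X) \<le> ennreal b + indicator (space M1 - E) x"
    proof (cases "x \<in> E")
      case True
      then show ?thesis using slice[OF True] by (simp add: M2.emeasure_eq_measure ennreal_leI)
    next
      case False
      have "emeasure M2 (Pair x -` X) \<le> 1" by (rule M2.emeasure_le_1)
      also have "1 \<le> ennreal b + indicator (space M1 - E) x" using False x by (simp add: add_increasing)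
      finally show ?thesis .
    qed
  qed
  also have "\<dots> = ennreal b + emeasure M1 (space M1 - E)"
    using E by (subst nn_integral_add) (auto simp: M1.emeasure_space_1)
  also have "\<dots> = ennreal (b + (1 - measure M1 E))"
    using E b by (simp add: M1.emeasure_eq_measure M1.prob_compl ennreal_plus)
  finally show ?thesis
    unfolding emeasure_eq_measure using b M1.prob_le_1[of E] by (subst (asm) ennreal_le_iff) auto
qed

text \<open>The failure probability is split evenly: \<open>\<delta> / 2\<close> for a bad
  \<open>\<Omega>\<close>, and \<open>\<delta> / 2\<close> for the samples given a good one.\<close>

lemma fun_nystrom_pp_error:
  assumes om: "operator_monotone f" and f0: "f 0 = 0" and A: "psd_mat n A" and q: "1 \<le> q"
    and r: "0 < r" and e: "0 < e" "e \<le> 1" "e \<le> \<epsilon>"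
    and \<delta>1: "3 * exp (- real r / 512) \<le> \<delta> / 2"
    and \<delta>2: "2 * exp (- ((real r * e)\<^sup>2 / (16 * nystrom_const))) \<le> \<delta> / 2"
  shows "\<P>((\<omega>, \<phi>) in gaussian_entries n r \<Otimes>\<^sub>M gaussian_entries n r.
      \<bar>fun_nystrom_pp f q A (Matrix.mat n r \<omega>) (Matrix.mat n r \<phi>) - mat_trace (mat_fun f A)\<bar>
        \<le> \<epsilon> * mat_trace (mat_fun f A)) \<ge> 1 - \<delta>"
proof -
  let ?M = "gauss ({..<n} \<times> {..<r})"
  let ?F = "\<lambda>\<omega> \<phi>. fun_nystrom_pp f q A (Matrix.mat n r \<omega>) (Matrix.mat n r \<phi>)"
  have gM: "gaussian_entries n r = ?M" by (simp add: gaussian_entries_def)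
  interpret G: prob_space ?M by (intro prob_space_PiM std_normal.prob_space_axioms)
  interpret P: pair_prob_space ?M ?M by standard
  obtain V \<mu> where V: "orthonormal_mat n V" and A': "A = spec n V \<mu>"
    using symmetric_mat_spec[OF psd_symmetric[OF A]] .
  have \<mu>: "0 \<le> \<mu> a" if "a < n" for a using A that by (simp add: A' psd_spec_iff[OF V])
  define T where "T = (\<Sum>a<n. f (\<mu> a))"
  have tr: "mat_trace (mat_fun f A) = T" by (simp add: A' mat_fun_spec[OF V] trace_spec[OF V] T_def)
  have T0: "0 \<le> T"
    unfolding T_def using \<mu> operator_monotone_mono[OF om, of 0] f0 by (intro sum_nonneg) auto
  have \<delta>0: "0 \<le> \<delta> / 2" by (rule order.trans[OF _ \<delta>1]) simp
  define p where "p = 2 * q - 1"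
  have p: "1 \<le> p" using q by (simp add: p_def)
  obtain S \<theta> \<tau> where S: "S \<subseteq> {..<n}" "18 * real (card S) \<le> real r / 512" "0 \<le> \<theta>"
    "\<And>a. a \<in> {..<n} - S \<Longrightarrow> (sqrt (\<mu> a) ^ p)\<^sup>2 \<le> \<theta>" "0 \<le> \<tau>" "f \<tau> \<le> nystrom_const * (\<Sum>a<n. f (\<mu> a)) / real r"
    "\<And>c. (\<Sum>a<n. (sqrt (\<mu> a) ^ p * c a)\<^sup>2)
        \<le> (8 * (\<Sum>a\<in>{..<n} - S. (sqrt (\<mu> a) ^ p)\<^sup>2) / real r + 321 * \<theta>) * (\<Sum>a<n. (c a)\<^sup>2) \<Longrightarrow>
      (\<Sum>a<n. \<mu> a * (c a)\<^sup>2) \<le> \<tau> * (\<Sum>a<n. (c a)\<^sup>2)"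
  proof (rule spectral_threshold[where \<mu> = \<mu> and n = n, OF om f0 \<mu> r p], goal_cases)
    case (2 S \<theta> \<tau>)
    show ?case by (rule that) (fact 2)+
  qed
  obtain E where E: "E \<in> sets ?M" "1 - 3 * exp (- real r / 512) \<le> measure ?M E"
    "\<And>\<omega> c. \<omega> \<in> E \<Longrightarrow> (\<And>j. j < r \<Longrightarrow> (\<Sum>a<n. sketch n V \<omega> a j * (sqrt (\<mu> a) ^ p * c a)) = 0) \<Longrightarrow>
      (\<Sum>a<n. (sqrt (\<mu> a) ^ p * c a)\<^sup>2)
        \<le> (8 * (\<Sum>a\<in>{..<n} - S. (sqrt (\<mu> a) ^ p)\<^sup>2) / real r + 321 * \<theta>) * (\<Sum>a<n. (c a)\<^sup>2)"
  proof (rule sketch_kernel_event[where \<sigma> = "\<lambda>a. sqrt (\<mu> a) ^ p", OF V S(1,2) r S(3,4)], goal_cases)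
    case (2 E)
    show ?case by (rule that) (fact 2)+
  qed
  have slice: "measure ?M {\<phi> \<in> space ?M. \<epsilon> * T < \<bar>?F \<omega> \<phi> - T\<bar>} \<le> \<delta> / 2" if \<omega>: "\<omega> \<in> E" for \<omega>
  proof -
    define H where "H = nystrom q A (Matrix.mat n r \<omega>)"
    have ker: "(\<Sum>a<n. \<mu> a * (c a)\<^sup>2) \<le> \<tau> * (\<Sum>a<n. (c a)\<^sup>2)"
      if "\<And>j. j < r \<Longrightarrow> (\<Sum>a<n. (\<Sum>i<n. V $$ (i, a) * Matrix.mat n r \<omega> $$ (i, j)) * (sqrt (\<mu> a) ^ (2 * q - 1) * c a)) = 0"
      for c
    proof (rule S(7)[OF E(3)[OF \<omega>]])
      fix j assume "j < r"
      then show "(\<Sum>a<n. sketch n V \<omega> a j * (sqrt (\<mu> a) ^ p * c a)) = 0"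
        using that[of j] by (simp add: sketch_def[OF V] p_def)
    qed
    note nys = nystrom_perturbation[OF V A' \<mu> _ q S(5) ker, of "Matrix.mat n r \<omega>" r, folded H_def]
    have H: "psd_mat n H" "loewner_le n H A" by (rule nys(1,2); simp)+
    have AH: "Matrix.scalar_prod x (A *\<^sub>v x)
        \<le> Matrix.scalar_prod x (H *\<^sub>v x) + \<tau> * Matrix.scalar_prod x x" if "x \<in> carrier_vec n" for x
      by (rule nys(3)[OF _ _ _ that]) simp_all
    obtain W d where W: "orthonormal_mat n W" and D: "mat_fun f A - mat_fun f H = spec n W d"
      and d: "\<And>a. a < n \<Longrightarrow> 0 \<le> d a" "\<And>a. a < n \<Longrightarrow> d a \<le> f \<tau>"
      and sd: "(\<Sum>a<n. d a) = mat_trace (mat_fun f A) - mat_trace (mat_fun f H)"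
      and H0: "0 \<le> mat_trace (mat_fun f H)"
    proof (rule mat_fun_perturbation[OF om f0 A H AH S(5)], goal_cases)
      case (2 W d)
      show ?case by (rule that) (fact 2)+
    qed
    \<comment> \<open>The trace of \<open>f H\<close> enters the estimator exactly, so it cancels,
      and only the sampling error on \<open>f A - f H\<close> remains.\<close>
    have err: "?F \<omega> \<phi> - T = trace_estimate (Matrix.mat n r \<phi>) (spec n W d) - (\<Sum>a<n. d a)" for \<phi>
      unfolding fun_nystrom_pp_def H_def[symmetric] D sd tr by simp
    have sumd: "(\<Sum>a<n. d a) \<le> T" using sd H0 tr by simp
    show ?thesis
    proof (cases "T = 0")
      \<comment> \<open>No deviation is allowed when \<open>T = 0\<close>; but then all
        \<open>d a\<close> vanish and the estimator is exact for every
        \<open>\<phi>\<close>.\<close>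
      case True
      have "(\<Sum>a<n. d a) = 0" using sumd True d(1) by (intro antisym sum_nonneg) auto
      then have "d a = 0" if "a < n" for a using d(1) that by (subst (asm) sum_nonneg_eq_0_iff) auto
      then have "?F \<omega> \<phi> - T = 0" for \<phi> unfolding err trace_estimate_spec[OF W] by (auto simp: split_beta intro!: sum.neutral)
      then show ?thesis using True \<delta>0 by simp
    next
      case False
      then have T: "0 < T" using T0 by simp
      have K: "0 < nystrom_const" by (simp add: nystrom_const_def)
      have "d a \<le> nystrom_const * T / real r" if "a < n" for a
        using d(2)[OF that] S(6) unfolding T_def[symmetric] by linarith
      from trace_estimate_concentration[OF W r T K d(1) this sumd e]
      show ?thesis unfolding err using \<delta>2 by linarith
    qed
  qed
  have meas: "(\<lambda>p. ?F (fst p) (snd p)) \<in> borel_measurable (?M \<Otimes>\<^sub>M ?M)"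
    by (rule fun_nystrom_pp_measurable[OF om A q])
  define X where "X = {p \<in> space (?M \<Otimes>\<^sub>M ?M). \<epsilon> * T < \<bar>?F (fst p) (snd p) - T\<bar>}"
  have X: "X \<in> sets (?M \<Otimes>\<^sub>M ?M)" using meas unfolding X_def by measurable
  have "measure (?M \<Otimes>\<^sub>M ?M) X \<le> \<delta> / 2 + (1 - measure ?M E)"
  proof (rule P.measure_pair_le[OF X E(1) \<delta>0])
    fix \<omega> assume \<omega>: "\<omega> \<in> E"
    then have "\<omega> \<in> space ?M" using sets.sets_into_space[OF E(1)] by blast
    then have "Pair \<omega> -` X = {\<phi> \<in> space ?M. \<epsilon> * T < \<bar>?F \<omega> \<phi> - T\<bar>}"
      by (auto simp: X_def space_pair_measure simp del: space_PiM)
    then show "measure ?M (Pair \<omega> -` X) \<le> \<delta> / 2" using slice[OF \<omega>] by simp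
  qed
  also have "\<dots> \<le> \<delta>" using E(2) \<delta>1 by linarith
  finally have "1 - \<delta> \<le> measure (?M \<Otimes>\<^sub>M ?M) (space (?M \<Otimes>\<^sub>M ?M) - X)"
    using P.prob_compl[OF X] by linarith
  also have "space (?M \<Otimes>\<^sub>M ?M) - X = {(\<omega>, \<phi>). (\<omega>, \<phi>) \<in> space (?M \<Otimes>\<^sub>M ?M) \<and> \<bar>?F \<omega> \<phi> - T\<bar> \<le> \<epsilon> * T}"
    by (auto simp: X_def split_beta not_less simp del: space_PiM)
  finally show ?thesis unfolding gM tr .
qed

theorem theorem5p1:
  shows "\<exists>c1 c2 :: real. 0 < c1 \<and> c1 \<le> c2 \<and>
    (\<forall>(n::nat) (A :: real mat) (f :: real \<Rightarrow> real) (\<epsilon>::real) (\<delta>::real).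
      f \<in> {0..} \<rightarrow> {0..} \<longrightarrow> operator_monotone f \<longrightarrow> f 0 = 0 \<longrightarrow>
      psd_mat n A \<longrightarrow> 0 < \<epsilon> \<longrightarrow> 0 < \<delta> \<longrightarrow> \<delta> \<le> 1 / 2 \<longrightarrow>
      (\<exists>r::nat.
        c1 * (sqrt (ln (1 / \<delta>)) / \<epsilon> + ln (1 / \<delta>)) \<le> real r \<and>
        real r \<le> c2 * (sqrt (ln (1 / \<delta>)) / \<epsilon> + ln (1 / \<delta>)) \<and>
        (\<forall>q\<ge>2.
          \<P>((\<omega>, \<phi>) in gaussian_entries n r \<Otimes>\<^sub>M gaussian_entries n r.
            \<bar>fun_nystrom_pp f q A (Matrix.mat n r \<omega>) (Matrix.mat n r \<phi>) - mat_trace (mat_fun f A)\<bar>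
              \<le> \<epsilon> * mat_trace (mat_fun f A)) \<ge> 1 - \<delta>)))"
proof (rule exI[of _ 20000], rule exI[of _ 20002], intro conjI allI impI)
  fix n :: nat and A :: "real mat" and f :: "real \<Rightarrow> real" and \<epsilon> \<delta> :: real
  assume om: "operator_monotone f" and f0: "f 0 = 0" and A: "psd_mat n A"
    and \<epsilon>: "0 < \<epsilon>" and \<delta>: "0 < \<delta>" "\<delta> \<le> 1 / 2"
  define L where "L = ln (1 / \<delta>)"
  define X where "X = sqrt L / \<epsilon> + L"
  \<comment> \<open>The factor \<open>20000\<close> is large enough for both \<open>d1\<close> and
    \<open>d2\<close>. Rounding up costs at most \<open>1\<close>, and \<open>1 \<le> 2 * X\<close>
    because \<open>X \<ge> L \<ge> 1 / 2\<close>, whence the upper constant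
    \<open>20002\<close>.\<close>
  define r where "r = nat \<lceil>20000 * X\<rceil>"
  have expL: "exp (- L) = \<delta>" using \<delta> by (simp add: L_def ln_div)
  have "2 \<le> 1 / \<delta>" using \<delta> by (simp add: field_simps)
  \<comment> \<open>This is where \<open>\<delta> \<le> 1 / 2\<close> enters: additive multiples of
    \<open>ln 2\<close> can be absorbed into multiples of \<open>L\<close>.\<close>
  then have "ln 2 \<le> L" unfolding L_def using \<delta> by (intro ln_mono) auto
  moreover have "1 / 2 \<le> ln (2 :: real)" using ln2_ge_two_thirds by linarith
  ultimately have L: "1 / 2 \<le> L" and ln2L: "ln 2 \<le> L" by linarith+
  have X: "sqrt L / \<epsilon> \<le> X" "L \<le> X" using L \<epsilon> by (auto simp: X_def)
  have rX: "20000 * X \<le> real r" "real r \<le> 20000 * X + 1" unfolding r_def using X L by linarith+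
  have r0: "0 < r" using rX X L by linarith
  define e where "e = min \<epsilon> 1"
  have e: "0 < e" "e \<le> 1" "e \<le> \<epsilon>" using \<epsilon> by (auto simp: e_def)
  have exp2: "exp (- (k * ln 2)) = 1 / 2 ^ k" for k :: nat
    by (simp add: exp_minus exp_of_nat_mult inverse_eq_divide)
  have d1: "3 * exp (- real r / 512) \<le> \<delta> / 2"
  proof -
    \<comment> \<open>The quotient \<open>r / 512\<close> is at least \<open>39 L\<close>, which
      covers \<open>L + 3 ln 2\<close>; the gained factor \<open>1 / 8\<close> suffices since
      \<open>3 / 8 \<le> 1 / 2\<close>.\<close>
    have "- real r / 512 \<le> - L + - (3 * ln 2)" using rX(1) X L ln2L by simp
    then have "exp (- real r / 512) \<le> exp (- L + - (3 * ln 2))" by (simp only: exp_le_cancel_iff)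
    also have "\<dots> = \<delta> * exp (- (3 * ln 2))" by (simp only: exp_add expL)
    also have "exp (- (3 * ln 2)) = (1 / 8 :: real)" using exp2[of 3] by simp
    finally show ?thesis using \<delta> by simp
  qed
  \<comment> \<open>For \<open>\<epsilon> > 1\<close> only the summand \<open>L\<close> of
    \<open>X\<close> helps: \<open>L \<ge> 1 / 2\<close> gives \<open>L \<ge> sqrt (L / 2)\<close>,
    and \<open>20000 / sqrt 2\<close> exceeds \<open>13000\<close>.\<close>
  have re: "13000 * sqrt L \<le> real r * e"
  proof (cases "\<epsilon> \<le> 1")
    case True
    have "20000 * (sqrt L / \<epsilon>) * \<epsilon> \<le> real r * \<epsilon>"
      using rX(1) X(1) \<epsilon> by (intro mult_right_mono) auto
    then have "20000 * sqrt L \<le> real r * \<epsilon>" using \<epsilon> by simp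
    moreover have "0 \<le> sqrt L" using L by simp
    ultimately have "13000 * sqrt L \<le> real r * \<epsilon>" by linarith
    then show ?thesis using True by (simp add: e_def min_absorb1)
  next
    case False
    have "(13000 * sqrt L)\<^sup>2 = 169000000 * L" using L by (simp add: power_mult_distrib)
    also have "\<dots> \<le> (20000 * L) * (20000 * L)"
    proof -
      have "1 / 2 * L \<le> L * L" using L by (intro mult_right_mono) auto
      then show ?thesis using L by simp
    qed
    also have "\<dots> = (20000 * L)\<^sup>2" by (simp add: power2_eq_square)
    finally have "13000 * sqrt L \<le> 20000 * L" by (rule power2_le_imp_le) (use L in simp)
    then show ?thesis using False rX(1) X(2) by (simp add: e_def)
  qed
  have d2: "2 * exp (- ((real r * e)\<^sup>2 / (16 * nystrom_const))) \<le> \<delta> / 2"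
  proof -
    have "169000000 * L = (13000 * sqrt L)\<^sup>2" using L by (simp add: power_mult_distrib)
    also have "\<dots> \<le> (real r * e)\<^sup>2" using re L by (intro power_mono) auto
    finally have "169000000 * L / (16 * nystrom_const) \<le> (real r * e)\<^sup>2 / (16 * nystrom_const)"
      by (intro divide_right_mono) (auto simp: nystrom_const_def)
    \<comment> \<open>Here \<open>48513024 = 16 * 329 * 9216\<close>. The quotient exceeds
      \<open>3\<close>, and \<open>L + 2 ln 2 \<le> 3 L\<close>.\<close>
    moreover have "169000000 * L / (16 * nystrom_const) = 169000000 / 48513024 * L"
      by (simp add: nystrom_const_def)
    ultimately have "- ((real r * e)\<^sup>2 / (16 * nystrom_const)) \<le> - L + - (2 * ln 2)"
      using ln2L L by simp
    then have "exp (- ((real r * e)\<^sup>2 / (16 * nystrom_const))) \<le> exp (- L + - (2 * ln 2))"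
      by (simp only: exp_le_cancel_iff)
    also have "\<dots> = \<delta> * exp (- (2 * ln 2))" by (simp only: exp_add expL)
    also have "exp (- (2 * ln 2)) = (1 / 4 :: real)" using exp2[of 2] by simp
    finally show ?thesis by simp
  qed
  show "\<exists>r::nat.
        20000 * (sqrt (ln (1 / \<delta>)) / \<epsilon> + ln (1 / \<delta>)) \<le> real r \<and>
        real r \<le> 20002 * (sqrt (ln (1 / \<delta>)) / \<epsilon> + ln (1 / \<delta>)) \<and>
        (\<forall>q\<ge>2.
          \<P>((\<omega>, \<phi>) in gaussian_entries n r \<Otimes>\<^sub>M gaussian_entries n r.
            \<bar>fun_nystrom_pp f q A (Matrix.mat n r \<omega>) (Matrix.mat n r \<phi>) - mat_trace (mat_fun f A)\<bar>
              \<le> \<epsilon> * mat_trace (mat_fun f A)) \<ge> 1 - \<delta>)"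
    unfolding L_def[symmetric] unfolding X_def[symmetric]
  proof (intro exI[of _ r] conjI allI impI)
    show "20000 * X \<le> real r" by (rule rX(1))
    show "real r \<le> 20002 * X" using rX(2) X(2) L by linarith
    fix q :: nat assume "2 \<le> q"
    then have "1 \<le> q" by simp
    then show "\<P>((\<omega>, \<phi>) in gaussian_entries n r \<Otimes>\<^sub>M gaussian_entries n r.
            \<bar>fun_nystrom_pp f q A (Matrix.mat n r \<omega>) (Matrix.mat n r \<phi>) - mat_trace (mat_fun f A)\<bar>
              \<le> \<epsilon> * mat_trace (mat_fun f A)) \<ge> 1 - \<delta>"
      by (rule fun_nystrom_pp_error[OF om f0 A _ r0 e d1 d2])
  qed
qed simp_all

end
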